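(* The lattice $\mathscr{SPL}$ is both upper dense and lower dense in the lattice $\mathscr{PL}$. That is: (upper density) whenever $I\in\mathscr{SPL}$, $J\in\mathscr{PL}$ and $I\subsetneq J$, there is $L\in\mathscr{SPL}$ with $I\subsetneq L\subsetneq J$; and (lower density) whenever $I\in\mathscr{SPL}$, $J\in\mathscr{PL}$ and $J\subsetneq I$, there is $L\in\mathscr{SPL}$ with $J\subsetneq L\subsetneq I$.
   Context: $H$ is a separable infinite-dimensional complex Hilbert space. "Ideal" means a two-sided ideal of $B(H)$ contained in the compact operators $K(H)$. $c_o^*$ is the set of nonnegative monotone nonincreasing sequences converging to $0$. For a compact operator $X$, $s(X)\in c_o^*$ is its sequence of s-numbers (singular values, with multiplicity), and $\Sigma(I):=\{s(X)\mid X\in I\}$ is the characteristic set of the ideal $I$; $I\mapsto\Sigma(I)$ is an inclusion-preserving bijection between ideals and the hereditary (solid) subcones of $c_o^*$ invariant under all ampliations $D_m$, where $(D_m\xi)_n:=\xi_{\lceil n/m\rceil}$, $m\in\mathbb N$. For $\xi\in c_o^*$, $(\xi)$ denotes the principal ideal generated by the diagonal operator $\mathrm{diag}\,\xi$; every principal ideal has this form, and $\eta\in\Sigma((\xi))$ if and only if $\eta=O(D_m\xi)$ for some $m\in\mathbb N$. For $\xi\in c_o^*$ put $(\xi_a)_n:=\frac1n\sum_{j=1}^n\xi_j$. For an ideal $I$, ${}_aI$ is the ideal with $\Sigma({}_aI)=\{\xi\in c_o^*\mid \xi_a\in\Sigma(I)\}$ and $I_a$ is the ideal with $\Sigma(I_a)=\{\xi\in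 c_o^*\mid \xi=O(\eta_a)\text{ for some }\eta\in\Sigma(I)\}$. $I$ is am-stable if $I={}_aI$ (equivalently, $I=I_a$). A principal ideal $(\xi)$ is am-stable if and only if $\xi$ is regular, i.e., $\xi_a=O(\xi)$. $\mathscr{PL}$ is the lattice (under inclusion, with meet $\cap$ and join $+$) of all nonzero principal ideals, and $\mathscr{SPL}$ is its sublattice of all nonzero am-stable principal ideals. *)

theory Defs
  imports "HOL-Analysis.Analysis" "HOL-Algebra.Ideal"
begin

section \<open>Complex Hilbert spaces\<close>

text \<open>
  A complex Hilbert space is presented on top of the library classes for complete real inner
  product spaces: the real inner product is required to be the real part of the complex one, so
  norm, topology and completeness of the library are those of the complex Hilbert space.
  The complex inner product is linear in its first argument.
\<close>

class chilbert_space = real_inner + complete_space +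
  fixes scaleC :: "complex \<Rightarrow> 'a \<Rightarrow> 'a" (infixr "*\<^sub>C" 75)
    and cinner :: "'a \<Rightarrow> 'a \<Rightarrow> complex"
  assumes scaleC_add_right: "c *\<^sub>C (x + y) = c *\<^sub>C x + c *\<^sub>C y"
    and scaleC_add_left: "(c + d) *\<^sub>C x = c *\<^sub>C x + d *\<^sub>C x"
    and scaleC_scaleC: "c *\<^sub>C (d *\<^sub>C x) = (c * d) *\<^sub>C x"
    and scaleR_scaleC: "r *\<^sub>R x = complex_of_real r *\<^sub>C x"
    and cinner_add_left: "cinner (x + y) z = cinner x z + cinner y z"
    and cinner_scaleC_left: "cinner (c *\<^sub>C x) y = c * cinner x y"
    and cinner_commute: "cinner x y = cnj (cinner y x)"
    and inner_Re_cinner: "inner x y = Re (cinner x y)"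

lemma scaleC_one: "1 *\<^sub>C x = (x :: 'a::chilbert_space)"
  using scaleR_scaleC[of 1 x] by simp

global_interpretation cvec: vector_space "scaleC :: complex \<Rightarrow> 'a \<Rightarrow> 'a::chilbert_space"
  defines cspan = cvec.span
    and cdim = cvec.dim
  by unfold_locales
    (simp_all add: scaleC_add_right scaleC_add_left scaleC_scaleC scaleC_one)


section \<open>Operators and operator ideals\<close>

definition bounded_clinear :: "('a::chilbert_space \<Rightarrow> 'a) \<Rightarrow> bool" where
  "bounded_clinear T \<longleftrightarrow> bounded_linear T \<and> (\<forall>c x. T (c *\<^sub>C x) = c *\<^sub>C T x)"

definition compact_operator :: "('a::chilbert_space \<Rightarrow> 'a) \<Rightarrow> bool" where
  "compact_operator T \<longleftrightarrow> bounded_clinear T \<and> compact (closure (T ` cball 0 1))"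

text \<open>The ring \<open>B(H)\<close>, where \<open>H\<close> is the type \<open>'a\<close>.\<close>

definition BH :: "('a::chilbert_space \<Rightarrow> 'a) ring" where
  "BH = \<lparr>carrier = {T. bounded_clinear T}, mult = (\<circ>), one = id,
         zero = (\<lambda>x. 0), add = (\<lambda>S T x. S x + T x)\<rparr>"

lemma bounded_clinear_intros:
  shows "bounded_clinear (\<lambda>x::'a::chilbert_space. 0)"
    and "bounded_clinear (id :: 'a \<Rightarrow> 'a)"
    and "bounded_clinear S \<Longrightarrow> bounded_clinear T \<Longrightarrow> bounded_clinear (\<lambda>x::'a. S x + T x)"
    and "bounded_clinear S \<Longrightarrow> bounded_clinear T \<Longrightarrow> bounded_clinear (S \<circ> T :: 'a \<Rightarrow> 'a)"
    and "bounded_clinear T \<Longrightarrow> bounded_clinear (\<lambda>x::'a. - T x)"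
  by (auto simp: bounded_clinear_def bounded_linear_add bounded_linear_minus o_def id_def
      scaleC_add_right cvec.scale_minus_right bounded_linear_compose)

lemma ring_BH: "ring (BH :: ('a::chilbert_space \<Rightarrow> 'a) ring)"
proof (rule ringI)
  show "abelian_group (BH :: ('a \<Rightarrow> 'a) ring)"
  proof (rule abelian_groupI)
    fix T :: "'a \<Rightarrow> 'a" assume "T \<in> carrier BH"
    then show "\<exists>S\<in>carrier BH. S \<oplus>\<^bsub>BH\<^esub> T = \<zero>\<^bsub>BH\<^esub>"
      by (intro bexI[of _ "\<lambda>x. - T x"]) (auto simp: BH_def bounded_clinear_intros)
  qed (auto simp: BH_def bounded_clinear_intros algebra_simps)
  show "monoid (BH :: ('a \<Rightarrow> 'a) ring)"
    by (rule monoidI) (auto simp: BH_def bounded_clinear_intros o_assoc)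
qed (auto simp: BH_def bounded_clinear_def linear_add bounded_linear.linear)

text \<open>"Ideal" always means a two-sided ideal of \<open>B(H)\<close> consisting of compact operators.\<close>

definition operator_ideal :: "('a::chilbert_space \<Rightarrow> 'a) set \<Rightarrow> bool" where
  "operator_ideal I \<longleftrightarrow> ideal I BH \<and> I \<subseteq> {T. compact_operator T}"

definition principal_operator_ideal :: "('a::chilbert_space \<Rightarrow> 'a) set \<Rightarrow> bool" where
  "principal_operator_ideal I \<longleftrightarrow> operator_ideal I \<and> principalideal I BH"


section \<open>Singular values and characteristic sets\<close>

text \<open>Sequences are indexed from \<open>0\<close>: the \<open>n\<close>-th term of the text-book sequence is the value at
  \<open>n - 1\<close>.\<close>

definition c0_star :: "(nat \<Rightarrow> real) set" where
  "c0_star = {\<xi>. (\<forall>n. 0 \<le> \<xi> n) \<and> decseq \<xi> \<and> \<xi> \<longlonglongrightarrow> 0}"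

definition cadjoint :: "('a::chilbert_space \<Rightarrow> 'a) \<Rightarrow> 'a \<Rightarrow> 'a" where
  "cadjoint T = (THE S. \<forall>x y. cinner (T x) y = cinner x (S y))"

text \<open>
  The s-numbers of a compact operator \<open>X\<close> are the eigenvalues of \<open>(X\<^sup>*X)\<^sup>1\<^sup>/\<^sup>2\<close>, that is, the square
  roots of the eigenvalues of \<open>X\<^sup>*X\<close>, in nonincreasing order and repeated according to
  multiplicity. Only the positive ones are prescribed, so if \<open>X\<close> has finite rank the sequence is
  continued by zeros, and if it has infinite rank then the value \<open>0\<close> does not occur. As \<open>X\<close> is
  compact, the eigenspaces for positive eigenvalues are finite-dimensional; membership in
  \<open>c0_star\<close> forces \<open>{n. \<xi> n = t}\<close> to be finite.
\<close>

definition s_numbers :: "('a::chilbert_space \<Rightarrow> 'a) \<Rightarrow> nat \<Rightarrow> real" where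
  "s_numbers X = (THE \<xi>. \<xi> \<in> c0_star \<and>
     (\<forall>t>0. card {n. \<xi> n = t} = cdim {v. cadjoint X (X v) = complex_of_real (t\<^sup>2) *\<^sub>C v}))"

definition char_set :: "('a::chilbert_space \<Rightarrow> 'a) set \<Rightarrow> (nat \<Rightarrow> real) set" where
  "char_set I = s_numbers ` I"


section \<open>Arithmetic means and am-stability\<close>

definition arith_mean :: "(nat \<Rightarrow> real) \<Rightarrow> nat \<Rightarrow> real" where
  "arith_mean \<xi> n = (\<Sum>j\<le>n. \<xi> j) / real (n + 1)"

text \<open>The pre-arithmetic mean ideal \<open>\<^sub>aI\<close>.\<close>

definition pre_am_ideal :: "('a::chilbert_space \<Rightarrow> 'a) set \<Rightarrow> ('a \<Rightarrow> 'a) set" where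
  "pre_am_ideal I =
     (THE J. operator_ideal J \<and> char_set J = {\<xi> \<in> c0_star. arith_mean \<xi> \<in> char_set I})"

definition am_stable :: "('a::chilbert_space \<Rightarrow> 'a) set \<Rightarrow> bool" where
  "am_stable I \<longleftrightarrow> I = pre_am_ideal I"

definition PL :: "('a::chilbert_space \<Rightarrow> 'a) set set" where
  "PL = {I. principal_operator_ideal I \<and> I \<noteq> {\<zero>\<^bsub>BH\<^esub>}}"

definition SPL :: "('a::chilbert_space \<Rightarrow> 'a) set set" where
  "SPL = {I \<in> PL. am_stable I}"

text \<open>
  The first two arguments are posets ordered by inclusion, the first contained in the second.
\<close>

definition upper_dense_in :: "'b set set \<Rightarrow> 'b set set \<Rightarrow> bool" where
  "upper_dense_in S P \<longleftrightarrow> (\<forall>I\<in>S. \<forall>J\<in>P. I \<subset> J \<longrightarrow> (\<exists>L\<in>S. I \<subset> L \<and> L \<subset> J))"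

definition lower_dense_in :: "'b set set \<Rightarrow> 'b set set \<Rightarrow> bool" where
  "lower_dense_in S P \<longleftrightarrow> (\<forall>I\<in>S. \<forall>J\<in>P. J \<subset> I \<longrightarrow> (\<exists>L\<in>S. J \<subset> L \<and> L \<subset> I))"

end

theory Submission
  imports Defs
begin

text \<open>
  Choosing orthonormal vectors that successively maximize \<open>\<parallel>X e\<parallel>\<close> diagonalizes \<open>X\<^sup>*X\<close> for compact \<open>X\<close>,
  and the minimax principle then shows that the operators whose s-numbers lie in a solid,
  ampliation invariant cone form an ideal; conversely an ideal is determined by its s-numbers.
  Hence nonzero principal ideals are the \<open>(\<xi>)\<close> with \<open>\<xi> \<noteq> 0\<close>, inclusion is \<open>\<eta> = O(D\<^sub>m \<xi>)\<close>, and
  am-stability is regularity of \<open>\<xi>\<close>.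

  A sequence \<open>\<xi>\<close> is regular iff \<open>n\<^sup>p \<xi>\<^sub>n\<close> is almost increasing for some \<open>p < 1\<close>. So between two regular
  sequences that are not equivalent lies their geometric mean. If only \<open>\<xi>\<close> is regular and \<open>\<rho>\<close> is
  not, take \<open>p < q < 1\<close> and replace \<open>\<rho>\<close> by its largest minorant (if \<open>\<xi> \<le> \<rho>\<close>) or smallest majorant
  (if \<open>\<rho> \<le> \<xi>\<close>) \<open>\<zeta>\<close> with \<open>n\<^sup>q \<zeta>\<^sub>n\<close> increasing; this \<open>\<zeta>\<close> is regular and still not equivalent to \<open>\<xi>\<close>.
\<close>

text \<open>Why an exponent below 1 appears: regularity makes each term at least a fixed fraction of
  the average up to that index, so the partial sums grow at least like some power
  \<open>n powr \<epsilon>\<close>, and the terms, being comparable to averages, decay no faster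
  than the power \<open>\<epsilon> - 1\<close>. The obstacle is that inclusion of ideals compares
  sequences only up to ampliation, while minorants, majorants and geometric means work pointwise.
  Arithmetic means turn an ampliation by \<open>m\<close> into a factor \<open>m\<close>, so
  domination by a regular sequence is a pointwise estimate. The strict gap \<open>p < q\<close>
  keeps the regularized \<zeta> away from \<xi>: with \<open>q = p\<close> distant indices would
  gain nothing. Since \<zeta> may be equivalent to \<rho>, strictness on the side of \<rho> is not
  taken from \<zeta>; the geometric mean of \<xi> and \<zeta> is formed in every case. On the
  operator side, adjoints, s-numbers and pre-arithmetic mean ideals are definite descriptions, so
  each needs existence and uniqueness before it can be used.\<close>

section \<open>Algebra of the complex inner product and bounded linear maps\<close>

lemma cinner_add_right: "cinner x (y + z) = cinner x y + cinner (x :: 'a::chilbert_space) z"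
  by (metis cinner_commute cinner_add_left complex_cnj_add)

lemma cinner_scaleC_right: "cinner x (c *\<^sub>C y) = cnj c * cinner (x :: 'a::chilbert_space) y"
  by (metis cinner_commute cinner_scaleC_left complex_cnj_mult)

lemma cinner_zero_left [simp]: "cinner 0 (x :: 'a::chilbert_space) = 0"
  using cinner_add_left[of 0 0 x] by simp

lemma cinner_zero_right [simp]: "cinner (x :: 'a::chilbert_space) 0 = 0"
  using cinner_add_right[of x 0 0] by simp

lemma cinner_minus_left: "cinner (- x) (y :: 'a::chilbert_space) = - cinner x y"
  using cinner_add_left[of x "- x" y] by (simp add: add_eq_0_iff)

lemma cinner_minus_right: "cinner x (- y :: 'a::chilbert_space) = - cinner x y"
  using cinner_add_right[of x y "- y"] by (simp add: add_eq_0_iff)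

lemma cinner_diff_left: "cinner (x - y) (z :: 'a::chilbert_space) = cinner x z - cinner y z"
  using cinner_add_left[of x "- y" z] by (simp add: cinner_minus_left)

lemma cinner_diff_right: "cinner x (y - z :: 'a::chilbert_space) = cinner x y - cinner x z"
  using cinner_add_right[of x y "- z"] by (simp add: cinner_minus_right)

lemma cinner_sum_left: "cinner (\<Sum>i\<in>A. f i) (y :: 'a::chilbert_space) = (\<Sum>i\<in>A. cinner (f i) y)"
  by (induction A rule: infinite_finite_induct) (auto simp: cinner_add_left)

lemma cinner_sum_right: "cinner y (\<Sum>i\<in>A. f i :: 'a::chilbert_space) = (\<Sum>i\<in>A. cinner y (f i))"
  by (induction A rule: infinite_finite_induct) (auto simp: cinner_add_right)

lemma cinner_eq_0_commute: "cinner x y = 0 \<longleftrightarrow> cinner y (x :: 'a::chilbert_space) = 0"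
  by (metis cinner_commute complex_cnj_zero)

lemma cinner_self: "cinner x (x :: 'a::chilbert_space) = of_real ((norm x)\<^sup>2)"
proof (rule complex_eqI)
  show "Re (cinner x x) = Re (of_real ((norm x)\<^sup>2))"
    by (simp add: inner_Re_cinner[symmetric] power2_norm_eq_inner)
  have "Im (cinner x x) = - Im (cinner x x)"
    using arg_cong[OF cinner_commute[of x x], of Im] by simp
  then show "Im (cinner x x) = Im (of_real ((norm x)\<^sup>2))"
    by simp
qed

lemma cinner_self_eq_0 [simp]: "cinner x x = 0 \<longleftrightarrow> (x :: 'a::chilbert_space) = 0"
  by (simp add: cinner_self)

lemma norm_scaleC [simp]: "norm (c *\<^sub>C (x :: 'a::chilbert_space)) = cmod c * norm x"
proof -
  have "of_real ((norm (c *\<^sub>C x))\<^sup>2) = (of_real ((cmod c * norm x)\<^sup>2) :: complex)"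
  proof -
    have "cinner (c *\<^sub>C x) (c *\<^sub>C x) = c * cnj c * cinner x x"
      by (simp add: cinner_scaleC_left cinner_scaleC_right)
    then show ?thesis
      by (simp add: cinner_self complex_norm_square[symmetric] power_mult_distrib)
  qed
  then have "(norm (c *\<^sub>C x))\<^sup>2 = (cmod c * norm x)\<^sup>2"
    by (simp only: of_real_eq_iff)
  then show ?thesis
    by simp
qed

text \<open>A unimodular factor on \<open>x\<close> makes the complex product real and nonnegative,
  where the inequality for the real inner product applies.\<close>

lemma cinner_cauchy_schwarz: "cmod (cinner x y) \<le> norm x * norm (y :: 'a::chilbert_space)"
proof (cases "cinner x y = 0")
  case False
  define c where "c = cnj (sgn (cinner x y))"
  have "of_real (cmod (cinner x y)) = c * cinner x y"
    using False complex_norm_square[of "cinner x y"]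
    by (simp add: c_def sgn_eq field_simps power2_eq_square)
  then have "cmod (cinner x y) = Re (cinner (c *\<^sub>C x) y)"
    by (metis Re_complex_of_real cinner_scaleC_left)
  also have "\<dots> \<le> norm (c *\<^sub>C x) * norm y"
    unfolding inner_Re_cinner[symmetric] by (rule norm_cauchy_schwarz)
  also have "cmod c = 1"
    using False by (simp add: c_def norm_sgn)
  then have "norm (c *\<^sub>C x) = norm x"
    by simp
  finally show ?thesis .
qed simp

lemma bounded_linear_cinner_left: "bounded_linear (\<lambda>x :: 'a::chilbert_space. cinner x y)"
  by (rule bounded_linear_intro[of _ "norm y"])
    (simp_all add: cinner_add_left scaleR_scaleC cinner_scaleC_left scaleR_conv_of_real
      cinner_cauchy_schwarz)

lemma bounded_linear_scaleC_right: "bounded_linear (\<lambda>x :: 'a::chilbert_space. c *\<^sub>C x)"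
  by (rule bounded_linear_intro[of _ "cmod c"])
    (simp_all add: scaleC_add_right scaleR_scaleC scaleC_scaleC mult.commute)

lemma norm_add_sq_orthogonal:
  assumes "cinner x y = 0"
  shows "(norm (x + y))\<^sup>2 = (norm x)\<^sup>2 + (norm (y :: 'a::chilbert_space))\<^sup>2"
proof -
  have "inner x y = 0"
    by (simp add: inner_Re_cinner assms)
  then show ?thesis
    by (simp add: power2_norm_eq_inner algebra_simps inner_commute)
qed

lemma norm_sum_sq_orthogonal:
  assumes "finite A" "\<And>i j. i \<in> A \<Longrightarrow> j \<in> A \<Longrightarrow> i \<noteq> j \<Longrightarrow> cinner (f i) (f j) = 0"
  shows "(norm (\<Sum>i\<in>A. f i :: 'a::chilbert_space))\<^sup>2 = (\<Sum>i\<in>A. (norm (f i))\<^sup>2)"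
  using assms
proof (induction A)
  case (insert i A)
  have "cinner (f i) (\<Sum>j\<in>A. f j) = 0"
    using insert by (auto simp: cinner_sum_right intro!: sum.neutral)
  then show ?case
    using insert by (simp add: norm_add_sq_orthogonal)
qed simp

lemma bounded_clinearD:
  assumes "bounded_clinear T"
  shows "bounded_linear T" "T (c *\<^sub>C x) = c *\<^sub>C T x" "T (x + y) = T x + T y"
    "T (x - y) = T x - T y" "T 0 = 0" "T (\<Sum>i\<in>A. f i) = (\<Sum>i\<in>A. T (f i))"
  using assms
  by (auto simp: bounded_clinear_def linear_add linear_diff linear_0 linear_sum
      bounded_linear.linear)

lemma bounded_clinearI:
  assumes "\<And>x y. T (x + y) = T x + T y" "\<And>c x. T (c *\<^sub>C x) = c *\<^sub>C T x"
    "\<And>x. norm (T x) \<le> norm x * K"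
  shows "bounded_clinear T"
  unfolding bounded_clinear_def
  by (auto simp: assms scaleR_scaleC intro!: bounded_linear_intro[of T K])

section \<open>Maximizing vectors and adjoints\<close>

text \<open>Maximizing sequences for the norm of a compact operator are Cauchy up to passing to a
  subsequence: by the parallelogram law, two unit vectors whose midpoint is nearly maximizing
  are close.\<close>

lemma compact_attains_norm:
  fixes T :: "'a::{real_inner,complete_space} \<Rightarrow> 'b::real_normed_vector"
  assumes T: "bounded_linear T" "compact (closure (T ` cball 0 1))"
    and S: "subspace S" "closed S" "S \<noteq> {0}"
  shows "\<exists>v\<in>S. norm v = 1 \<and> (\<forall>x\<in>S. norm (T x) \<le> norm (T v) * norm x)"
proof -
  interpret T: bounded_linear T by (fact T(1))
  obtain u where u: "u \<in> S" "norm u = 1"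
  proof -
    obtain w where "w \<in> S" "w \<noteq> 0"
      using S(1,3) subspace_0 by blast
    then have "w /\<^sub>R norm w \<in> S" "norm (w /\<^sub>R norm w) = 1"
      using S(1) by (auto simp: subspace_scale)
    with that show ?thesis by blast
  qed
  define N where "N = (\<lambda>x. norm (T x)) ` (S \<inter> cball 0 1)"
  define M where "M = Sup N"
  have bdd: "bdd_above N"
  proof -
    obtain K where "\<And>x. norm (T x) \<le> norm x * K" "K > 0"
      using T.pos_bounded by blast
    then have "norm (T x) \<le> K" if "norm x \<le> 1" for x
      using that by (meson dual_order.trans mult_left_le_one_le norm_ge_zero order_less_imp_le)
    then show ?thesis
      by (auto simp: N_def intro!: bdd_aboveI[of _ K])
  qed
  have ne: "N \<noteq> {}"
    using u by (auto simp: N_def)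
  have le: "norm (T x) \<le> M * norm x" if "x \<in> S" for x
  proof (cases "x = 0")
    case False
    have "norm (T (x /\<^sub>R norm x)) \<le> M"
      unfolding M_def using False that S(1)
      by (intro cSup_upper bdd) (auto simp: N_def subspace_scale intro!: imageI)
    then show ?thesis
      using False by (simp add: T.scaleR field_simps)
  qed (simp add: T.zero)
  show ?thesis
  \<comment> \<open>If \<open>M\<close> is not positive, \<open>T\<close> vanishes on
    \<open>S\<close> and any unit vector of \<open>S\<close> will do.\<close>
  proof (cases "M \<le> 0")
    case True
    have "T x = 0" if "x \<in> S" for x
      using le[OF that] True by (metis mult_nonpos_nonneg norm_ge_zero norm_le_zero_iff order.trans)
    then show ?thesis
      using u by (intro bexI[of _ u]) auto
  next
    case False
    then have M: "M > 0" by simp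
    have "\<exists>x. x \<in> S \<and> norm x \<le> 1 \<and> norm (T x) > M - 1 / Suc n" for n
      using less_cSupD[OF ne, of "M - 1 / Suc n"] by (auto simp: N_def M_def)
    then obtain x where x: "\<And>n. x n \<in> S" "\<And>n. norm (x n) \<le> 1"
        "\<And>n. norm (T (x n)) > M - 1 / Suc n"
      by metis
    have "T (x n) \<in> closure (T ` cball 0 1)" for n
      using x(2) by (intro subsetD[OF closure_subset]) auto
    then obtain y r where r: "strict_mono r" "((\<lambda>n. T (x n)) \<circ> r) \<longlonglongrightarrow> y"
      using T(2) unfolding compact_def by metis
    define z where "z = x \<circ> r"
    have z: "\<And>n. z n \<in> S" "\<And>n. norm (z n) \<le> 1"
      using x by (auto simp: z_def)
    have Tz: "(\<lambda>n. T (z n)) \<longlonglongrightarrow> y"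
      using r(2) by (simp add: z_def o_def)
    have ny: "norm y = M"
    proof (rule LIMSEQ_unique)
      show "(\<lambda>n. norm (T (z n))) \<longlonglongrightarrow> norm y"
        by (intro tendsto_norm Tz)
      show "(\<lambda>n. norm (T (z n))) \<longlonglongrightarrow> M"
      proof (rule tendsto_sandwich)
        have "norm (T (z n)) \<le> M" for n
        proof -
          have "M * norm (z n) \<le> M * 1"
            using M z(2) by (intro mult_left_mono) auto
          with le[OF z(1)[of n]] show ?thesis by simp
        qed
        then show "\<forall>\<^sub>F n in sequentially. norm (T (z n)) \<le> M"
          by simp
        have "M - 1 / Suc n \<le> norm (T (z n))" for n
        proof -
          have "1 / Suc (r n) \<le> 1 / Suc n"
            using seq_suble[OF r(1), of n] by (simp add: frac_le)
          then show ?thesis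
            using x(3)[of "r n"] by (simp add: z_def)
        qed
        then show "\<forall>\<^sub>F n in sequentially. M - 1 / Suc n \<le> norm (T (z n))"
          by simp
        show "(\<lambda>n. M - 1 / Suc n) \<longlonglongrightarrow> M"
          using tendsto_diff[OF tendsto_const LIMSEQ_inverse_real_of_nat, of M]
          by (simp add: inverse_eq_divide)
      qed auto
    qed
    have "Cauchy z"
    proof (rule CauchyI')
      fix e :: real assume e: "e > 0"
      \<comment> \<open>\<open>d \<le> M\<close> makes \<open>2 - 2 * d / M\<close> nonnegative, so
        that it may be squared; the factor 16 leaves room for the strict bound
        \<open>8 * (d / M) < e\<^sup>2\<close>.\<close>
      define d where "d = min M (M * e\<^sup>2 / 16)"
      have d: "0 < d" "d \<le> M" "16 * d \<le> M * e\<^sup>2"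
        using e M by (auto simp: d_def min_def)
      obtain n0 where n0: "\<And>n. n \<ge> n0 \<Longrightarrow> norm (T (z n) - y) < d"
        using LIMSEQ_D[OF Tz d(1)] by blast
      show "\<exists>n0. \<forall>m\<ge>n0. \<forall>n>m. dist (z m) (z n) < e"
      proof (intro exI allI impI)
        fix m n assume mn: "m \<ge> n0" "n > m"
        have "norm (T (z m + z n) - 2 *\<^sub>R y) \<le> norm (T (z m) - y) + norm (T (z n) - y)"
          using norm_triangle_ineq[of "T (z m) - y" "T (z n) - y"]
          by (simp add: T.add algebra_simps scaleR_2)
        also have "\<dots> \<le> 2 * d"
          using n0[of m] n0[of n] mn by simp
        finally have "2 * M - 2 * d \<le> norm (T (z m + z n))"
          using norm_triangle_ineq2[of "2 *\<^sub>R y" "T (z m + z n)"] ny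
          by (simp add: norm_minus_commute)
        also have "\<dots> \<le> M * norm (z m + z n)"
          using S(1) z by (intro le) (auto simp: subspace_add)
        finally have "2 - 2 * d / M \<le> norm (z m + z n)"
          using M by (simp add: field_simps)
        then have "(2 - 2 * d / M)\<^sup>2 \<le> (norm (z m + z n))\<^sup>2"
          using d M by (intro power_mono) (auto simp: field_simps)
        moreover have "(norm (z m - z n))\<^sup>2 + (norm (z m + z n))\<^sup>2 \<le> 4"
        proof -
          have "(norm (z m - z n))\<^sup>2 + (norm (z m + z n))\<^sup>2 = 2 * (norm (z m))\<^sup>2 + 2 * (norm (z n))\<^sup>2"
            by (simp add: power2_norm_eq_inner algebra_simps inner_commute)
          moreover have "(norm (z k))\<^sup>2 \<le> 1" for k
            using z(2)[of k] by (simp add: power_le_one)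
          from this[of m] this[of n]
          have "2 * (norm (z m))\<^sup>2 + 2 * (norm (z n))\<^sup>2 \<le> 4" by linarith
          ultimately show ?thesis by simp
        qed
        moreover have "4 - (2 - 2 * d / M)\<^sup>2 \<le> 8 * (d / M)"
          by (simp add: power2_eq_square algebra_simps)
        moreover have "8 * (d / M) < e\<^sup>2"
        proof -
          have "8 * d < M * e\<^sup>2" using d by simp
          then show ?thesis using M by (simp add: field_simps)
        qed
        ultimately have "(norm (z m - z n))\<^sup>2 < e\<^sup>2"
          by linarith
        then show "dist (z m) (z n) < e"
          using e by (simp add: dist_norm power_less_imp_less_base)
      qed
    qed
    then obtain v where v: "z \<longlonglongrightarrow> v"
      using Cauchy_convergent convergent_def by blast
    have "v \<in> S"
      using closed_sequentially[OF S(2) _ v] z by blast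
    have "norm v \<le> 1"
      using LIMSEQ_le_const2[OF tendsto_norm[OF v]] z by blast
    have "T v = y"
      using LIMSEQ_unique[OF T.tendsto[OF v] Tz] .
    with ny le[OF \<open>v \<in> S\<close>] M have "norm v \<ge> 1"
      by simp
    with \<open>norm v \<le> 1\<close> have "norm v = 1" by simp
    with \<open>v \<in> S\<close> \<open>T v = y\<close> ny le show ?thesis
      by (intro bexI[of _ v]) auto
  qed
qed

lemma norm_add_scaleR_sq:
  fixes a b :: "'a::real_inner"
  shows "(norm (a + s *\<^sub>R b))\<^sup>2 = (norm a)\<^sup>2 + 2 * s * inner a b + s\<^sup>2 * (norm b)\<^sup>2"
  unfolding power2_norm_eq_inner
  by (simp add: inner_add_left inner_add_right inner_commute[of b a] power2_eq_square distrib_left)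

text \<open>First variation: the squared inequality has no constant term in \<open>s\<close>, so a
  nonzero linear term \<open>2 * s * inner (T v) (T x)\<close> would violate it for small
  \<open>s\<close> of the right sign.\<close>

lemma maximizer_orthogonal:
  fixes T :: "'a::real_inner \<Rightarrow> 'b::real_inner"
  assumes T: "linear T"
    and max: "\<And>s. norm (T (v + s *\<^sub>R x)) \<le> norm (T v) * norm (v + s *\<^sub>R x)"
    and v: "norm v = 1" "inner v x = 0"
  shows "inner (T v) (T x) = 0"
proof (rule ccontr)
  define b where "b = inner (T v) (T x)"
  define c where "c = (norm (T v) * norm x)\<^sup>2 - (norm (T x))\<^sup>2"
  assume "inner (T v) (T x) \<noteq> 0"
  then have b: "b \<noteq> 0" by (simp add: b_def)
  have *: "2 * s * b \<le> s\<^sup>2 * c" for s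
  proof -
    have "(norm (T (v + s *\<^sub>R x)))\<^sup>2 \<le> (norm (T v) * norm (v + s *\<^sub>R x))\<^sup>2"
      by (intro power_mono max) simp
    moreover have "(norm (T (v + s *\<^sub>R x)))\<^sup>2 = (norm (T v))\<^sup>2 + 2 * s * b + s\<^sup>2 * (norm (T x))\<^sup>2"
      by (simp add: linear_add[OF T] linear_cmul[OF T] b_def norm_add_scaleR_sq)
    moreover have "(norm (v + s *\<^sub>R x))\<^sup>2 = 1 + s\<^sup>2 * (norm x)\<^sup>2"
      by (simp add: norm_add_scaleR_sq v)
    ultimately show ?thesis
      by (simp add: c_def power_mult_distrib algebra_simps)
  qed
  \<comment> \<open>A positive bound for \<open>c\<close>; the perturbation \<open>s = b / d\<close>
    then contradicts the quadratic inequality.\<close>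
  define d where "d = \<bar>c\<bar> + 1"
  have d: "d > 0" "c \<le> d" by (auto simp: d_def)
  have "2 * (b / d) * b \<le> (b / d)\<^sup>2 * c"
    by (rule *)
  also have "\<dots> \<le> (b / d)\<^sup>2 * d"
    using d by (intro mult_left_mono) auto
  also have "\<dots> = (b / d) * b"
    using d by (simp add: power2_eq_square)
  finally have "(b / d) * b \<le> 0" by simp
  moreover have "(b / d) * b > 0"
    using b d by (auto simp: zero_less_mult_iff zero_less_divide_iff)
  ultimately show False by simp
qed

text \<open>A bounded functional maps the unit ball to a relatively compact set of reals, so it
  attains its norm at some unit \<open>v\<close>; by first variation it vanishes on the orthogonal
  complement of \<open>v\<close>.\<close>

lemma riesz_representation:
  fixes f :: "'a::{real_inner,complete_space} \<Rightarrow> real"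
  assumes f: "bounded_linear f"
  shows "\<exists>y. \<forall>x. f x = inner x y"
proof (cases "\<forall>x. f x = 0")
  case True
  then show ?thesis
    by (intro exI[of _ 0]) simp
next
  case False
  interpret f: bounded_linear f by (fact f)
  have "bounded (f ` cball 0 1)"
    using bounded_linear_image[OF bounded_cball f] .
  then have c: "compact (closure (f ` cball 0 1))"
    by (simp add: compact_closure)
  have "(UNIV :: 'a set) \<noteq> {0}"
    using False f.zero by (metis UNIV_I singletonD)
  then obtain v where v: "norm v = 1" "\<And>x. norm (f x) \<le> norm (f v) * norm x"
    using compact_attains_norm[OF f c subspace_UNIV closed_UNIV] by auto
  have "f x = inner x (f v *\<^sub>R v)" for x
  proof -
    have "f (x - inner x v *\<^sub>R v) = 0"
    proof -
      have "inner v (x - inner x v *\<^sub>R v) = 0"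
        using v(1) by (simp add: inner_diff_right inner_commute norm_eq_1)
      then have "inner (f v) (f (x - inner x v *\<^sub>R v)) = 0"
        by (rule maximizer_orthogonal[OF bounded_linear.linear[OF f] v(2,1)])
      moreover have "f v \<noteq> 0"
        using v(2) False by force
      ultimately show ?thesis by simp
    qed
    then show ?thesis
      by (simp add: f.diff f.scaleR)
  qed
  then show ?thesis by blast
qed

lemma cadjoint:
  assumes T: "bounded_clinear (T :: 'a::chilbert_space \<Rightarrow> 'a)"
  shows "cinner (T x) y = cinner x (cadjoint T y)"
proof -
  have "\<exists>z. \<forall>x. cinner (T x) y = cinner x z" for y
  proof -
    have "bounded_linear (\<lambda>x. inner (T x) y)"
      using bounded_linear_compose[OF bounded_linear_inner_left bounded_clinearD(1)[OF T]] .
    then obtain z where z: "\<And>x. inner (T x) y = inner x z"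
      using riesz_representation by blast
    have Re: "Re (cinner (T x) y) = Re (cinner x z)" for x
      using z[of x] by (simp add: inner_Re_cinner)
    \<comment> \<open>The real representation theorem matches real parts only; inserting
      \<open>\<i> *\<^sub>C x\<close> supplies the imaginary parts.\<close>
    have "cinner (T x) y = cinner x z" for x
      using Re[of x] Re[of "\<i> *\<^sub>C x"]
      by (intro complex_eqI) (simp_all add: bounded_clinearD[OF T] cinner_scaleC_left)
    then show ?thesis by blast
  qed
  then obtain S where S: "\<forall>x y. cinner (T x) y = cinner x (S y)"
    by metis
  have "\<forall>x y. cinner (T x) y = cinner x (cadjoint T y)"
    unfolding cadjoint_def
  proof (rule theI[where P = "\<lambda>S. \<forall>x y. cinner (T x) y = cinner x (S y)"])
    show "\<forall>x y. cinner (T x) y = cinner x (S y)" by (fact S)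
    fix R assume "\<forall>x y. cinner (T x) y = cinner x (R y)"
    with S have "cinner (R y - S y) (R y - S y) = 0" for y
      by (metis cinner_diff_right right_minus_eq)
    then show "R = S" by auto
  qed
  then show ?thesis by blast
qed

section \<open>Singular systems\<close>

definition orthonormal_seq :: "(nat \<Rightarrow> 'a::chilbert_space) \<Rightarrow> bool" where
  "orthonormal_seq e \<longleftrightarrow> (\<forall>m n. cinner (e m) (e n) = (if m = n then 1 else 0))"

lemma orthonormal_seqD:
  assumes "orthonormal_seq e"
  shows "cinner (e m) (e n) = (if m = n then 1 else 0)" "norm (e n) = 1"
proof -
  show *: "cinner (e m) (e n) = (if m = n then 1 else 0)" for m n
    using assms by (simp add: orthonormal_seq_def)
  have "complex_of_real ((norm (e n))\<^sup>2) = of_real 1"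
    using *[of n n] by (simp add: cinner_self)
  then have "(norm (e n))\<^sup>2 = 1\<^sup>2"
    by (simp only: of_real_eq_iff power_one)
  then show "norm (e n) = 1"
    by (rule power2_eq_imp_eq) simp_all
qed

text \<open>The third clause says \<open>X\<^sup>*X e\<^sub>n = \<xi>\<^sub>n\<^sup>2 e\<^sub>n\<close> in weak form.\<close>

definition singular_system ::
  "('a::chilbert_space \<Rightarrow> 'a) \<Rightarrow> (nat \<Rightarrow> 'a) \<Rightarrow> (nat \<Rightarrow> real) \<Rightarrow> bool" where
  "singular_system X e \<xi> \<longleftrightarrow> orthonormal_seq e \<and> \<xi> \<in> c0_star \<and>
     (\<forall>n v. cinner (X v) (X (e n)) = of_real ((\<xi> n)\<^sup>2) * cinner v (e n)) \<and>
     (\<forall>n v. (\<forall>k<n. cinner v (e k) = 0) \<longrightarrow> norm (X v) \<le> \<xi> n * norm v)"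

lemma c0_starD:
  assumes "\<xi> \<in> c0_star"
  shows "0 \<le> \<xi> n" "decseq \<xi>" "\<xi> \<longlonglongrightarrow> 0" "m \<le> n \<Longrightarrow> \<xi> n \<le> \<xi> m"
  using assms by (auto simp: c0_star_def decseq_def)

lemma singular_systemD:
  assumes "singular_system X e \<xi>"
  shows "orthonormal_seq e" "\<xi> \<in> c0_star"
    "cinner (X v) (X (e n)) = of_real ((\<xi> n)\<^sup>2) * cinner v (e n)"
    "(\<And>k. k < n \<Longrightarrow> cinner v (e k) = 0) \<Longrightarrow> norm (X v) \<le> \<xi> n * norm v"
  using assms by (auto simp: singular_system_def)

lemma singular_system_norm:
  assumes "singular_system X e \<xi>"
  shows "norm (X (e n)) = \<xi> n"
proof -
  note D = singular_systemD[OF assms]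
  have "complex_of_real ((norm (X (e n)))\<^sup>2) = of_real ((\<xi> n)\<^sup>2)"
    using D(3)[of "e n" n] by (simp add: cinner_self orthonormal_seqD[OF D(1)])
  then have "(norm (X (e n)))\<^sup>2 = (\<xi> n)\<^sup>2"
    by (simp only: of_real_eq_iff)
  then show ?thesis
    using c0_starD(1)[OF D(2)] by simp
qed

text \<open>\<open>e\<close> need not be complete. Orthogonality to every \<open>e k\<close> allows
  the bound \<open>\<xi> n * norm v\<close> for all \<open>n\<close>, and \<xi> tends to 0.\<close>

lemma singular_system_kernel:
  assumes "singular_system X e \<xi>" "\<And>k. cinner v (e k) = 0"
  shows "X v = 0"
proof -
  note D = singular_systemD[OF assms(1)]
  have "(\<lambda>n. \<xi> n * norm v) \<longlonglongrightarrow> 0 * norm v"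
    by (intro tendsto_intros c0_starD(3)[OF D(2)])
  then have "norm (X v) \<le> 0 * norm v"
    using D(4) assms(2) by (intro LIMSEQ_le_const) auto
  then show ?thesis by simp
qed

text \<open>Otherwise every vector would equal its projection onto the span of the first
  \<open>n\<close> vectors of \<open>f\<close>.\<close>

lemma infinite_dimensional_orthogonal:
  fixes f :: "nat \<Rightarrow> 'a::chilbert_space"
  assumes inf: "\<nexists>B :: 'a set. finite B \<and> cspan B = UNIV"
    and f: "\<And>j k. j < n \<Longrightarrow> k < n \<Longrightarrow> cinner (f j) (f k) = (if j = k then 1 else 0)"
  shows "\<exists>v. v \<noteq> 0 \<and> (\<forall>k<n. cinner v (f k) = 0)"
proof (rule ccontr)
  assume no: "\<not> ?thesis"
  have "x \<in> cspan (f ` {..<n})" for x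
  proof -
    define y where "y = (\<Sum>k<n. cinner x (f k) *\<^sub>C f k)"
    have "cinner (x - y) (f k) = 0" if "k < n" for k
    proof -
      have "cinner y (f k) = (\<Sum>j<n. if j = k then cinner x (f k) else 0)"
        using that unfolding y_def cinner_sum_left cinner_scaleC_left
        by (intro sum.cong) (auto simp: f)
      then show ?thesis
        using that by (simp add: cinner_diff_left)
    qed
    with no have "x = y"
      by (metis right_minus_eq)
    also have "y \<in> cspan (f ` {..<n})"
      unfolding y_def by (intro cvec.span_sum cvec.span_scale cvec.span_base) auto
    finally show ?thesis .
  qed
  with inf show False
    by (metis UNIV_eq_I finite_imageI finite_lessThan)
qed

text \<open>The real first variation gives the real part; closure of \<open>S\<close> under complex
  scalars admits \<open>\<i> *\<^sub>C x\<close> and gives the imaginary part.\<close>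

lemma maximizer_cinner_orthogonal:
  fixes T :: "'a::chilbert_space \<Rightarrow> 'a"
  assumes T: "bounded_clinear T"
    and S: "\<And>x y. x \<in> S \<Longrightarrow> y \<in> S \<Longrightarrow> x + y \<in> S" "\<And>c x. x \<in> S \<Longrightarrow> c *\<^sub>C x \<in> S"
    and max: "\<And>x. x \<in> S \<Longrightarrow> norm (T x) \<le> norm (T v) * norm x"
    and v: "v \<in> S" "norm v = 1" and x: "x \<in> S" "cinner x v = 0"
  shows "cinner (T x) (T v) = 0"
proof -
  have lin: "linear T"
    using bounded_clinearD(1)[OF T] by (rule bounded_linear.linear)
  have *: "Re (cinner (T z) (T v)) = 0" if "z \<in> S" "cinner z v = 0" for z
  proof -
    have "inner (T v) (T z) = 0"
    proof (rule maximizer_orthogonal[OF lin _ v(2)])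
      show "norm (T (v + s *\<^sub>R z)) \<le> norm (T v) * norm (v + s *\<^sub>R z)" for s
        using that v(1) by (intro max S) (auto simp: scaleR_scaleC S)
      show "inner v z = 0"
        using that(2) by (metis inner_Re_cinner inner_commute zero_complex.simps(1))
    qed
    then show ?thesis
      by (metis inner_Re_cinner inner_commute)
  qed
  show ?thesis
  proof (rule complex_eqI)
    show "Re (cinner (T x) (T v)) = Re 0"
      using *[OF x] by simp
    have "\<i> *\<^sub>C x \<in> S" "cinner (\<i> *\<^sub>C x) v = 0"
      using x S(2) by (auto simp: cinner_scaleC_left)
    from *[OF this] show "Im (cinner (T x) (T v)) = Im 0"
      by (simp add: bounded_clinearD(2)[OF T] cinner_scaleC_left)
  qed
qed

lemma singular_system_exists:
  fixes X :: "'a::chilbert_space \<Rightarrow> 'a"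
  assumes inf: "\<nexists>B :: 'a set. finite B \<and> cspan B = UNIV" and X: "compact_operator X"
  shows "\<exists>e \<xi>. singular_system X e \<xi>"
proof -
  have bl: "bounded_clinear X" and cpt: "compact (closure (X ` cball 0 1))"
    using X by (auto simp: compact_operator_def)
  define S where "S = (\<lambda>(f :: nat \<Rightarrow> 'a) n. {x. \<forall>k<n. cinner x (f k) = 0})"
  define P where "P = (\<lambda>f n v. v \<in> S f n \<and> norm v = 1 \<and>
    (\<forall>x\<in>S f n. norm (X x) \<le> norm (X v) * norm x))"
  have S_add: "x + y \<in> S f n" if "x \<in> S f n" "y \<in> S f n" for x y f n
    using that by (simp add: S_def cinner_add_left)
  have S_scale: "c *\<^sub>C x \<in> S f n" if "x \<in> S f n" for c x f n
    using that by (simp add: S_def cinner_scaleC_left)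
  have unit: "cinner v v = 1" if "norm v = 1" for v :: 'a
    using that by (simp add: cinner_self)
  have "\<exists>e. \<forall>n. P e n (e n)"
  \<comment> \<open>The condition on \<open>e n\<close> refers to all earlier vectors, so the choice
    is by well-founded recursion; the first goal says that \<open>P\<close> reads \<open>f\<close>
    only below \<open>n\<close>.\<close>
  proof (rule dependent_wf_choice[OF wf_less])
    fix f g :: "nat \<Rightarrow> 'a" and n r assume "\<And>z. (z, n) \<in> {(x, y). x < y} \<Longrightarrow> f z = g z"
    then have "S f n = S g n" by (auto simp: S_def)
    then show "P f n r = P g n r" by (simp add: P_def)
  next
    fix n and f :: "nat \<Rightarrow> 'a" assume IH: "\<And>y. (y, n) \<in> {(x, y). x < y} \<Longrightarrow> P f y (f y)"
    have orth: "cinner (f j) (f k) = 0" if "j < k" "k < n" for j k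
      using IH[of k] that by (subst cinner_eq_0_commute) (auto simp: P_def S_def)
    have "cinner (f j) (f k) = (if j = k then 1 else 0)" if "j < n" "k < n" for j k
    proof (cases j k rule: linorder_cases)
      case less then show ?thesis using orth that by simp
    next
      case equal then show ?thesis using IH[of k] that by (simp add: P_def unit)
    next
      case greater then show ?thesis
        using orth[of k j] that cinner_eq_0_commute[of "f j" "f k"] by simp
    qed
    then obtain v where v: "v \<noteq> 0" "v \<in> S f n"
      using infinite_dimensional_orthogonal[OF inf, of n f] unfolding S_def by blast
    have "S f n = (\<Inter>k\<in>{..<n}. {x. cinner x (f k) = 0})"
      by (auto simp: S_def)
    moreover have "closed {x. cinner x (f k) = 0}" for k
      by (intro closed_Collect_eq linear_continuous_on bounded_linear_cinner_left continuous_on_const)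
    ultimately have "closed (S f n)"
      by (auto intro: closed_INT)
    moreover have "subspace (S f n)"
      by (intro subspaceI) (auto simp: S_add scaleR_scaleC S_scale, auto simp: S_def)
    ultimately show "\<exists>r. P f n r"
      using compact_attains_norm[OF bounded_clinearD(1)[OF bl] cpt, of "S f n"] v
      by (auto simp: P_def)
  qed
  then obtain e where P: "\<And>n. P e n (e n)" by blast
  define \<xi> where "\<xi> n = norm (X (e n))" for n
  have e: "e n \<in> S e n" "norm (e n) = 1" and max: "\<And>x. x \<in> S e n \<Longrightarrow> norm (X x) \<le> \<xi> n * norm x" for n
    using P[of n] by (auto simp: P_def \<xi>_def)
  have orth: "cinner (e j) (e k) = 0" if "j \<noteq> k" for j k
    using e(1)[of j] e(1)[of k] that cinner_eq_0_commute[of "e j" "e k"]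
    by (cases j k rule: linorder_cases) (auto simp: S_def)
  have on: "orthonormal_seq e"
    by (auto simp: orthonormal_seq_def orth unit e)
  have Xorth: "cinner (X v) (X (e n)) = 0" if "v \<in> S e (Suc n)" for v n
    using that max[of _ n] S_add S_scale e
    by (intro maximizer_cinner_orthogonal[OF bl, of "S e n"]) (auto simp: S_def \<xi>_def)
  have eig: "cinner (X v) (X (e n)) = of_real ((\<xi> n)\<^sup>2) * cinner v (e n)" for v n
  proof -
    \<comment> \<open>Removing the components of \<open>v\<close> along \<open>e 0\<close>, ...,
      \<open>e n\<close> reduces the claim to \<open>Xorth\<close> for \<open>w\<close> and to
      pairwise orthogonality of the images \<open>X (e k)\<close>.\<close>
    define w where "w = v - (\<Sum>k\<le>n. cinner v (e k) *\<^sub>C e k)"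
    have "cinner w (e j) = 0" if "j < Suc n" for j
    proof -
      have "(\<Sum>k\<le>n. cinner v (e k) * cinner (e k) (e j)) = (\<Sum>k\<le>n. if k = j then cinner v (e j) else 0)"
        by (intro sum.cong) (auto simp: orthonormal_seqD(1)[OF on])
      then show ?thesis
        using that by (simp add: w_def cinner_diff_left cinner_sum_left cinner_scaleC_left less_Suc_eq_le)
    qed
    then have "cinner (X w) (X (e n)) = 0"
      by (intro Xorth) (auto simp: S_def)
    moreover have Xe: "cinner (X (e k)) (X (e n)) = (if k = n then of_real ((\<xi> n)\<^sup>2) else 0)" if "k \<le> n" for k
    proof (cases "k = n")
      case False
      with that have "e n \<in> S e (Suc k)"
        by (auto simp: S_def orth)
      then show ?thesis
        using Xorth False cinner_eq_0_commute[of "X (e k)" "X (e n)"] by simp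
    qed (simp add: cinner_self \<xi>_def)
    have "(\<Sum>k\<le>n. cinner v (e k) * cinner (X (e k)) (X (e n))) =
        (\<Sum>k\<le>n. if k = n then cinner v (e n) * of_real ((\<xi> n)\<^sup>2) else 0)"
      by (intro sum.cong) (auto simp: Xe)
    ultimately show ?thesis
      by (simp add: w_def bounded_clinearD[OF bl] cinner_diff_left cinner_sum_left
          cinner_scaleC_left mult.commute)
  qed
  have dec: "\<xi> n \<le> \<xi> m" if "m \<le> n" for m n
    using max[of "e n" m] e[of n] that by (auto simp: S_def \<xi>_def)
  have nonneg: "\<xi> n \<ge> 0" for n by (simp add: \<xi>_def)
  have lim: "\<xi> \<longlonglongrightarrow> 0"
  proof -
    obtain L where L: "\<xi> \<longlonglongrightarrow> L" "\<And>n. L \<le> \<xi> n"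
      using decseq_convergent[of \<xi> 0] dec nonneg by (auto simp: decseq_def)
    have "L \<ge> 0" using LIMSEQ_le_const[OF L(1)] nonneg by blast
    have "X (e n) \<in> closure (X ` cball 0 1)" for n
      using e(2) by (intro subsetD[OF closure_subset]) auto
    then obtain y r where r: "strict_mono r" "((\<lambda>n. X (e n)) \<circ> r) \<longlonglongrightarrow> y"
      using cpt unfolding compact_def by metis
    have "Cauchy ((\<lambda>n. X (e n)) \<circ> r)"
      using r(2) by (intro LIMSEQ_imp_Cauchy)
    \<comment> \<open>The images \<open>X (e n)\<close> are orthogonal with norms at least
      \<open>L\<close>, so for positive \<open>L\<close> two of distinct index are never closer than
      \<open>L\<close>, against the Cauchy subsequence.\<close>
    have "\<not> L > 0"
    proof
      assume "L > 0"
      then obtain M where M: "\<And>m n. m \<ge> M \<Longrightarrow> n \<ge> M \<Longrightarrow> norm (X (e (r m)) - X (e (r n))) < L"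
        using CauchyD[OF \<open>Cauchy _\<close>, of L] by (auto simp: o_def)
      have ne: "r M \<noteq> r (Suc M)"
        using r(1) by (simp add: strict_mono_eq)
      have "(norm (X (e (r M)) + (- X (e (r (Suc M))))))\<^sup>2 = (\<xi> (r M))\<^sup>2 + (\<xi> (r (Suc M)))\<^sup>2"
        by (subst norm_add_sq_orthogonal) (simp_all add: cinner_minus_right eig orth ne \<xi>_def)
      also have "\<dots> \<ge> L\<^sup>2"
        using power_mono[OF L(2)[of "r M"] \<open>L \<ge> 0\<close>, of 2] by (simp add: add_increasing2)
      finally have "L \<le> norm (X (e (r M)) - X (e (r (Suc M))))"
        using power2_le_imp_le[of L] by simp
      with M[of M "Suc M"] show False by simp
    qed
    with L \<open>L \<ge> 0\<close> show ?thesis by simp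
  qed
  have "singular_system X e \<xi>"
    using on dec nonneg lim eig max
    by (auto simp: singular_system_def c0_star_def decseq_def S_def)
  then show ?thesis by blast
qed

section \<open>Null sequences and their level sets; identification of the s-numbers\<close>

lemma c0_star_finite_level:
  assumes "\<xi> \<in> c0_star" "t > 0"
  shows "finite {n. \<xi> n \<ge> t}"
proof -
  obtain N where N: "\<And>n. n \<ge> N \<Longrightarrow> \<bar>\<xi> n\<bar> < t"
    using LIMSEQ_D[OF c0_starD(3)[OF assms(1)] assms(2)] by auto
  have "n < N" if "\<xi> n \<ge> t" for n
    using N[of n] that by (cases "n < N") auto
  then have "{n. \<xi> n \<ge> t} \<subseteq> {..<N}"
    by auto
  then show ?thesis
    by (rule finite_subset) simp
qed

lemma c0_star_card_ge:
  assumes "\<xi> \<in> c0_star" "t > 0"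
  shows "\<xi> n \<ge> t \<longleftrightarrow> n < card {k. \<xi> k \<ge> t}"
proof
  note fin = c0_star_finite_level[OF assms]
  assume "\<xi> n \<ge> t"
  then have "{..n} \<subseteq> {k. \<xi> k \<ge> t}"
    using c0_starD(4)[OF assms(1), of _ n] by fastforce
  from card_mono[OF fin this] show "n < card {k. \<xi> k \<ge> t}"
    by simp
next
  assume *: "n < card {k. \<xi> k \<ge> t}"
  show "\<xi> n \<ge> t"
  proof (rule ccontr)
    assume "\<not> \<xi> n \<ge> t"
    then have "{k. \<xi> k \<ge> t} \<subseteq> {..<n}"
      using c0_starD(4)[OF assms(1), of n] by (force simp flip: not_le)
    from card_mono[OF _ this] * show False
      by simp
  qed
qed

text \<open>A nonincreasing sequence is determined by the sizes of its superlevel sets, and each of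
  these, being finite, is a finite sum of the given level counts.\<close>

lemma c0_star_eqI:
  assumes \<xi>: "\<xi> \<in> c0_star" and \<eta>: "\<eta> \<in> c0_star"
    and card: "\<And>t. t > 0 \<Longrightarrow> card {n. \<xi> n = t} = card {n. \<eta> n = t}"
  shows "\<xi> = \<eta>"
proof -
  have ge: "card {n. \<xi> n \<ge> t} = card {n. \<eta> n \<ge> t}" if t: "t > 0" for t
  proof -
    \<comment> \<open>One finite index set for both sums: all values at least \<open>t\<close> taken
      by either sequence.\<close>
    define V where "V = \<xi> ` {n. \<xi> n \<ge> t} \<union> \<eta> ` {n. \<eta> n \<ge> t}"
    have V: "finite V"
      using c0_star_finite_level[OF \<xi> t] c0_star_finite_level[OF \<eta> t] by (simp add: V_def)
    have Vt: "s \<ge> t" if "s \<in> V" for s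
      using that by (auto simp: V_def)
    have *: "card {n. \<zeta> n \<ge> t} = (\<Sum>s\<in>V. card {n. \<zeta> n = s})"
      if "\<zeta> \<in> c0_star" "\<zeta> ` {n. \<zeta> n \<ge> t} \<subseteq> V" for \<zeta>
    proof -
      have "{n. \<zeta> n \<ge> t} = (\<Union>s\<in>V. {n. \<zeta> n = s})"
        using that(2) Vt by fast
      moreover have "finite {n. \<zeta> n = s}" if "s \<in> V" for s
        by (rule rev_finite_subset[OF c0_star_finite_level[OF \<open>\<zeta> \<in> c0_star\<close> t]])
          (use Vt[OF that] in auto)
      ultimately show ?thesis
        using V by (simp add: card_UN_disjoint disjoint_iff)
    qed
    have "(\<Sum>s\<in>V. card {n. \<xi> n = s}) = (\<Sum>s\<in>V. card {n. \<eta> n = s})"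
      using Vt t by (intro sum.cong card refl) (meson less_le_trans)
    then show ?thesis
      using *[OF \<xi>] *[OF \<eta>] by (simp add: V_def)
  qed
  have iff: "\<xi> n \<ge> t \<longleftrightarrow> \<eta> n \<ge> t" if "t > 0" for n t
    by (simp only: c0_star_card_ge[OF \<xi> that, of n] c0_star_card_ge[OF \<eta> that, of n] ge[OF that])
  show ?thesis
  proof
    fix n
    show "\<xi> n = \<eta> n"
      using iff[of "\<xi> n" n] iff[of "\<eta> n" n] c0_starD(1)[OF \<xi>, of n] c0_starD(1)[OF \<eta>, of n]
      by linarith
  qed
qed

lemma orthonormal_card_cdim:
  assumes e: "orthonormal_seq e" and A: "finite A"
  shows "cdim (cspan (e ` A)) = card A"
proof -
  have eq: "e i = e j \<longleftrightarrow> i = j" for i j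
    using orthonormal_seqD(1)[OF e, of i j] orthonormal_seqD(1)[OF e, of j j] by (auto split: if_splits)
  then have inj: "inj_on e A"
    by (simp add: inj_on_def)
  have "cvec.independent (e ` A)"
  proof (subst cvec.independent_explicit_finite_subsets, safe)
    fix B u v assume B: "B \<subseteq> e ` A" "finite B" and 0: "(\<Sum>w\<in>B. u w *\<^sub>C w) = 0" and v: "v \<in> B"
    obtain k where k: "v = e k" using B v by auto
    have "0 = (\<Sum>w\<in>B. u w * cinner w v)"
      using arg_cong[OF 0, of "\<lambda>x. cinner x v"] by (simp add: cinner_sum_left cinner_scaleC_left)
    also have "\<dots> = (\<Sum>w\<in>B. if w = v then u v else 0)"
    proof (intro sum.cong refl)
      fix w assume "w \<in> B"
      then obtain j where "w = e j" using B by auto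
      then show "u w * cinner w v = (if w = v then u v else 0)"
        by (simp add: k eq orthonormal_seqD(1)[OF e])
    qed
    also have "\<dots> = u v"
      using B v by simp
    finally show "u v = 0" by simp
  qed
  from cvec.dim_span_eq_card_independent[OF this] show ?thesis
    by (simp only: card_image[OF inj])
qed

text \<open>For \<open>t > 0\<close> the eigenspace is exactly the span of the \<open>e n\<close>
  with \<open>\<xi> n = t\<close>, so its dimension counts these indices; uniqueness in the definite
  description is \<open>c0_star_eqI\<close>.\<close>

lemma singular_system_s_numbers:
  assumes X: "bounded_clinear (X :: 'a::chilbert_space \<Rightarrow> 'a)" and sys: "singular_system X e \<xi>"
  shows "s_numbers X = \<xi>"
proof -
  note D = singular_systemD[OF sys]
  have eigenspace: "{v. cadjoint X (X v) = of_real (t\<^sup>2) *\<^sub>C v} = cspan (e ` {n. \<xi> n = t})"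
    if t: "t > 0" for t
  proof -
    define A where "A = {n. \<xi> n = t}"
    have A: "finite A"
      using c0_star_finite_level[OF D(2) t] unfolding A_def by (rule rev_finite_subset) auto
    \<comment> \<open>Pairing with arbitrary \<open>w\<close> removes the adjoint and matches the
      form used in \<open>singular_system\<close>.\<close>
    have weak: "cadjoint X (X v) = of_real (t\<^sup>2) *\<^sub>C v \<longleftrightarrow>
        (\<forall>w. cinner (X v) (X w) = of_real (t\<^sup>2) * cinner v w)" for v
    proof -
      have "cinner (X v) (X w) = of_real (t\<^sup>2) * cinner v w \<longleftrightarrow>
          cinner w (cadjoint X (X v)) = cinner w (of_real (t\<^sup>2) *\<^sub>C v)" for w
      proof -
        have "cinner (X v) (X w) = cnj (cinner w (cadjoint X (X v)))"
          by (metis cinner_commute cadjoint[OF X])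
        moreover have "of_real (t\<^sup>2) * cinner v w = cnj (cinner w (of_real (t\<^sup>2) *\<^sub>C v))"
          by (metis cinner_commute cinner_scaleC_left)
        ultimately show ?thesis by simp
      qed
      moreover have "x = y \<longleftrightarrow> (\<forall>w. cinner w x = cinner w y)" for x y :: 'a
        by (metis cinner_diff_right cinner_self_eq_0 right_minus_eq)
      ultimately show ?thesis by simp
    qed
    have "v \<in> cspan (e ` A)" if "\<forall>w. cinner (X v) (X w) = of_real (t\<^sup>2) * cinner v w" for v
    proof -
      have zero: "cinner v (e n) = 0" if "n \<notin> A" for n
      proof -
        have "of_real ((\<xi> n)\<^sup>2) * cinner v (e n) = of_real (t\<^sup>2) * cinner v (e n)"
          using D(3) \<open>\<forall>w. _\<close> by metis
        moreover have "(\<xi> n)\<^sup>2 \<noteq> t\<^sup>2"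
          using that t c0_starD(1)[OF D(2), of n] by (simp add: A_def)
        then have "complex_of_real ((\<xi> n)\<^sup>2) \<noteq> of_real (t\<^sup>2)"
          by (simp only: of_real_eq_iff not_False_eq_True)
        ultimately show ?thesis by (metis mult_cancel_right)
      qed
      \<comment> \<open>The projection of \<open>v\<close> onto the candidate eigenspace. The
        remainder \<open>v - y\<close> is orthogonal to every \<open>e n\<close>, so
        \<open>X\<close> kills it; the eigenvalue equation makes it orthogonal to \<open>v\<close>,
        and being orthogonal to \<open>y\<close> as well it is 0.\<close>
      define y where "y = (\<Sum>k\<in>A. cinner v (e k) *\<^sub>C e k)"
      have orth: "cinner (v - y) (e n) = 0" for n
      proof -
        have "cinner y (e n) = (\<Sum>k\<in>A. if k = n then cinner v (e n) else 0)"
          unfolding y_def cinner_sum_left cinner_scaleC_left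
          by (intro sum.cong) (auto simp: orthonormal_seqD(1)[OF D(1)])
        then show ?thesis
          using A zero[of n] by (simp add: cinner_diff_left)
      qed
      then have "X (v - y) = 0"
        by (rule singular_system_kernel[OF sys])
      then have "of_real (t\<^sup>2) * cinner v (v - y) = 0"
        using \<open>\<forall>w. _\<close> by (metis cinner_zero_right)
      then have "cinner v (v - y) = 0" using t by simp
      moreover have "cinner y (v - y) = 0"
        using orth by (auto simp: y_def cinner_sum_left cinner_scaleC_left cinner_eq_0_commute[of "e _"]
            intro!: sum.neutral)
      ultimately have "cinner (v - y) (v - y) = 0"
        by (simp add: cinner_diff_left)
      then have "v = y" by simp
      also have "y \<in> cspan (e ` A)"
        unfolding y_def by (intro cvec.span_sum cvec.span_scale cvec.span_base) auto
      finally show ?thesis .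
    qed
    moreover have "\<forall>w. cinner (X v) (X w) = of_real (t\<^sup>2) * cinner v w" if "v \<in> cspan (e ` A)" for v
      using that
    proof (induction rule: cvec.span_induct_alt)
      case base
      then show ?case by (simp add: bounded_clinearD[OF X])
    next
      case (step c x y)
      then obtain n where n: "x = e n" "\<xi> n = t" by (auto simp: A_def)
      have "cinner (X x) (X w) = of_real (t\<^sup>2) * cinner x w" for w
        using arg_cong[OF D(3)[of w n], of cnj] n
        by (metis cinner_commute complex_cnj_complex_of_real complex_cnj_mult)
      with step show ?case
        by (simp add: bounded_clinearD[OF X] cinner_add_left cinner_scaleC_left algebra_simps)
    qed
    ultimately show ?thesis
      unfolding weak A_def by blast
  qed
  have card: "card {n. \<xi> n = t} = cdim {v. cadjoint X (X v) = of_real (t\<^sup>2) *\<^sub>C v}" if "t > 0" for t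
  proof -
    have "finite {n. \<xi> n = t}"
      using c0_star_finite_level[OF D(2) that] by (rule rev_finite_subset) auto
    then show ?thesis
      unfolding eigenspace[OF that] by (rule orthonormal_card_cdim[OF D(1), symmetric])
  qed
  show ?thesis
    unfolding s_numbers_def
  proof (rule the_equality)
    show "\<xi> \<in> c0_star \<and>
      (\<forall>t>0. card {n. \<xi> n = t} = cdim {v. cadjoint X (X v) = of_real (t\<^sup>2) *\<^sub>C v})"
      using D(2) card by blast
    fix \<eta> assume *: "\<eta> \<in> c0_star \<and>
      (\<forall>t>0. card {n. \<eta> n = t} = cdim {v. cadjoint X (X v) = of_real (t\<^sup>2) *\<^sub>C v})"
    show "\<eta> = \<xi>"
    proof (rule c0_star_eqI)
      show "card {n. \<eta> n = t} = card {n. \<xi> n = t}" if "t > 0" for t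
        using * that card[OF that] by (simp only:)
    qed (use * D(2) in blast)+
  qed
qed

section \<open>Inequalities for singular numbers\<close>

text \<open>Gaussian elimination, by induction on the number of equations: a nonzero entry of row
  \<open>i\<close> serves as pivot and removes one unknown together with one equation.\<close>

lemma homogeneous_system_nontrivial:
  fixes \<phi> :: "'k \<Rightarrow> 'j \<Rightarrow> complex"
  assumes "finite K" "finite J" "card K < card J"
  shows "\<exists>a. (\<exists>j\<in>J. a j \<noteq> 0) \<and> (\<forall>k\<in>K. (\<Sum>j\<in>J. a j * \<phi> k j) = 0)"
  using assms
proof (induction K arbitrary: J \<phi> rule: finite_induct)
  case empty
  then have "J \<noteq> {}" by auto
  then show ?case by (intro exI[of _ "\<lambda>_. 1"]) auto
next
  case (insert i K J \<phi>)
  show ?case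
  proof (cases "\<forall>j\<in>J. \<phi> i j = 0")
    case True
    have "card K < card J" using insert by simp
    with insert obtain a where "\<exists>j\<in>J. a j \<noteq> 0" "\<forall>k\<in>K. (\<Sum>j\<in>J. a j * \<phi> k j) = 0"
      by metis
    with True show ?thesis
      by (intro exI[of _ a]) simp
  next
    case False
    then obtain p where p: "p \<in> J" "\<phi> i p \<noteq> 0" by blast
    define L where "L = J - {p}"
    have L: "finite L" "card K < card L" "p \<notin> L" "J = insert p L"
      using insert p by (auto simp: L_def)
    \<comment> \<open>The remaining rows after subtracting the multiple of row \<open>i\<close> that
      cancels column \<open>p\<close>; the value \<open>- b\<close> assigned to the unknown
      \<open>p\<close> later satisfies row \<open>i\<close>.\<close>
    define \<psi> where "\<psi> k j = \<phi> k j - \<phi> k p * \<phi> i j / \<phi> i p" for k j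
    obtain a where a: "\<exists>j\<in>L. a j \<noteq> 0" "\<forall>k\<in>K. (\<Sum>j\<in>L. a j * \<psi> k j) = 0"
      using insert.IH[OF L(1,2), of \<psi>] by blast
    define b where "b = (\<Sum>j\<in>L. a j * \<phi> i j) / \<phi> i p"
    define c where "c = a(p := - b)"
    have sum: "(\<Sum>j\<in>J. c j * \<phi> k j) = (\<Sum>j\<in>L. a j * \<phi> k j) - b * \<phi> k p" for k
    proof -
      have "(\<Sum>j\<in>L. c j * \<phi> k j) = (\<Sum>j\<in>L. a j * \<phi> k j)"
        using L by (intro sum.cong) (auto simp: c_def)
      then show ?thesis
        using L by (simp add: c_def)
    qed
    have "(\<Sum>j\<in>J. c j * \<phi> k j) = 0" if "k \<in> K" for k
    proof -
      have "0 = (\<Sum>j\<in>L. a j * \<psi> k j)" using a that by simp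
      also have "\<dots> = (\<Sum>j\<in>L. a j * \<phi> k j - (a j * \<phi> i j) * (\<phi> k p / \<phi> i p))"
        by (intro sum.cong) (simp_all add: \<psi>_def algebra_simps)
      also have "\<dots> = (\<Sum>j\<in>L. a j * \<phi> k j) - b * \<phi> k p"
        by (simp add: sum_subtractf sum_distrib_right sum_divide_distrib b_def)
      finally show ?thesis by (simp add: sum)
    qed
    moreover have "(\<Sum>j\<in>J. c j * \<phi> i j) = 0"
      using p by (simp add: sum b_def)
    moreover have "\<exists>j\<in>J. c j \<noteq> 0"
      using a(1) L by (auto simp: c_def)
    ultimately show ?thesis by (intro exI[of _ c]) auto
  qed
qed

text \<open>One half of the minimax principle: the span of \<open>e\<^sub>0, \<dots>, e\<^sub>n\<close> meets the orthogonal
  complement of any \<open>n\<close> vectors.\<close>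

lemma s_numbers_le:
  assumes sys: "singular_system X e \<xi>" and X: "bounded_clinear X"
    and U: "finite U" "card U \<le> n"
    and C: "\<And>v. (\<And>u. u \<in> U \<Longrightarrow> cinner v u = 0) \<Longrightarrow> norm (X v) \<le> C * norm v"
  shows "\<xi> n \<le> C"
proof -
  note D = singular_systemD[OF sys]
  obtain a where a: "\<exists>j\<in>{..n}. a j \<noteq> 0" "\<forall>u\<in>U. (\<Sum>j\<le>n. a j * cinner (e j) u) = 0"
    using homogeneous_system_nontrivial[OF U(1) finite_atMost[of n], of "\<lambda>u j. cinner (e j) u"] U(2)
    by auto
  define v where "v = (\<Sum>j\<le>n. a j *\<^sub>C e j)"
  have nv: "(norm v)\<^sup>2 = (\<Sum>j\<le>n. (cmod (a j))\<^sup>2)"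
    unfolding v_def
    by (subst norm_sum_sq_orthogonal)
      (auto simp: cinner_scaleC_left cinner_scaleC_right orthonormal_seqD[OF D(1)])
  have nXv: "(norm (X v))\<^sup>2 = (\<Sum>j\<le>n. (cmod (a j) * \<xi> j)\<^sup>2)"
    unfolding v_def bounded_clinearD(6)[OF X]
    by (subst norm_sum_sq_orthogonal)
      (auto simp: cinner_scaleC_left cinner_scaleC_right D(3) orthonormal_seqD[OF D(1)]
        bounded_clinearD(2)[OF X] singular_system_norm[OF sys])
  have "cinner v u = 0" if "u \<in> U" for u
    using a(2) that by (simp add: v_def cinner_sum_left cinner_scaleC_left)
  then have "norm (X v) \<le> C * norm v" by (rule C)
  moreover have "\<xi> n * norm v \<le> norm (X v)"
  proof (rule power2_le_imp_le)
    have "(\<xi> n * norm v)\<^sup>2 = (\<Sum>j\<le>n. (cmod (a j) * \<xi> n)\<^sup>2)"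
      by (simp add: power_mult_distrib nv sum_distrib_left mult.commute)
    also have "\<dots> \<le> (norm (X v))\<^sup>2"
      unfolding nXv using c0_starD[OF D(2)] by (intro sum_mono power_mono mult_left_mono) auto
    finally show "(\<xi> n * norm v)\<^sup>2 \<le> (norm (X v))\<^sup>2" .
  qed simp
  moreover have "norm v > 0"
  proof -
    obtain i where i: "i \<le> n" "a i \<noteq> 0" using a(1) by auto
    have "0 < (cmod (a i))\<^sup>2" using i by simp
    also have "\<dots> \<le> (norm v)\<^sup>2"
      unfolding nv using i by (intro member_le_sum) auto
    finally show ?thesis by simp
  qed
  ultimately have "\<xi> n * norm v \<le> C * norm v" by linarith
  with \<open>norm v > 0\<close> show ?thesis by simp
qed

section \<open>Sums and products with compact operators, and the s-numbers of these\<close>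

lemma compact_operatorD:
  assumes "compact_operator X"
  shows "bounded_clinear X" "compact (closure (X ` cball 0 1))"
  using assms by (auto simp: compact_operator_def)

lemma compact_operatorI:
  assumes "bounded_clinear X" "compact K" "X ` cball 0 1 \<subseteq> K"
  shows "compact_operator X"
proof -
  have "closure (X ` cball 0 1) \<subseteq> K"
    using assms(2,3) by (simp add: closure_minimal compact_imp_closed)
  then have "closure (X ` cball 0 1) = K \<inter> closure (X ` cball 0 1)"
    by blast
  then show ?thesis
    using assms(1) compact_Int_closed[OF assms(2) closed_closure, of "X ` cball 0 1"]
    by (simp add: compact_operator_def)
qed

lemma compact_operator_add:
  assumes "compact_operator X" "compact_operator (Y :: 'a::chilbert_space \<Rightarrow> 'a)"
  shows "compact_operator (\<lambda>x. X x + Y x)"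
proof (rule compact_operatorI)
  show "bounded_clinear (\<lambda>x. X x + Y x)"
    using assms by (intro bounded_clinear_intros(3) compact_operatorD(1))
  show "compact {a + b |a b. a \<in> closure (X ` cball 0 1) \<and> b \<in> closure (Y ` cball 0 1)}"
    using compact_sums[OF compact_operatorD(2)[OF assms(1)] compact_operatorD(2)[OF assms(2)]]
    by (simp add: conj_commute Bex_def)
  show "(\<lambda>x. X x + Y x) ` cball 0 1 \<subseteq>
      {a + b |a b. a \<in> closure (X ` cball 0 1) \<and> b \<in> closure (Y ` cball 0 1)}"
    using closure_subset by blast
qed

lemma compact_operator_compose_left:
  assumes "bounded_clinear A" "compact_operator (X :: 'a::chilbert_space \<Rightarrow> 'a)"
  shows "compact_operator (A \<circ> X)"
proof (rule compact_operatorI)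
  show "bounded_clinear (A \<circ> X)"
    by (rule bounded_clinear_intros(4)[OF assms(1) compact_operatorD(1)[OF assms(2)]])
  show "compact (A ` closure (X ` cball 0 1))"
    using assms
    by (intro compact_continuous_image linear_continuous_on bounded_clinearD(1) compact_operatorD(2))
  show "(A \<circ> X) ` cball 0 1 \<subseteq> A ` closure (X ` cball 0 1)"
    using closure_subset by fastforce
qed

lemma compact_operator_compose_right:
  assumes "bounded_clinear B" "compact_operator (X :: 'a::chilbert_space \<Rightarrow> 'a)"
  shows "compact_operator (X \<circ> B)"
proof -
  have X: "bounded_linear X"
    using assms by (intro bounded_clinearD(1) compact_operatorD(1))
  obtain K where K: "K > 0" "\<And>x. norm (B x) \<le> norm x * K"
    using bounded_linear.pos_bounded[OF bounded_clinearD(1)[OF assms(1)]] by blast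
  show ?thesis
  proof (rule compact_operatorI)
    show "bounded_clinear (X \<circ> B)"
      by (rule bounded_clinear_intros(4)[OF compact_operatorD(1)[OF assms(2)] assms(1)])
    show "compact ((\<lambda>x. K *\<^sub>R x) ` closure (X ` cball 0 1))"
      using assms by (intro compact_scaling compact_operatorD(2))
    show "(X \<circ> B) ` cball 0 1 \<subseteq> (\<lambda>x. K *\<^sub>R x) ` closure (X ` cball 0 1)"
    proof
      fix y assume "y \<in> (X \<circ> B) ` cball 0 1"
      then obtain x where x: "y = X (B x)" "norm x \<le> 1" by auto
      have "norm (B x) \<le> K"
      proof -
        have "norm x * K \<le> 1 * K"
          using K(1) x(2) by (intro mult_right_mono) auto
        with K(2)[of x] show ?thesis by simp
      qed
      then have "B x /\<^sub>R K \<in> cball 0 1"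
        using K(1) by (simp add: field_simps)
      moreover have "y = K *\<^sub>R X (B x /\<^sub>R K)"
        using K(1) by (simp add: x linear_cmul[OF bounded_linear.linear[OF X]])
      ultimately show "y \<in> (\<lambda>x. K *\<^sub>R x) ` closure (X ` cball 0 1)"
        using closure_subset by blast
    qed
  qed
qed

context
  assumes inf: "\<nexists>B :: 'a::chilbert_space set. finite B \<and> cspan B = UNIV"
begin

lemma singular_system_obtain:
  assumes "compact_operator (X :: 'a \<Rightarrow> 'a)"
  obtains e where "singular_system X e (s_numbers X)"
  using singular_system_exists[OF inf assms]
    singular_system_s_numbers[OF compact_operatorD(1)[OF assms]] by metis

lemma s_numbers_c0_star:
  assumes "compact_operator (X :: 'a \<Rightarrow> 'a)"
  shows "s_numbers X \<in> c0_star"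
  using singular_system_obtain[OF assms] singular_systemD(2) by metis

text \<open>Orthogonality to the first \<open>m\<close> singular vectors of \<open>X\<close> and the
  first \<open>n\<close> of \<open>Y\<close> bounds both summands, at the price of at most
  \<open>m + n\<close> conditions.\<close>

lemma s_numbers_add_le:
  assumes X: "compact_operator (X :: 'a \<Rightarrow> 'a)" and Y: "compact_operator (Y :: 'a \<Rightarrow> 'a)"
  shows "s_numbers (\<lambda>x. X x + Y x) (m + n) \<le> s_numbers X m + s_numbers Y n"
proof -
  have XY: "compact_operator (\<lambda>x. X x + Y x)"
    by (rule compact_operator_add[OF X Y])
  obtain e where e: "singular_system X e (s_numbers X)" by (rule singular_system_obtain[OF X])
  obtain f where f: "singular_system Y f (s_numbers Y)" by (rule singular_system_obtain[OF Y])
  obtain g where g: "singular_system (\<lambda>x. X x + Y x) g (s_numbers (\<lambda>x. X x + Y x))"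
    by (rule singular_system_obtain[OF XY])
  show ?thesis
  proof (rule s_numbers_le[OF g compact_operatorD(1)[OF XY]])
    show "finite (e ` {..<m} \<union> f ` {..<n})" by simp
    have "card (e ` {..<m} \<union> f ` {..<n}) \<le> card (e ` {..<m}) + card (f ` {..<n})"
      by (rule card_Un_le)
    also have "\<dots> \<le> m + n"
      using card_image_le[of "{..<m}" e] card_image_le[of "{..<n}" f] by simp
    finally show "card (e ` {..<m} \<union> f ` {..<n}) \<le> m + n" .
    fix v assume v: "\<And>u. u \<in> e ` {..<m} \<union> f ` {..<n} \<Longrightarrow> cinner v u = 0"
    have "norm (X v) \<le> s_numbers X m * norm v"
      by (rule singular_systemD(4)[OF e]) (use v in auto)
    moreover have "norm (Y v) \<le> s_numbers Y n * norm v"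
      by (rule singular_systemD(4)[OF f]) (use v in auto)
    ultimately show "norm (X v + Y v) \<le> (s_numbers X m + s_numbers Y n) * norm v"
      using norm_triangle_ineq[of "X v" "Y v"] by (simp add: distrib_right)
  qed
qed

lemma s_numbers_compose_left_le:
  assumes A: "bounded_clinear A" "\<And>x. norm (A x) \<le> K * norm x"
    and X: "compact_operator (X :: 'a \<Rightarrow> 'a)"
  shows "s_numbers (A \<circ> X) n \<le> K * s_numbers X n"
proof -
  have AX: "compact_operator (A \<circ> X)"
    by (rule compact_operator_compose_left[OF A(1) X])
  obtain e where e: "singular_system X e (s_numbers X)" by (rule singular_system_obtain[OF X])
  obtain g where g: "singular_system (A \<circ> X) g (s_numbers (A \<circ> X))"
    by (rule singular_system_obtain[OF AX])
  show ?thesis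
  proof (rule s_numbers_le[OF g compact_operatorD(1)[OF AX]])
    show "finite (e ` {..<n})" "card (e ` {..<n}) \<le> n"
      using card_image_le[of "{..<n}" e] by auto
    have K: "K \<ge> 0"
      using A(2)[of "e 0"] orthonormal_seqD(2)[OF singular_systemD(1)[OF e]]
      by (simp add: order_trans[OF norm_ge_zero])
    fix v assume v: "\<And>u. u \<in> e ` {..<n} \<Longrightarrow> cinner v u = 0"
    have "norm (A (X v)) \<le> K * norm (X v)" by (rule A(2))
    also have "norm (X v) \<le> s_numbers X n * norm v"
      by (rule singular_systemD(4)[OF e]) (use v in auto)
    then have "K * norm (X v) \<le> K * (s_numbers X n * norm v)"
      using K by (rule mult_left_mono)
    finally show "norm ((A \<circ> X) v) \<le> K * s_numbers X n * norm v"
      by (simp add: mult.assoc)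
  qed
qed

text \<open>Conditions on \<open>B v\<close> become conditions on \<open>v\<close> by moving the
  singular vectors of \<open>X\<close> through the adjoint of \<open>B\<close>; their number does
  not grow.\<close>

lemma s_numbers_compose_right_le:
  assumes B: "bounded_clinear B" "\<And>x. norm (B x) \<le> K * norm x"
    and X: "compact_operator (X :: 'a \<Rightarrow> 'a)"
  shows "s_numbers (X \<circ> B) n \<le> K * s_numbers X n"
proof -
  have XB: "compact_operator (X \<circ> B)"
    by (rule compact_operator_compose_right[OF B(1) X])
  obtain e where e: "singular_system X e (s_numbers X)" by (rule singular_system_obtain[OF X])
  obtain g where g: "singular_system (X \<circ> B) g (s_numbers (X \<circ> B))"
    by (rule singular_system_obtain[OF XB])
  show ?thesis
  proof (rule s_numbers_le[OF g compact_operatorD(1)[OF XB]])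
    show "finite ((cadjoint B \<circ> e) ` {..<n})" "card ((cadjoint B \<circ> e) ` {..<n}) \<le> n"
      using card_image_le[of "{..<n}" "cadjoint B \<circ> e"] by auto
    fix v assume v: "\<And>u. u \<in> (cadjoint B \<circ> e) ` {..<n} \<Longrightarrow> cinner v u = 0"
    have "norm (X (B v)) \<le> s_numbers X n * norm (B v)"
      by (rule singular_systemD(4)[OF e]) (use v in \<open>auto simp: cadjoint[OF B(1)]\<close>)
    also have "\<dots> \<le> s_numbers X n * (K * norm v)"
      using c0_starD(1)[OF s_numbers_c0_star[OF X]] by (intro mult_left_mono B(2))
    finally show "norm ((X \<circ> B) v) \<le> K * s_numbers X n * norm v"
      by (simp add: mult_ac)
  qed
qed

end

section \<open>Operators given by orthogonal series\<close>

text \<open>Zero vectors are allowed, so that normalized images \<open>T e\<^sub>k / \<tau>\<^sub>k\<close> qualify also when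
  \<open>\<tau>\<^sub>k = 0\<close> for some \<open>k\<close>.\<close>

definition orthogonal_seq :: "(nat \<Rightarrow> 'a::chilbert_space) \<Rightarrow> real \<Rightarrow> bool" where
  "orthogonal_seq g C \<longleftrightarrow> (\<forall>m n. m \<noteq> n \<longrightarrow> cinner (g m) (g n) = 0) \<and> (\<forall>n. norm (g n) \<le> C)"

definition series_operator :: "(nat \<Rightarrow> 'a) \<Rightarrow> (nat \<Rightarrow> 'a) \<Rightarrow> 'a \<Rightarrow> 'a::chilbert_space" where
  "series_operator e g v = (\<Sum>k. cinner v (e k) *\<^sub>C g k)"

lemma orthogonal_seqD:
  assumes "orthogonal_seq g C"
  shows "m \<noteq> n \<Longrightarrow> cinner (g m) (g n) = 0" "norm (g n) \<le> C"
  using assms by (auto simp: orthogonal_seq_def)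

lemma orthonormal_imp_orthogonal_seq:
  assumes "orthonormal_seq e"
  shows "orthogonal_seq e 1"
  using orthonormal_seqD[OF assms] by (simp add: orthogonal_seq_def)

lemma orthogonal_seq_subseq:
  assumes "orthogonal_seq g C" "inj r"
  shows "orthogonal_seq (\<lambda>k. g (r k)) C"
  using assms by (simp add: orthogonal_seq_def inj_eq)

text \<open>The vectors have norm at most 1, so the projection satisfies
  \<open>(norm y)\<^sup>2 \<le> s\<close> instead of equality; that is the direction which expanding
  the square of \<open>v - y\<close> asks for.\<close>

lemma bessel:
  assumes e: "orthogonal_seq e 1" and A: "finite A"
  shows "(\<Sum>k\<in>A. (cmod (cinner v (e k)))\<^sup>2) \<le> (norm v)\<^sup>2"
proof -
  define y where "y = (\<Sum>k\<in>A. cinner v (e k) *\<^sub>C e k)"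
  define s where "s = (\<Sum>k\<in>A. (cmod (cinner v (e k)))\<^sup>2)"
  have "cinner y v = of_real s"
  proof -
    have "cinner v (e k) * cinner (e k) v = of_real ((cmod (cinner v (e k)))\<^sup>2)" for k
      by (metis cinner_commute complex_norm_square of_real_power)
    then show ?thesis
      by (simp add: y_def s_def cinner_sum_left cinner_scaleC_left)
  qed
  then have "inner v y = s"
    by (metis Re_complex_of_real inner_Re_cinner inner_commute)
  moreover have "(norm y)\<^sup>2 \<le> s"
  proof -
    have "(norm y)\<^sup>2 = (\<Sum>k\<in>A. (cmod (cinner v (e k)) * norm (e k))\<^sup>2)"
      unfolding y_def using A
      by (subst norm_sum_sq_orthogonal)
        (auto simp: cinner_scaleC_left cinner_scaleC_right orthogonal_seqD(1)[OF e])
    also have "\<dots> \<le> s"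
      unfolding s_def using orthogonal_seqD(2)[OF e]
      by (intro sum_mono power_mono) (auto simp: mult_left_le)
    finally show ?thesis .
  qed
  moreover have "0 \<le> (norm (v + (- 1) *\<^sub>R y))\<^sup>2" by simp
  then have "0 \<le> (norm v)\<^sup>2 - 2 * inner v y + (norm y)\<^sup>2"
    unfolding norm_add_scaleR_sq by simp
  ultimately show ?thesis
    unfolding s_def[symmetric] by linarith
qed

lemma bessel_summable:
  assumes e: "orthogonal_seq e 1"
  shows "summable (\<lambda>k. (cmod (cinner v (e k)))\<^sup>2)"
proof (rule summableI_nonneg_bounded)
  show "(\<Sum>k<n. (cmod (cinner v (e k)))\<^sup>2) \<le> (norm v)\<^sup>2" for n
    by (rule bessel[OF e]) simp
qed simp

text \<open>The bound \<open>C\<close> is asked only where the coefficient is nonzero. A vector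
  orthogonal to the first \<open>n\<close> basis vectors is thereby estimated by the weight at
  \<open>n\<close>, as a singular system demands; \<open>C'\<close> is the global bound.\<close>

lemma norm_orthogonal_combination_le:
  assumes "finite A" and g: "orthogonal_seq g C'"
    and C: "C \<ge> 0" "\<And>k. k \<in> A \<Longrightarrow> c k \<noteq> 0 \<Longrightarrow> norm (g k) \<le> C"
  shows "(norm (\<Sum>k\<in>A. c k *\<^sub>C g k))\<^sup>2 \<le> C\<^sup>2 * (\<Sum>k\<in>A. (cmod (c k))\<^sup>2)"
proof -
  have "(norm (\<Sum>k\<in>A. c k *\<^sub>C g k))\<^sup>2 = (\<Sum>k\<in>A. (cmod (c k) * norm (g k))\<^sup>2)"
    using assms(1)
    by (subst norm_sum_sq_orthogonal)
      (auto simp: cinner_scaleC_left cinner_scaleC_right orthogonal_seqD(1)[OF g])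
  also have "\<dots> \<le> (\<Sum>k\<in>A. C\<^sup>2 * (cmod (c k))\<^sup>2)"
  proof (rule sum_mono)
    fix k assume k: "k \<in> A"
    have "cmod (c k) * norm (g k) \<le> cmod (c k) * C"
      using C(2)[OF k] by (cases "c k = 0") (auto intro!: mult_left_mono)
    then have "(cmod (c k) * norm (g k))\<^sup>2 \<le> (cmod (c k) * C)\<^sup>2"
      by (intro power_mono) auto
    then show "(cmod (c k) * norm (g k))\<^sup>2 \<le> C\<^sup>2 * (cmod (c k))\<^sup>2"
      by (simp add: power_mult_distrib mult.commute)
  qed
  finally show ?thesis
    by (simp add: sum_distrib_left)
qed

instance chilbert_space \<subseteq> banach ..

lemma series_operator_summable:
  assumes e: "orthogonal_seq e 1" and g: "orthogonal_seq g C"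
  shows "summable (\<lambda>k. cinner v (e k) *\<^sub>C g k)"
  unfolding summable_Cauchy
proof (intro allI impI)
  have C: "C \<ge> 0"
    using orthogonal_seqD(2)[OF g] norm_ge_zero order_trans by metis
  fix r :: real assume r: "r > 0"
  \<comment> \<open>\<open>C + 1\<close> instead of \<open>C\<close> avoids division by zero and
    yields the strict inequality.\<close>
  define d where "d = (r / (C + 1))\<^sup>2"
  have d: "d > 0" using r C by (simp add: d_def)
  obtain N where N: "\<And>m n. m \<ge> N \<Longrightarrow> norm (\<Sum>k\<in>{m..<n}. (cmod (cinner v (e k)))\<^sup>2) < d"
    using bessel_summable[OF e, of v] d unfolding summable_Cauchy by metis
  have "norm (\<Sum>k\<in>{m..<n}. cinner v (e k) *\<^sub>C g k) < r" if "m \<ge> N" for m n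
  proof -
    have "(norm (\<Sum>k\<in>{m..<n}. cinner v (e k) *\<^sub>C g k))\<^sup>2
        \<le> C\<^sup>2 * (\<Sum>k\<in>{m..<n}. (cmod (cinner v (e k)))\<^sup>2)"
      by (rule norm_orthogonal_combination_le[OF _ g C]) (use orthogonal_seqD(2)[OF g] in auto)
    also have "\<dots> \<le> C\<^sup>2 * d"
      using N[OF that, of n] by (intro mult_left_mono) auto
    also have "\<dots> < (C + 1)\<^sup>2 * d"
      using d C by (intro mult_strict_right_mono power_strict_mono) auto
    also have "\<dots> = r\<^sup>2"
      using C by (simp add: d_def power_divide)
    finally show ?thesis
      using r by (simp add: power_less_imp_less_base)
  qed
  then show "\<exists>N. \<forall>m\<ge>N. \<forall>n. norm (\<Sum>k\<in>{m..<n}. cinner v (e k) *\<^sub>C g k) < r"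
    by blast
qed

lemma series_operator_norm_le:
  assumes e: "orthogonal_seq e 1" and g: "orthogonal_seq g C'"
    and C: "C \<ge> 0" "\<And>k. cinner v (e k) \<noteq> 0 \<Longrightarrow> norm (g k) \<le> C"
  shows "norm (series_operator e g v) \<le> C * norm v"
proof (rule LIMSEQ_le_const2)
  show "(\<lambda>n. norm (\<Sum>k<n. cinner v (e k) *\<^sub>C g k)) \<longlonglongrightarrow> norm (series_operator e g v)"
    unfolding series_operator_def by (intro tendsto_norm summable_LIMSEQ series_operator_summable[OF e g])
  have "norm (\<Sum>k<n. cinner v (e k) *\<^sub>C g k) \<le> C * norm v" for n
  proof (rule power2_le_imp_le)
    have "(norm (\<Sum>k<n. cinner v (e k) *\<^sub>C g k))\<^sup>2 \<le> C\<^sup>2 * (\<Sum>k<n. (cmod (cinner v (e k)))\<^sup>2)"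
      by (rule norm_orthogonal_combination_le[OF _ g C(1)]) (use C(2) in auto)
    also have "\<dots> \<le> C\<^sup>2 * (norm v)\<^sup>2"
      by (intro mult_left_mono bessel[OF e]) auto
    finally show "(norm (\<Sum>k<n. cinner v (e k) *\<^sub>C g k))\<^sup>2 \<le> (C * norm v)\<^sup>2"
      by (simp add: power_mult_distrib)
  qed (use C in simp)
  then show "\<exists>N. \<forall>n\<ge>N. norm (\<Sum>k<n. cinner v (e k) *\<^sub>C g k) \<le> C * norm v"
    by blast
qed

lemma bounded_clinear_series_operator:
  assumes e: "orthogonal_seq e 1" and g: "orthogonal_seq g C"
  shows "bounded_clinear (series_operator e g)"
proof (rule bounded_clinearI)
  note sum = series_operator_summable[OF e g]
  have C: "C \<ge> 0"
    using orthogonal_seqD(2)[OF g] norm_ge_zero order_trans by metis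
  show "series_operator e g (x + y) = series_operator e g x + series_operator e g y" for x y
    unfolding series_operator_def
    by (simp add: suminf_add[OF sum sum] cinner_add_left scaleC_add_left)
  show "series_operator e g (c *\<^sub>C x) = c *\<^sub>C series_operator e g x" for c x
    unfolding series_operator_def bounded_linear.suminf[OF bounded_linear_scaleC_right sum]
    by (simp add: cinner_scaleC_left scaleC_scaleC)
  show "norm (series_operator e g x) \<le> norm x * C" for x
    using series_operator_norm_le[OF e g C] orthogonal_seqD(2)[OF g] by (simp add: mult.commute)
qed

lemma compose_series_operator:
  assumes e: "orthogonal_seq e 1" and g: "orthogonal_seq g C" and T: "bounded_clinear T"
  shows "T (series_operator e g v) = series_operator e (\<lambda>k. T (g k)) v"
  unfolding series_operator_def
    bounded_linear.suminf[OF bounded_clinearD(1)[OF T] series_operator_summable[OF e g]]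
  by (simp add: bounded_clinearD(2)[OF T])

lemma cinner_series_operator:
  assumes e: "orthogonal_seq e 1" and g: "orthogonal_seq g C"
  shows "cinner (series_operator e g v) (g n) = cinner v (e n) * of_real ((norm (g n))\<^sup>2)"
proof -
  have "cinner (series_operator e g v) (g n) = (\<Sum>k. cinner (cinner v (e k) *\<^sub>C g k) (g n))"
    unfolding series_operator_def
    by (rule bounded_linear.suminf[OF bounded_linear_cinner_left series_operator_summable[OF e g]])
  also have "\<dots> = (\<Sum>k\<in>{n}. cinner (cinner v (e k) *\<^sub>C g k) (g n))"
    by (rule suminf_finite) (auto simp: cinner_scaleC_left orthogonal_seqD(1)[OF g])
  finally show ?thesis
    by (simp add: cinner_scaleC_left cinner_self)
qed

lemma series_operator_basis:
  assumes "orthonormal_seq e"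
  shows "series_operator e g (e n) = g n"
proof -
  have "series_operator e g (e n) = (\<Sum>k\<in>{n}. cinner (e n) (e k) *\<^sub>C g k)"
    unfolding series_operator_def
    by (rule suminf_finite) (auto simp: orthonormal_seqD(1)[OF assms])
  then show ?thesis
    by (simp add: orthonormal_seqD(1)[OF assms] scaleC_one)
qed

lemma singular_system_orthogonal_image:
  assumes "singular_system X e \<xi>"
  shows "orthogonal_seq (\<lambda>k. X (e k)) (\<xi> 0)"
  using singular_systemD[OF assms] c0_starD(4)[of \<xi> 0] singular_system_norm[OF assms]
    orthonormal_seqD(1)[of e]
  by (simp add: orthogonal_seq_def)

lemma singular_system_expansion:
  assumes X: "bounded_clinear X" and sys: "singular_system X e \<xi>"
  shows "series_operator e (\<lambda>k. X (e k)) v = X v"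
proof -
  have on: "orthonormal_seq e" and e: "orthogonal_seq e 1"
    using singular_systemD(1)[OF sys] by (auto intro: orthonormal_imp_orthogonal_seq)
  have "cinner (v - series_operator e e v) (e k) = 0" for k
    by (simp add: cinner_diff_left cinner_series_operator[OF e e] orthonormal_seqD(2)[OF on])
  then have "X (v - series_operator e e v) = 0"
    by (rule singular_system_kernel[OF sys])
  then have "X v = X (series_operator e e v)"
    by (simp add: bounded_clinearD(4)[OF X])
  then show ?thesis
    by (simp add: compose_series_operator[OF e e X])
qed

text \<open>A block of \<open>m\<close> consecutive terms contains one index of each residue class,
  and each class alone is summable, so the finite sum may be pulled out.\<close>

lemma series_operator_residue_classes:
  assumes e: "orthogonal_seq e 1" and g: "orthogonal_seq g C" and m: "m > 0"
  shows "series_operator e g v =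
    (\<Sum>j<m. series_operator (\<lambda>k. e (k * m + j)) (\<lambda>k. g (k * m + j)) v)"
proof -
  define f where "f k = cinner v (e k) *\<^sub>C g k" for k
  have inj: "inj (\<lambda>k. k * m + j)" for j
    using m by (intro injI) simp
  have f: "summable (\<lambda>k. f (k * m + j))" for j
    unfolding f_def
    by (rule series_operator_summable[OF orthogonal_seq_subseq[OF e inj] orthogonal_seq_subseq[OF g inj]])
  have "(\<lambda>k. sum f {k * m..<k * m + m}) sums suminf f"
    using series_operator_summable[OF e g, of v] m
    by (intro sums_group summable_sums) (simp_all add: f_def[abs_def])
  moreover have "sum f {k * m..<k * m + m} = (\<Sum>j<m. f (k * m + j))" for k
    using sum.shift_bounds_nat_ivl[of f 0 "k * m" m]
    by (simp add: add.commute lessThan_atLeast0)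
  ultimately have "suminf f = (\<Sum>k. \<Sum>j<m. f (k * m + j))"
    by (simp add: sums_iff)
  also have "\<dots> = (\<Sum>j<m. \<Sum>k. f (k * m + j))"
    by (rule suminf_sum) (rule f)
  finally show ?thesis
    by (simp add: series_operator_def f_def[abs_def])
qed

text \<open>The box is a Minkowski sum of compact discs. It contains the truncations, on the unit
  ball, of a series operator with orthonormal \<open>e\<close>, which is how total boundedness is
  obtained.\<close>

lemma compact_coefficient_box:
  "compact {\<Sum>k<(n::nat). c k *\<^sub>C (g k :: 'a::chilbert_space) |c. \<forall>k<n. cmod (c k) \<le> 1}"
proof (induction n)
  case (Suc n)
  define A where "A = {\<Sum>k<n. c k *\<^sub>C g k |c. \<forall>k<n. cmod (c k) \<le> 1}"
  have "bounded_linear (\<lambda>z. z *\<^sub>C g n)"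
    by (rule bounded_linear_intro[of _ "norm (g n)"])
      (simp_all add: scaleC_add_left scaleR_scaleC scaleC_scaleC scaleR_conv_of_real)
  then have "compact ((\<lambda>z. z *\<^sub>C g n) ` cball 0 1)"
    by (intro compact_continuous_image linear_continuous_on) simp_all
  with Suc have "compact {x + y |x y. x \<in> A \<and> y \<in> (\<lambda>z. z *\<^sub>C g n) ` cball 0 1}"
    unfolding A_def by (rule compact_sums)
  moreover have "{x + y |x y. x \<in> A \<and> y \<in> (\<lambda>z. z *\<^sub>C g n) ` cball 0 1} =
      {\<Sum>k<Suc n. c k *\<^sub>C g k |c. \<forall>k<Suc n. cmod (c k) \<le> 1}" (is "?L = ?R")
  proof
    show "?L \<subseteq> ?R"
    proof
      fix w assume "w \<in> ?L"
      then obtain c z where cz: "w = (\<Sum>k<n. c k *\<^sub>C g k) + z *\<^sub>C g n" "\<forall>k<n. cmod (c k) \<le> 1" "cmod z \<le> 1"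
        by (auto simp: A_def)
      then have "w = (\<Sum>k<Suc n. (c(n := z)) k *\<^sub>C g k)" "\<forall>k<Suc n. cmod ((c(n := z)) k) \<le> 1"
        by (auto simp: less_Suc_eq)
      then show "w \<in> ?R" by blast
    qed
    show "?R \<subseteq> ?L"
    proof
      fix w assume "w \<in> ?R"
      then obtain c where c: "w = (\<Sum>k<n. c k *\<^sub>C g k) + c n *\<^sub>C g n" "\<forall>k<Suc n. cmod (c k) \<le> 1"
        by auto
      then have "(\<Sum>k<n. c k *\<^sub>C g k) \<in> A" "c n *\<^sub>C g n \<in> (\<lambda>z. z *\<^sub>C g n) ` cball 0 1"
        by (auto simp: A_def)
      with c(1) show "w \<in> ?L" by blast
    qed
  qed
  ultimately show ?case by simp
qed simp

lemma compact_operator_series: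
  assumes e: "orthonormal_seq e" and g: "orthogonal_seq g C" "(\<lambda>k. norm (g k)) \<longlonglongrightarrow> 0"
  shows "compact_operator (series_operator e g)"
proof -
  have e1: "orthogonal_seq e 1"
    by (rule orthonormal_imp_orthogonal_seq[OF e])
  define S where "S = series_operator e g ` cball 0 1"
  have "\<exists>K. finite K \<and> closure S \<subseteq> (\<Union>x\<in>K. ball x r)" if r: "r > 0" for r
  proof -
    obtain N where N: "\<And>k. k \<ge> N \<Longrightarrow> norm (g k) < r / 4"
      using LIMSEQ_D[OF g(2), of "r / 4"] r by auto
    define B where "B = {\<Sum>k<N. c k *\<^sub>C g k |c. \<forall>k<N. cmod (c k) \<le> 1}"
    have "compact B"
      unfolding B_def by (rule compact_coefficient_box)
    then obtain K where K: "finite K" "B \<subseteq> (\<Union>x\<in>K. ball x (r / 4))"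
      unfolding compact_eq_totally_bounded using r by (metis zero_less_divide_iff zero_less_numeral)
    \<comment> \<open>A quarter of \<open>r\<close> is spent on the net for the truncation and a
      quarter on the tail. Closed balls of radius \<open>r / 2\<close> also cover the closure and
      lie inside the open balls of radius \<open>r\<close>.\<close>
    have "S \<subseteq> (\<Union>x\<in>K. cball x (r / 2))"
    proof
      fix y assume "y \<in> S"
      then obtain v where v: "y = series_operator e g v" "norm v \<le> 1" by (auto simp: S_def)
      define b where "b = (\<Sum>k<N. cinner v (e k) *\<^sub>C g k)"
      have "cmod (cinner v (e k)) \<le> 1" for k
        using cinner_cauchy_schwarz[of v "e k"] v(2) by (simp add: orthonormal_seqD(2)[OF e])
      then have "b \<in> B" by (auto simp: B_def b_def)
      then obtain x where x: "x \<in> K" "dist x b < r / 4"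
        using K(2) by auto
      \<comment> \<open>Zeroing the first \<open>N\<close> vectors keeps the sequence orthogonal, so
        the tail is itself a series operator, with weights below \<open>r / 4\<close>.\<close>
      define h where "h k = (if k < N then 0 else g k)" for k
      have h: "orthogonal_seq h C"
        using g(1) order_trans[OF norm_ge_zero orthogonal_seqD(2)[OF g(1)]]
        by (auto simp: orthogonal_seq_def h_def)
      have "y = series_operator e h v + b"
      proof -
        define f where "f k = (if k \<in> {..<N} then cinner v (e k) *\<^sub>C g k else 0)" for k
        have "y = (\<Sum>k. cinner v (e k) *\<^sub>C h k + f k)"
          unfolding v(1) series_operator_def by (rule suminf_cong) (simp add: h_def f_def)
        also have "\<dots> = (\<Sum>k. cinner v (e k) *\<^sub>C h k) + (\<Sum>k. f k)"
          unfolding f_def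
          by (rule suminf_add[symmetric, OF series_operator_summable[OF e1 h] summable_If_finite_set]) simp
        also have "(\<Sum>k. f k) = b"
          unfolding b_def f_def by (subst suminf_finite[of "{..<N}"]) auto
        finally show ?thesis
          by (simp add: series_operator_def)
      qed
      moreover have "norm (series_operator e h v) \<le> r / 4 * norm v"
        using r N by (intro series_operator_norm_le[OF e1 h]) (auto simp: h_def less_imp_le)
      then have "norm (series_operator e h v) \<le> r / 4"
      proof (rule order_trans)
        have "r / 4 * norm v \<le> r / 4 * 1"
          using v(2) r by (intro mult_left_mono) auto
        then show "r / 4 * norm v \<le> r / 4" by simp
      qed
      ultimately have "dist b y \<le> r / 4"
        by (simp add: dist_norm)
      with x have "dist x y \<le> r / 2"
        using dist_triangle[of x y b] by simp
      with x show "y \<in> (\<Union>x\<in>K. cball x (r / 2))" by auto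
    qed
    then have "closure S \<subseteq> (\<Union>x\<in>K. cball x (r / 2))"
      using K(1) by (intro closure_minimal closed_UN) auto
    also have "\<dots> \<subseteq> (\<Union>x\<in>K. ball x r)"
      using r by (intro UN_mono) auto
    finally show ?thesis using K(1) by blast
  qed
  then have "compact (closure S)"
    unfolding compact_eq_totally_bounded by (simp add: complete_eq_closed)
  then show ?thesis
    unfolding compact_operator_def S_def
    using bounded_clinear_series_operator[OF e1 g(1)] by simp
qed

lemma singular_system_diagonal:
  assumes e: "orthonormal_seq e" and \<eta>: "\<eta> \<in> c0_star"
  shows "compact_operator (series_operator e (\<lambda>k. of_real (\<eta> k) *\<^sub>C e k))"
    and "singular_system (series_operator e (\<lambda>k. of_real (\<eta> k) *\<^sub>C e k)) e \<eta>"
proof -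
  define g where "g k = of_real (\<eta> k) *\<^sub>C e k" for k
  have e1: "orthogonal_seq e 1"
    by (rule orthonormal_imp_orthogonal_seq[OF e])
  have norm_g: "norm (g k) = \<eta> k" for k
    using c0_starD(1)[OF \<eta>] by (simp add: g_def orthonormal_seqD[OF e])
  have g: "orthogonal_seq g (\<eta> 0)"
    using c0_starD(4)[OF \<eta>]
    by (simp add: orthogonal_seq_def norm_g) (simp add: g_def cinner_scaleC_left cinner_scaleC_right orthonormal_seqD[OF e])
  show "compact_operator (series_operator e (\<lambda>k. of_real (\<eta> k) *\<^sub>C e k))"
    using compact_operator_series[OF e g] c0_starD(3)[OF \<eta>] by (simp add: norm_g) (simp add: g_def[abs_def])
  have "cinner (series_operator e g v) (series_operator e g (e n)) = of_real ((\<eta> n)\<^sup>2) * cinner v (e n)" for v n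
    by (simp add: series_operator_basis[OF e] cinner_series_operator[OF e1 g] norm_g)
  moreover have "norm (series_operator e g v) \<le> \<eta> n * norm v"
    if "\<forall>k<n. cinner v (e k) = 0" for n v
    using that c0_starD(1,4)[OF \<eta>]
    by (intro series_operator_norm_le[OF e1 g]) (auto simp: norm_g not_less[symmetric])
  ultimately show "singular_system (series_operator e (\<lambda>k. of_real (\<eta> k) *\<^sub>C e k)) e \<eta>"
    unfolding singular_system_def g_def[abs_def] using e \<eta> by blast
qed

section \<open>Ideals and characteristic sets\<close>

text \<open>With indices from 0 the ampliation \<open>D\<^sub>m\<close> is
  \<open>\<xi> (n div m)\<close>, since the ceiling of \<open>(n + 1) / m\<close> is
  \<open>n div m + 1\<close>. The last clause combines solidity, multiplication by scalars and all
  ampliations.\<close>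

definition characteristic_set :: "(nat \<Rightarrow> real) set \<Rightarrow> bool" where
  "characteristic_set \<Sigma> \<longleftrightarrow> \<Sigma> \<subseteq> c0_star \<and> \<Sigma> \<noteq> {} \<and>
     (\<forall>\<xi>\<in>\<Sigma>. \<forall>\<eta>\<in>\<Sigma>. (\<lambda>n. \<xi> n + \<eta> n) \<in> \<Sigma>) \<and>
     (\<forall>\<xi>\<in>\<Sigma>. \<forall>\<eta>\<in>c0_star. \<forall>C m. m > 0 \<longrightarrow> (\<forall>n. \<eta> n \<le> C * \<xi> (n div m)) \<longrightarrow> \<eta> \<in> \<Sigma>)"

definition ideal_of :: "(nat \<Rightarrow> real) set \<Rightarrow> ('a::chilbert_space \<Rightarrow> 'a) set" where
  "ideal_of \<Sigma> = {X. compact_operator X \<and> s_numbers X \<in> \<Sigma>}"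

lemma characteristic_setD:
  assumes "characteristic_set \<Sigma>"
  shows "\<Sigma> \<subseteq> c0_star" "\<Sigma> \<noteq> {}"
    "\<xi> \<in> \<Sigma> \<Longrightarrow> \<eta> \<in> \<Sigma> \<Longrightarrow> (\<lambda>n. \<xi> n + \<eta> n) \<in> \<Sigma>"
    "\<xi> \<in> \<Sigma> \<Longrightarrow> \<eta> \<in> c0_star \<Longrightarrow> m > 0 \<Longrightarrow> (\<And>n. \<eta> n \<le> C * \<xi> (n div m)) \<Longrightarrow> \<eta> \<in> \<Sigma>"
  using assms unfolding characteristic_set_def by blast+

lemma ideal_BH_D:
  assumes "ideal I (BH :: ('a::chilbert_space \<Rightarrow> 'a) ring)"
  shows "X \<in> I \<Longrightarrow> bounded_clinear X"
    "X \<in> I \<Longrightarrow> bounded_clinear A \<Longrightarrow> A \<circ> X \<in> I"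
    "X \<in> I \<Longrightarrow> bounded_clinear A \<Longrightarrow> X \<circ> A \<in> I"
    "X \<in> I \<Longrightarrow> Y \<in> I \<Longrightarrow> (\<lambda>x. X x + Y x) \<in> I"
    "(\<lambda>x. 0) \<in> I"
proof -
  interpret ideal I BH by (fact assms)
  show "X \<in> I \<Longrightarrow> bounded_clinear X"
    using Icarr by (simp add: BH_def)
  show "X \<in> I \<Longrightarrow> bounded_clinear A \<Longrightarrow> A \<circ> X \<in> I"
    using I_l_closed[of X A] by (simp add: BH_def)
  show "X \<in> I \<Longrightarrow> bounded_clinear A \<Longrightarrow> X \<circ> A \<in> I"
    using I_r_closed[of X A] by (simp add: BH_def)
  show "X \<in> I \<Longrightarrow> Y \<in> I \<Longrightarrow> (\<lambda>x. X x + Y x) \<in> I"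
    using additive_subgroup.a_closed[OF additive_subgroup_axioms, of X Y] by (simp add: BH_def)
  show "(\<lambda>x. 0) \<in> I"
    using additive_subgroup.zero_closed[OF additive_subgroup_axioms] by (simp add: BH_def)
qed

lemma ideal_BH_sum:
  assumes I: "ideal I (BH :: ('a::chilbert_space \<Rightarrow> 'a) ring)"
    and "finite J" "\<And>j. j \<in> J \<Longrightarrow> F j \<in> I"
  shows "(\<lambda>x. \<Sum>j\<in>J. F j x) \<in> I"
  using assms(2,3) by (induction J) (simp_all add: ideal_BH_D[OF I])

text \<open>If \<open>s(X) = O(D\<^sub>m s(T))\<close>, then \<open>X\<close> is a sum of \<open>m\<close> operators \<open>A\<^sub>j T B\<^sub>j\<close>, one for each
  residue class of indices modulo \<open>m\<close>.\<close>

lemma ideal_BH_memberI: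
  fixes X T :: "'a::chilbert_space \<Rightarrow> 'a"
  assumes I: "ideal I BH" "T \<in> I"
    and sysT: "singular_system T e \<tau>"
    and X: "bounded_clinear X" and sysX: "singular_system X x \<xi>"
    and m: "m > 0" and le: "\<And>n. \<xi> n \<le> C * \<tau> (n div m)"
  shows "X \<in> I"
proof -
  have T: "bounded_clinear T" by (rule ideal_BH_D(1)[OF I])
  have e: "orthogonal_seq e 1" and x: "orthogonal_seq x 1"
    using sysT sysX by (auto intro: orthonormal_imp_orthogonal_seq singular_systemD(1))
  have \<tau>: "\<tau> k \<ge> 0" and \<xi>: "\<xi> k \<ge> 0" for k
    using sysT sysX by (auto intro: c0_starD(1) singular_systemD(2))
  have Te: "orthogonal_seq (\<lambda>k. T (e k)) (\<tau> 0)" and Xx: "orthogonal_seq (\<lambda>k. X (x k)) (\<xi> 0)"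
    using singular_system_orthogonal_image sysT sysX by blast+
  have nTe: "norm (T (e k)) = \<tau> k" and nXx: "norm (X (x k)) = \<xi> k" for k
    using singular_system_norm sysT sysX by blast+
  \<comment> \<open>\<open>B j\<close> sends \<open>x (r j k)\<close> to \<open>e k\<close>,
    \<open>T\<close> sends that to \<open>\<tau> k\<close> times \<open>f k\<close>, and
    \<open>A j\<close> rescales the result to \<open>X (x (r j k))\<close>. Where
    \<open>\<tau> k = 0\<close>, both \<open>f k\<close> and \<open>g j k\<close> are 0 because
    \<open>1 / 0 = 0\<close>, and \<open>vanish\<close> shows that the target is 0 too.\<close>
  define r where "r j k = k * m + j" for j k :: nat
  have inj: "inj (r j)" for j
    using m by (intro injI) (simp add: r_def)
  define f where "f k = of_real (1 / \<tau> k) *\<^sub>C T (e k)" for k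
  define g where "g j k = of_real (1 / \<tau> k) *\<^sub>C X (x (r j k))" for j k
  define B where "B j = series_operator (\<lambda>k. x (r j k)) e" for j
  define A where "A j = series_operator f (g j)" for j
  have f: "orthogonal_seq f 1"
    using orthogonal_seqD(1)[OF Te] \<tau>
    by (auto simp: orthogonal_seq_def f_def cinner_scaleC_left cinner_scaleC_right nTe norm_divide)
  have vanish: "X (x (r j k)) = 0" if "\<tau> k = 0" "j < m" for j k
    using le[of "r j k"] that \<xi>[of "r j k"] nXx[of "r j k"] by (simp add: r_def)
  have g: "orthogonal_seq (g j) \<bar>C\<bar>" if j: "j < m" for j
    unfolding orthogonal_seq_def
  proof safe
    show "cinner (g j k) (g j l) = 0" if "k \<noteq> l" for k l
      using orthogonal_seqD(1)[OF Xx, of "r j k" "r j l"] that inj[of j]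
      by (simp add: g_def cinner_scaleC_left cinner_scaleC_right inj_eq)
    show "norm (g j k) \<le> \<bar>C\<bar>" for k
    proof (cases "\<tau> k = 0")
      case False
      with \<tau>[of k] have pos: "\<tau> k > 0" by simp
      have "\<xi> (r j k) \<le> C * \<tau> k"
        using le[of "r j k"] j by (simp add: r_def)
      also have "\<dots> \<le> \<bar>C\<bar> * \<tau> k"
        using pos by (intro mult_right_mono) auto
      finally show ?thesis
        using pos by (simp add: g_def nXx norm_divide field_simps)
    qed (simp add: g_def)
  qed
  have xr: "orthogonal_seq (\<lambda>k. x (r j k)) 1" for j
    by (rule orthogonal_seq_subseq[OF x inj])
  have AB: "bounded_clinear (A j)" "bounded_clinear (B j)" if "j < m" for j
    unfolding A_def B_def using bounded_clinear_series_operator f g[OF that] xr e by blast+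
  have ATe: "A j (T (e k)) = X (x (r j k))" if j: "j < m" for j k
  proof (cases "\<tau> k = 0")
    case True
    then have "T (e k) = 0" using nTe[of k] by simp
    then show ?thesis
      using vanish[OF True j] bounded_clinearD(5)[OF AB(1)[OF j]] by simp
  next
    case False
    have "A j (T (e k)) = (\<Sum>i\<in>{k}. cinner (T (e k)) (f i) *\<^sub>C g j i)"
      unfolding A_def series_operator_def
      by (rule suminf_finite) (auto simp: f_def cinner_scaleC_right orthogonal_seqD(1)[OF Te])
    also have "\<dots> = X (x (r j k))"
      using False
      by (simp add: f_def g_def cinner_scaleC_right cinner_self nTe scaleC_scaleC power2_eq_square
          scaleC_one flip: of_real_mult)
    finally show ?thesis .
  qed
  have "X = (\<lambda>v. \<Sum>j<m. (A j \<circ> (T \<circ> B j)) v)"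
  proof
    fix v
    have "X v = series_operator x (\<lambda>k. X (x k)) v"
      by (rule singular_system_expansion[OF X sysX, symmetric])
    also have "\<dots> = (\<Sum>j<m. series_operator (\<lambda>k. x (r j k)) (\<lambda>k. X (x (r j k))) v)"
      unfolding r_def by (rule series_operator_residue_classes[OF x Xx m])
    also have "\<dots> = (\<Sum>j<m. (A j \<circ> (T \<circ> B j)) v)"
    proof (rule sum.cong)
      fix j assume "j \<in> {..<m}"
      then have j: "j < m" by simp
      have "A j (T (B j v)) = A j (series_operator (\<lambda>k. x (r j k)) (\<lambda>k. T (e k)) v)"
        unfolding B_def by (simp add: compose_series_operator[OF xr e T])
      also have "\<dots> = series_operator (\<lambda>k. x (r j k)) (\<lambda>k. A j (T (e k))) v"
        by (rule compose_series_operator[OF xr Te AB(1)[OF j]])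
      finally show "series_operator (\<lambda>k. x (r j k)) (\<lambda>k. X (x (r j k))) v = (A j \<circ> (T \<circ> B j)) v"
        by (simp add: ATe[OF j])
    qed simp
    finally show "X v = (\<Sum>j<m. (A j \<circ> (T \<circ> B j)) v)" .
  qed
  also have "\<dots> \<in> I"
  proof (rule ideal_BH_sum[OF I(1)])
    show "A j \<circ> (T \<circ> B j) \<in> I" if "j \<in> {..<m}" for j
      using that by (intro ideal_BH_D(2,3)[OF I(1)] I(2) AB) auto
  qed simp
  finally show ?thesis .
qed

context
  assumes inf: "\<nexists>B :: 'a::chilbert_space set. finite B \<and> cspan B = UNIV"
begin

lemma operator_ideal_memberI:
  assumes I: "ideal I BH" "T \<in> I" and T: "compact_operator T"
    and X: "compact_operator (X :: 'a \<Rightarrow> 'a)"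
    and "m > 0" "\<And>n. s_numbers X n \<le> C * s_numbers T (n div m)"
  shows "X \<in> I"
proof -
  obtain e where e: "singular_system T e (s_numbers T)"
    by (rule singular_system_obtain[OF inf T])
  obtain x where x: "singular_system X x (s_numbers X)"
    by (rule singular_system_obtain[OF inf X])
  show ?thesis
    by (rule ideal_BH_memberI[OF I e compact_operatorD(1)[OF X] x assms(5,6)])
qed

lemma compact_operator_zero: "compact_operator (\<lambda>x :: 'a. 0)"
  by (rule compact_operatorI[of _ "{0}"]) (auto intro: bounded_clinear_intros)

lemma s_numbers_surj:
  assumes "\<eta> \<in> c0_star"
  obtains X :: "'a \<Rightarrow> 'a" where "compact_operator X" "s_numbers X = \<eta>"
proof -
  \<comment> \<open>The zero operator supplies an infinite orthonormal sequence, on which the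
    diagonal operator is then built.\<close>
  obtain e :: "nat \<Rightarrow> 'a" where "singular_system (\<lambda>x :: 'a. 0) e (s_numbers (\<lambda>x :: 'a. 0))"
    by (rule singular_system_obtain[OF inf compact_operator_zero])
  from singular_systemD(1)[OF this] have e: "orthonormal_seq e" .
  note D = singular_system_diagonal[OF e assms]
  from D(1) singular_system_s_numbers[OF compact_operatorD(1)[OF D(1)] D(2)] that show ?thesis
    by blast
qed

text \<open>Halving \<open>n\<close> turns the index shift of the sum inequality into an ampliation
  by 2, under which characteristic sets are closed.\<close>

lemma s_numbers_add_div_le:
  assumes X: "compact_operator (X :: 'a \<Rightarrow> 'a)" and Y: "compact_operator (Y :: 'a \<Rightarrow> 'a)"
  shows "s_numbers (\<lambda>x. X x + Y x) n \<le> s_numbers X (n div 2) + s_numbers Y (n div 2)"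
proof -
  have "s_numbers (\<lambda>x. X x + Y x) n \<le> s_numbers (\<lambda>x. X x + Y x) (n div 2 + n div 2)"
    by (intro c0_starD(4)[OF s_numbers_c0_star[OF inf compact_operator_add[OF X Y]]]) linarith
  also have "\<dots> \<le> s_numbers X (n div 2) + s_numbers Y (n div 2)"
    by (rule s_numbers_add_le[OF inf X Y])
  finally show ?thesis .
qed

lemma char_set_ideal_of:
  assumes "\<Sigma> \<subseteq> c0_star"
  shows "char_set (ideal_of \<Sigma> :: ('a \<Rightarrow> 'a) set) = \<Sigma>"
proof
  show "\<Sigma> \<subseteq> char_set (ideal_of \<Sigma> :: ('a \<Rightarrow> 'a) set)"
  proof
    fix \<eta> assume "\<eta> \<in> \<Sigma>"
    moreover obtain X :: "'a \<Rightarrow> 'a" where "compact_operator X" "s_numbers X = \<eta>"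
      using s_numbers_surj \<open>\<eta> \<in> \<Sigma>\<close> assms by blast
    ultimately show "\<eta> \<in> char_set (ideal_of \<Sigma> :: ('a \<Rightarrow> 'a) set)"
      by (auto simp: char_set_def ideal_of_def)
  qed
qed (auto simp: char_set_def ideal_of_def)

lemma ideal_of_subset_iff:
  assumes "\<Sigma> \<subseteq> c0_star"
  shows "(ideal_of \<Sigma> :: ('a \<Rightarrow> 'a) set) \<subseteq> ideal_of \<Sigma>' \<longleftrightarrow> \<Sigma> \<subseteq> \<Sigma>'"
proof
  assume *: "(ideal_of \<Sigma> :: ('a \<Rightarrow> 'a) set) \<subseteq> ideal_of \<Sigma>'"
  show "\<Sigma> \<subseteq> \<Sigma>'"
  proof
    fix \<eta> assume \<eta>: "\<eta> \<in> \<Sigma>"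
    then obtain X :: "'a \<Rightarrow> 'a" where "compact_operator X" "s_numbers X = \<eta>"
      using s_numbers_surj assms by blast
    with * \<eta> show "\<eta> \<in> \<Sigma>'"
      by (auto simp: ideal_of_def)
  qed
qed (auto simp: ideal_of_def)

lemma operator_ideal_ideal_of:
  assumes "characteristic_set \<Sigma>"
  shows "operator_ideal (ideal_of \<Sigma> :: ('a \<Rightarrow> 'a) set)"
proof -
  note D = characteristic_setD[OF assms]
  interpret BH: ring "BH :: ('a \<Rightarrow> 'a) ring" by (rule ring_BH)
  have left: "A \<circ> X \<in> ideal_of \<Sigma>" if X: "X \<in> ideal_of \<Sigma>" and A: "bounded_clinear A" for A X :: "'a \<Rightarrow> 'a"
  proof -
    obtain K where K: "\<And>x. norm (A x) \<le> K * norm x"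
      using bounded_linear.bounded[OF bounded_clinearD(1)[OF A]] by (metis mult.commute)
    have c: "compact_operator X" and s: "s_numbers X \<in> \<Sigma>" using X by (auto simp: ideal_of_def)
    have c': "compact_operator (A \<circ> X)" by (rule compact_operator_compose_left[OF A c])
    have "s_numbers (A \<circ> X) \<in> \<Sigma>"
      by (rule D(4)[OF s s_numbers_c0_star[OF inf c'], of 1])
        (use s_numbers_compose_left_le[OF inf A K c] in auto)
    with c' show ?thesis by (simp add: ideal_of_def)
  qed
  have right: "X \<circ> A \<in> ideal_of \<Sigma>" if X: "X \<in> ideal_of \<Sigma>" and A: "bounded_clinear A" for A X :: "'a \<Rightarrow> 'a"
  proof -
    obtain K where K: "\<And>x. norm (A x) \<le> K * norm x"
      using bounded_linear.bounded[OF bounded_clinearD(1)[OF A]] by (metis mult.commute)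
    have c: "compact_operator X" and s: "s_numbers X \<in> \<Sigma>" using X by (auto simp: ideal_of_def)
    have c': "compact_operator (X \<circ> A)" by (rule compact_operator_compose_right[OF A c])
    have "s_numbers (X \<circ> A) \<in> \<Sigma>"
      by (rule D(4)[OF s s_numbers_c0_star[OF inf c'], of 1])
        (use s_numbers_compose_right_le[OF inf A K c] in auto)
    with c' show ?thesis by (simp add: ideal_of_def)
  qed
  have add: "(\<lambda>x. X x + Y x) \<in> ideal_of \<Sigma>" if "X \<in> ideal_of \<Sigma>" "Y \<in> ideal_of \<Sigma>" for X Y :: "'a \<Rightarrow> 'a"
  proof -
    have X: "compact_operator X" "s_numbers X \<in> \<Sigma>" and Y: "compact_operator Y" "s_numbers Y \<in> \<Sigma>"
      using that by (auto simp: ideal_of_def)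
    have c: "compact_operator (\<lambda>x. X x + Y x)"
      by (rule compact_operator_add[OF X(1) Y(1)])
    have "s_numbers (\<lambda>x. X x + Y x) \<in> \<Sigma>"
      by (rule D(4)[OF D(3)[OF X(2) Y(2)] s_numbers_c0_star[OF inf c], of 2 1])
        (use s_numbers_add_div_le[OF X(1) Y(1)] in auto)
    with c show ?thesis by (simp add: ideal_of_def)
  qed
  have carr: "ideal_of \<Sigma> \<subseteq> carrier (BH :: ('a \<Rightarrow> 'a) ring)"
    by (auto simp: ideal_of_def BH_def compact_operator_def)
  obtain \<xi> where "\<xi> \<in> \<Sigma>" using D(2) by blast
  then obtain Z :: "'a \<Rightarrow> 'a" where Z: "Z \<in> ideal_of \<Sigma>"
    using s_numbers_surj D(1) unfolding ideal_of_def by blast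
  have "ideal (ideal_of \<Sigma>) (BH :: ('a \<Rightarrow> 'a) ring)"
  proof (rule idealI)
    show "subgroup (ideal_of \<Sigma>) (add_monoid (BH :: ('a \<Rightarrow> 'a) ring))"
    proof (rule group.subgroupI)
      show "group (add_monoid (BH :: ('a \<Rightarrow> 'a) ring))"
        by (rule BH.a_group)
      \<comment> \<open>Additive inverses come from left multiplication by the negative of the
        identity, under which the set is already closed.\<close>
      fix X :: "'a \<Rightarrow> 'a" assume X: "X \<in> ideal_of \<Sigma>"
      have "\<ominus>\<^bsub>BH\<^esub> X = (\<ominus>\<^bsub>BH\<^esub> \<one>\<^bsub>BH\<^esub>) \<otimes>\<^bsub>BH\<^esub> X"
        using X carr by (simp add: BH.l_minus subset_iff)
      moreover have "bounded_clinear (\<ominus>\<^bsub>BH\<^esub> \<one>\<^bsub>BH\<^esub> :: 'a \<Rightarrow> 'a)"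
        using BH.a_inv_closed[OF BH.one_closed] by (simp add: BH_def)
      ultimately show "inv\<^bsub>add_monoid BH\<^esub> X \<in> ideal_of \<Sigma>"
        using left[OF X] by (simp add: a_inv_def BH_def)
    qed (use carr Z add in \<open>auto simp: BH_def\<close>)
  qed (use left right ring_BH in \<open>auto simp: BH_def\<close>)
  then show ?thesis
    by (auto simp: operator_ideal_def ideal_of_def)
qed

lemma operator_ideal_eq_ideal_of:
  assumes "operator_ideal (I :: ('a \<Rightarrow> 'a) set)"
  shows "I = ideal_of (char_set I)"
proof
  have I: "ideal I BH" and c: "\<And>X. X \<in> I \<Longrightarrow> compact_operator X"
    using assms by (auto simp: operator_ideal_def)
  show "I \<subseteq> ideal_of (char_set I)"
    using c by (auto simp: ideal_of_def char_set_def)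
  show "ideal_of (char_set I) \<subseteq> I"
  proof
    fix X :: "'a \<Rightarrow> 'a" assume "X \<in> ideal_of (char_set I)"
    then obtain T where T: "T \<in> I" "s_numbers X = s_numbers T" and X: "compact_operator X"
      by (auto simp: ideal_of_def char_set_def)
    show "X \<in> I"
      by (rule operator_ideal_memberI[OF I T(1) c[OF T(1)] X, of 1 1]) (simp_all add: T(2))
  qed
qed

text \<open>Existence in the description is provided by \<open>ideal_of\<close>, whence the
  hypothesis; uniqueness holds because an ideal is recovered from its characteristic set.\<close>

lemma pre_am_ideal_eq:
  assumes "characteristic_set {\<xi> \<in> c0_star. arith_mean \<xi> \<in> char_set (I :: ('a \<Rightarrow> 'a) set)}"
  shows "pre_am_ideal I = ideal_of {\<xi> \<in> c0_star. arith_mean \<xi> \<in> char_set I}"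
proof -
  let ?S = "{\<xi> \<in> c0_star. arith_mean \<xi> \<in> char_set I}"
  show ?thesis
    unfolding pre_am_ideal_def
  proof (rule the_equality)
    show "operator_ideal (ideal_of ?S :: ('a \<Rightarrow> 'a) set) \<and> char_set (ideal_of ?S :: ('a \<Rightarrow> 'a) set) = ?S"
      using operator_ideal_ideal_of[OF assms] char_set_ideal_of[of ?S] by blast
    show "J = ideal_of ?S" if "operator_ideal J \<and> char_set J = ?S" for J :: "('a \<Rightarrow> 'a) set"
      using operator_ideal_eq_ideal_of[of J] that by simp
  qed
qed

text \<open>\<open>dom\<close> gives the substantial inclusion: each member of
  \<open>ideal_of \<Sigma>\<close> is a finite sum of products through \<open>T\<close>.\<close>

lemma Idl_eq_ideal_of:
  assumes T: "compact_operator (T :: 'a \<Rightarrow> 'a)"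
    and \<Sigma>: "characteristic_set \<Sigma>" "s_numbers T \<in> \<Sigma>"
    and dom: "\<And>\<eta>. \<eta> \<in> \<Sigma> \<Longrightarrow> \<exists>C m. m > 0 \<and> (\<forall>n. \<eta> n \<le> C * s_numbers T (n div m))"
  shows "Idl\<^bsub>BH\<^esub> {T} = ideal_of \<Sigma>"
proof
  interpret BH: ring "BH :: ('a \<Rightarrow> 'a) ring" by (rule ring_BH)
  have carr: "{T} \<subseteq> carrier BH"
    using compact_operatorD(1)[OF T] by (simp add: BH_def)
  show "Idl\<^bsub>BH\<^esub> {T} \<subseteq> ideal_of \<Sigma>"
    using operator_ideal_ideal_of[OF \<Sigma>(1)] T \<Sigma>(2)
    by (intro BH.genideal_minimal) (auto simp: operator_ideal_def ideal_of_def)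
  have I: "ideal (Idl\<^bsub>BH\<^esub> {T}) BH" "T \<in> Idl\<^bsub>BH\<^esub> {T}"
    using BH.genideal_ideal[OF carr] BH.genideal_self[OF carr] by auto
  show "ideal_of \<Sigma> \<subseteq> Idl\<^bsub>BH\<^esub> {T}"
  proof
    fix X :: "'a \<Rightarrow> 'a" assume "X \<in> ideal_of \<Sigma>"
    then have X: "compact_operator X" "s_numbers X \<in> \<Sigma>" by (auto simp: ideal_of_def)
    from dom[OF X(2)] obtain C m where "m > 0" "\<And>n. s_numbers X n \<le> C * s_numbers T (n div m)"
      by blast
    then show "X \<in> Idl\<^bsub>BH\<^esub> {T}"
      by (rule operator_ideal_memberI[OF I T X(1)])
  qed
qed

end

section \<open>Regular sequences\<close>

text \<open>The O-relation up to ampliation that governs inclusion of principal ideals, with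
  zero-based indices. The sign of \<open>C\<close> is left open and made positive in
  \<open>dominatedE\<close>.\<close>

definition dominated :: "(nat \<Rightarrow> real) \<Rightarrow> (nat \<Rightarrow> real) \<Rightarrow> bool" where
  "dominated \<eta> \<xi> \<longleftrightarrow> (\<exists>C m. m > 0 \<and> (\<forall>n. \<eta> n \<le> C * \<xi> (n div m)))"

definition regular :: "(nat \<Rightarrow> real) \<Rightarrow> bool" where
  "regular \<xi> \<longleftrightarrow> (\<exists>K. \<forall>n. arith_mean \<xi> n \<le> K * \<xi> n)"

text \<open>Says that \<open>(n + 1) powr p * \<xi> n\<close> increases up to the factor
  \<open>C\<close>; the shift by one matches the indexing from 0.\<close>

definition almost_increasing :: "real \<Rightarrow> (nat \<Rightarrow> real) \<Rightarrow> bool" where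
  "almost_increasing p \<xi> \<longleftrightarrow>
     (\<exists>C>0. \<forall>n m. n \<le> m \<longrightarrow> \<xi> n \<le> C * (real (m + 1) / real (n + 1)) powr p * \<xi> m)"

lemma dominatedI:
  assumes "\<And>n. \<eta> n \<le> C * \<xi> n"
  shows "dominated \<eta> \<xi>"
  unfolding dominated_def using assms by (intro exI[of _ C] exI[of _ 1]) simp

lemma dominatedE:
  assumes "dominated \<eta> \<xi>" "\<xi> \<in> c0_star"
  obtains C m where "C > 0" "m > 0" "\<And>n. \<eta> n \<le> C * \<xi> (n div m)"
proof -
  obtain C m where Cm: "m > 0" "\<And>n. \<eta> n \<le> C * \<xi> (n div m)"
    using assms(1) by (auto simp: dominated_def)
  have "\<eta> n \<le> (\<bar>C\<bar> + 1) * \<xi> (n div m)" for n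
    using Cm(2)[of n] mult_right_mono[OF _ c0_starD(1)[OF assms(2)], of C "\<bar>C\<bar> + 1" "n div m"]
    by linarith
  with Cm(1) show ?thesis
    by (intro that[of "\<bar>C\<bar> + 1" m]) auto
qed

lemma dominated_trans:
  assumes "dominated \<zeta> \<eta>" "dominated \<eta> \<xi>" "\<eta> \<in> c0_star" "\<xi> \<in> c0_star"
  shows "dominated \<zeta> \<xi>"
proof -
  obtain C m where 1: "C > 0" "m > 0" "\<And>n. \<zeta> n \<le> C * \<eta> (n div m)"
    using dominatedE[OF assms(1,3)] by blast
  obtain D k where 2: "D > 0" "k > 0" "\<And>n. \<eta> n \<le> D * \<xi> (n div k)"
    using dominatedE[OF assms(2,4)] by blast
  have "\<zeta> n \<le> (C * D) * \<xi> (n div (m * k))" for n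
  proof -
    have "\<zeta> n \<le> C * (D * \<xi> (n div m div k))"
      using 1(3)[of n] mult_left_mono[OF 2(3)[of "n div m"], of C] 1(1) by linarith
    then show ?thesis by (simp add: div_mult2_eq mult.assoc)
  qed
  with 1(2) 2(2) show ?thesis
    unfolding dominated_def by (intro exI[of _ "C * D"] exI[of _ "m * k"]) simp
qed

lemma dominated_add:
  assumes "dominated \<zeta> \<xi>" "dominated \<eta> \<xi>" "\<xi> \<in> c0_star"
  shows "dominated (\<lambda>n. \<zeta> n + \<eta> n) \<xi>"
proof -
  obtain C m where 1: "C > 0" "m > 0" "\<And>n. \<zeta> n \<le> C * \<xi> (n div m)"
    using dominatedE[OF assms(1,3)] by blast
  obtain D k where 2: "D > 0" "k > 0" "\<And>n. \<eta> n \<le> D * \<xi> (n div k)"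
    using dominatedE[OF assms(2,3)] by blast
  have "\<zeta> n + \<eta> n \<le> (C + D) * \<xi> (n div (m * k))" for n
  proof -
    have *: "n div (m * k) \<le> n div m" "n div (m * k) \<le> n div k"
      using 1(2) 2(2) by (auto intro!: div_le_mono2)
    have "C * \<xi> (n div m) \<le> C * \<xi> (n div (m * k))" "D * \<xi> (n div k) \<le> D * \<xi> (n div (m * k))"
      using 1(1) 2(1) c0_starD(4)[OF assms(3)] * by (auto intro!: mult_left_mono)
    with 1(3)[of n] 2(3)[of n] show ?thesis
      by (simp add: distrib_right)
  qed
  with 1(2) 2(2) show ?thesis
    unfolding dominated_def by (intro exI[of _ "C + D"] exI[of _ "m * k"]) simp
qed

lemma arith_mean_c0_star:
  assumes \<xi>: "\<xi> \<in> c0_star"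
  shows "arith_mean \<xi> \<in> c0_star"
proof -
  note D = c0_starD[OF \<xi>]
  have nonneg: "arith_mean \<xi> n \<ge> 0" for n
    unfolding arith_mean_def using D(1) by (intro divide_nonneg_nonneg sum_nonneg) auto
  have "arith_mean \<xi> (Suc n) \<le> arith_mean \<xi> n" for n
  proof -
    have "(\<Sum>j\<le>n. \<xi> (Suc n)) \<le> (\<Sum>j\<le>n. \<xi> j)"
      using D(4) by (intro sum_mono) auto
    then have "real (n + 1) * \<xi> (Suc n) \<le> (\<Sum>j\<le>n. \<xi> j)" by simp
    then show ?thesis
      by (simp add: arith_mean_def field_simps)
  qed
  then have dec: "decseq (arith_mean \<xi>)"
    by (rule decseq_SucI)
  have "arith_mean \<xi> \<longlonglongrightarrow> 0"
  proof (rule LIMSEQ_I)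
    fix r :: real assume r: "r > 0"
    obtain N where N: "\<And>n. n \<ge> N \<Longrightarrow> \<xi> n < r / 2"
    proof -
      have "\<forall>\<^sub>F n in sequentially. \<xi> n < r / 2"
        by (rule order_tendstoD(2)[OF D(3)]) (use r in simp)
      then show ?thesis
        using that unfolding eventually_sequentially by blast
    qed
    \<comment> \<open>From \<open>M\<close> on, the first \<open>N\<close> terms, each at most
      \<open>\<xi> 0\<close>, contribute less than \<open>r / 2\<close> to the mean.\<close>
    obtain M :: nat where M: "2 * (real N * \<xi> 0) / r < real M"
      using reals_Archimedean2 by blast
    have "norm (arith_mean \<xi> n - 0) < r" if n: "n \<ge> M" for n
    proof -
      have "(\<Sum>j\<le>n. \<xi> j) \<le> (\<Sum>j\<le>n. (if j < N then \<xi> 0 else 0) + r / 2)"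
        using N D(4)[of 0] r by (intro sum_mono) (auto simp: not_less less_imp_le intro: add_increasing2)
      also have "\<dots> = (\<Sum>j | j \<le> n \<and> j < N. \<xi> 0) + real (n + 1) * (r / 2)"
        by (simp add: sum.distrib sum.If_cases Int_def)
      also have "(\<Sum>j | j \<le> n \<and> j < N. \<xi> 0) \<le> real N * \<xi> 0"
      proof -
        have "card {j. j \<le> n \<and> j < N} \<le> card {..<N}"
          by (intro card_mono) auto
        then show ?thesis
          using D(1)[of 0] by (simp add: mult_right_mono)
      qed
      also have "real N * \<xi> 0 < real (n + 1) * (r / 2)"
      proof -
        have "2 * (real N * \<xi> 0) < real M * r"
          using M r by (simp add: field_simps)
        also have "real M * r \<le> real (n + 1) * r"
          using n r by (intro mult_right_mono) auto
        finally show ?thesis by simp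
      qed
      finally have "(\<Sum>j\<le>n. \<xi> j) < real (n + 1) * r" by (simp add: field_simps)
      then show ?thesis
        using nonneg[of n] by (simp add: arith_mean_def field_simps)
    qed
    then show "\<exists>M. \<forall>n\<ge>M. norm (arith_mean \<xi> n - 0) < r" by blast
  qed
  with nonneg dec show ?thesis
    by (simp add: c0_star_def)
qed

lemma le_arith_mean:
  assumes "\<xi> \<in> c0_star"
  shows "\<xi> n \<le> arith_mean \<xi> n"
proof -
  have "(\<Sum>j\<le>n. \<xi> n) \<le> (\<Sum>j\<le>n. \<xi> j)"
    using c0_starD(4)[OF assms] by (intro sum_mono) auto
  then show ?thesis
    by (simp add: arith_mean_def field_simps)
qed

text \<open>Each value of \<xi> occurs at most \<open>m\<close> times in the ampliated sum, so
  averaging trades the ampliation for the factor \<open>m\<close>.\<close>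

lemma arith_mean_ampliation:
  assumes \<xi>: "\<xi> \<in> c0_star" and m: "m > 0" and "C \<ge> 0" "\<And>n. \<eta> n \<le> C * \<xi> (n div m)"
  shows "arith_mean \<eta> n \<le> (C * real m) * arith_mean \<xi> n"
proof -
  have "(\<Sum>j\<le>n. \<xi> (j div m)) = (\<Sum>i\<le>n. \<Sum>j | j \<in> {..n} \<and> j div m = i. \<xi> (j div m))"
    using m by (intro sum.group[symmetric]) (auto intro: order_trans[OF div_le_dividend])
  also have "\<dots> = (\<Sum>i\<le>n. real (card {j \<in> {..n}. j div m = i}) * \<xi> i)"
    by (intro sum.cong) auto
  also have "\<dots> \<le> (\<Sum>i\<le>n. real m * \<xi> i)"
  proof (intro sum_mono mult_right_mono c0_starD(1)[OF \<xi>])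
    fix i
    have "{j \<in> {..n}. j div m = i} \<subseteq> {i * m..<i * m + m}"
      using m by (auto simp: div_nat_eqI dividend_less_times_div algebra_simps)
    from card_mono[OF _ this] show "real (card {j \<in> {..n}. j div m = i}) \<le> real m"
      by simp
  qed
  finally have *: "(\<Sum>j\<le>n. \<xi> (j div m)) \<le> real m * (\<Sum>i\<le>n. \<xi> i)"
    by (simp add: sum_distrib_left)
  have "(\<Sum>j\<le>n. \<eta> j) \<le> (\<Sum>j\<le>n. C * \<xi> (j div m))"
    by (intro sum_mono assms(4))
  also have "\<dots> \<le> C * (real m * (\<Sum>i\<le>n. \<xi> i))"
    using * \<open>C \<ge> 0\<close> by (simp add: sum_distrib_left[symmetric] mult_left_mono)
  finally show ?thesis
    by (simp add: arith_mean_def divide_right_mono mult.assoc)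
qed

text \<open>At the index \<open>n * m\<close> the ampliation returns \<open>\<xi> n\<close>, and
  passing from \<open>n\<close> to \<open>n * m\<close> costs the mean at most a factor
  \<open>m\<close>.\<close>

lemma regular_if_dominated_arith_mean:
  assumes \<xi>: "\<xi> \<in> c0_star" and "dominated (arith_mean \<xi>) \<xi>"
  shows "regular \<xi>"
proof -
  obtain C m where Cm: "C > 0" "m > 0" "\<And>n. arith_mean \<xi> n \<le> C * \<xi> (n div m)"
    using dominatedE[OF assms(2,1)] by blast
  have "arith_mean \<xi> n \<le> (real m * C) * \<xi> n" for n
  proof -
    have "(\<Sum>j\<le>n. \<xi> j) \<le> (\<Sum>j\<le>n * m. \<xi> j)"
      using Cm(2) c0_starD(1)[OF \<xi>] by (intro sum_mono2) auto
    then have "arith_mean \<xi> n \<le> (\<Sum>j\<le>n * m. \<xi> j) / real (n + 1)"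
      unfolding arith_mean_def by (intro divide_right_mono) auto
    also have "\<dots> \<le> (\<Sum>j\<le>n * m. \<xi> j) / (real (n * m + 1) / real m)"
    proof (rule divide_left_mono)
      have "real (n * m + 1) \<le> real ((n + 1) * m)"
        unfolding of_nat_le_iff using Cm(2) by simp
      also have "\<dots> = real (n + 1) * real m"
        by (rule of_nat_mult)
      finally show "real (n * m + 1) / real m \<le> real (n + 1)"
        using Cm(2) by (subst pos_divide_le_eq) simp_all
      show "0 \<le> (\<Sum>j\<le>n * m. \<xi> j)"
        using c0_starD(1)[OF \<xi>] by (intro sum_nonneg) auto
      show "0 < real (n + 1) * (real (n * m + 1) / real m)"
        using Cm(2) by (intro mult_pos_pos divide_pos_pos) (auto intro: add_pos_nonneg)
    qed
    also have "\<dots> = real m * arith_mean \<xi> (n * m)"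
      by (simp add: arith_mean_def)
    also have "\<dots> \<le> real m * (C * \<xi> (n * m div m))"
      by (intro mult_left_mono Cm(3)) simp
    finally show ?thesis
      using Cm(2) by (simp add: mult.assoc)
  qed
  then show ?thesis
    unfolding regular_def by blast
qed

lemma regular_dominated_iff:
  assumes \<xi>: "\<xi> \<in> c0_star" and reg: "regular \<xi>" and \<eta>: "\<eta> \<in> c0_star"
  shows "dominated \<eta> \<xi> \<longleftrightarrow> dominated (arith_mean \<eta>) \<xi>"
    and "dominated \<eta> \<xi> \<longleftrightarrow> (\<exists>C>0. \<forall>n. \<eta> n \<le> C * \<xi> n)"
proof -
  obtain K where K: "\<And>n. arith_mean \<xi> n \<le> K * \<xi> n"
    using reg by (auto simp: regular_def)
  \<comment> \<open>The mean absorbs the ampliation, then regularity of \<xi> removes the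
    mean.\<close>
  have main: "\<exists>C>0. \<forall>n. arith_mean \<eta> n \<le> C * \<xi> n" if d: "dominated \<eta> \<xi>"
  proof -
    obtain C m where Cm: "C > 0" "m > 0" "\<And>n. \<eta> n \<le> C * \<xi> (n div m)"
      using dominatedE[OF d \<xi>] by blast
    have "arith_mean \<eta> n \<le> (C * real m * (\<bar>K\<bar> + 1)) * \<xi> n" for n
    proof -
      have "arith_mean \<eta> n \<le> (C * real m) * arith_mean \<xi> n"
        using Cm by (intro arith_mean_ampliation[OF \<xi>]) auto
      also have "\<dots> \<le> (C * real m) * ((\<bar>K\<bar> + 1) * \<xi> n)"
      proof (rule mult_left_mono)
        show "arith_mean \<xi> n \<le> (\<bar>K\<bar> + 1) * \<xi> n"
          using K[of n] mult_right_mono[OF _ c0_starD(1)[OF \<xi>], of K "\<bar>K\<bar> + 1" n] by linarith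
      qed (use Cm in simp)
      finally show ?thesis by (simp add: mult.assoc)
    qed
    moreover have "C * real m * (\<bar>K\<bar> + 1) > 0"
      using Cm by (intro mult_pos_pos) auto
    ultimately show ?thesis by blast
  qed
  show "dominated \<eta> \<xi> \<longleftrightarrow> dominated (arith_mean \<eta>) \<xi>"
  proof
    show "dominated (arith_mean \<eta>) \<xi>" if "dominated \<eta> \<xi>"
      using main[OF that] dominatedI by blast
    show "dominated \<eta> \<xi>" if "dominated (arith_mean \<eta>) \<xi>"
      using dominated_trans[OF dominatedI[of \<eta> 1 "arith_mean \<eta>"] that arith_mean_c0_star[OF \<eta>] \<xi>]
        le_arith_mean[OF \<eta>] by simp
  qed
  show "dominated \<eta> \<xi> \<longleftrightarrow> (\<exists>C>0. \<forall>n. \<eta> n \<le> C * \<xi> n)"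
    using main le_arith_mean[OF \<eta>] dominatedI order_trans by metis
qed

section \<open>Regularity as a growth condition with exponent below 1\<close>

text \<open>Used with \<open>x = 1 / (n + 2)\<close>, where \<open>1 - x\<close> is a ratio of
  consecutive integers. The factor 2 comes from \<open>x / (1 - x) \<le> 2 * x\<close> for
  \<open>x \<le> 1 / 2\<close>.\<close>

lemma one_minus_powr_ge:
  fixes x \<epsilon> :: real
  assumes "0 \<le> x" "x \<le> 1 / 2" "\<epsilon> \<ge> 0"
  shows "1 - 2 * \<epsilon> * x \<le> (1 - x) powr \<epsilon>"
proof -
  have "- ln (1 - x) = ln (1 / (1 - x))"
    using assms by (simp add: ln_div)
  also have "\<dots> \<le> 1 / (1 - x) - 1"
    using assms by (intro ln_le_minus_one) auto
  also have "\<dots> \<le> 2 * x"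
    using assms mult_left_mono[OF assms(2,1)] by (simp add: field_simps)
  finally have "- (2 * x) * \<epsilon> \<le> ln (1 - x) * \<epsilon>"
    using assms by (intro mult_right_mono) auto
  also have "1 + ln (1 - x) * \<epsilon> \<le> exp (ln (1 - x) * \<epsilon>)"
    by (rule exp_ge_add_one_self)
  then have "1 + ln (1 - x) * \<epsilon> \<le> (1 - x) powr \<epsilon>"
    using assms by (simp add: powr_def mult.commute)
  ultimately show ?thesis by (simp add: mult_ac)
qed

text \<open>Follows from \<open>1 - x \<le> exp (- x)\<close> and, for \<open>y = a * x\<close>
  between 0 and 1, \<open>exp (- y) \<le> 1 / (1 + y) \<le> 1 - y / 2\<close>.\<close>

lemma one_minus_powr_le:
  fixes x a :: real
  assumes "0 \<le> x" "x < 1" "0 \<le> a" "a \<le> 1"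
  shows "(1 - x) powr a \<le> 1 - a * x / 2"
proof -
  have "ln (1 - x) \<le> - x"
    using ln_le_minus_one[of "1 - x"] assms by simp
  then have "a * ln (1 - x) \<le> a * (- x)"
    using assms by (intro mult_left_mono) auto
  then have "(1 - x) powr a \<le> exp (- (a * x))"
    using assms by (simp add: powr_def)
  also have "\<dots> = inverse (exp (a * x))"
    by (rule exp_minus)
  also have "\<dots> \<le> inverse (1 + a * x)"
    using assms by (intro le_imp_inverse_le exp_ge_add_one_self) (simp add: add_pos_nonneg)
  also have "\<dots> \<le> 1 - a * x / 2"
  proof -
    have "a * x \<le> 1" using assms mult_mono[of a 1 x 1] by simp
    then have "1 \<le> (1 - a * x / 2) * (1 + a * x)"
      using assms mult_left_mono[of "a * x" 1 "a * x"] by (simp add: algebra_simps)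
    then show ?thesis
      using assms by (simp add: inverse_eq_divide divide_le_eq add_pos_nonneg)
  qed
  finally show ?thesis .
qed

text \<open>Regularity bounds each increment of the partial sums below by a multiple of their
  average, so \<open>S n / (n + 1) powr \<epsilon>\<close> increases; as \<open>\<xi> n\<close> is
  comparable with \<open>S n / (n + 1)\<close>, it inherits the exponent
  \<open>1 - \<epsilon>\<close>.\<close>

lemma regular_imp_almost_increasing:
  assumes \<xi>: "\<xi> \<in> c0_star" and reg: "regular \<xi>"
  shows "\<exists>p. 0 < p \<and> p < 1 \<and> almost_increasing p \<xi>"
proof -
  note D = c0_starD[OF \<xi>]
  obtain K where K: "K \<ge> 1" "\<And>n. arith_mean \<xi> n \<le> K * \<xi> n"
  proof -
    obtain K where "\<And>n. arith_mean \<xi> n \<le> K * \<xi> n"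
      using reg by (auto simp: regular_def)
    then have "arith_mean \<xi> n \<le> max 1 K * \<xi> n" for n
      using mult_right_mono[OF max.cobounded2[of K 1] D(1)[of n]] order_trans by blast
    then show ?thesis by (intro that[of "max 1 K"]) auto
  qed
  \<comment> \<open>The 2 cancels the factor in \<open>one_minus_powr_ge\<close>;
    \<open>K \<ge> 1\<close> gives \<open>\<epsilon> < 1\<close>.\<close>
  define \<epsilon> where "\<epsilon> = 1 / (2 * K)"
  have \<epsilon>: "0 < \<epsilon>" "\<epsilon> < 1" "2 * \<epsilon> * K = 1" using K(1) by (auto simp: \<epsilon>_def field_simps)
  define S where "S n = (\<Sum>j\<le>n. \<xi> j)" for n
  have S_nonneg: "S n \<ge> 0" for n unfolding S_def by (intro sum_nonneg D(1))
  have am: "arith_mean \<xi> n = S n / real (n + 1)" for n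
    by (simp add: arith_mean_def S_def)
  define f where "f n = S n / real (n + 1) powr \<epsilon>" for n
  have "f n \<le> f (Suc n)" for n
  proof -
    define x where "x = 1 / real (n + 2)"
    have x: "0 \<le> x" "x \<le> 1 / 2" by (auto simp: x_def field_simps)
    have "S (Suc n) * x \<le> K * \<xi> (Suc n)"
      using K(2)[of "Suc n"] by (simp add: am x_def)
    then have "2 * \<epsilon> * (S (Suc n) * x) \<le> 2 * \<epsilon> * (K * \<xi> (Suc n))"
      using \<epsilon> by (intro mult_left_mono) auto
    also have "\<dots> = \<xi> (Suc n)"
      using \<epsilon>(3) by (simp add: mult.assoc[symmetric])
    finally have "S n \<le> S (Suc n) * (1 - 2 * \<epsilon> * x)"
      by (simp add: S_def algebra_simps)
    also have "\<dots> \<le> S (Suc n) * (1 - x) powr \<epsilon>"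
      using x \<epsilon> by (intro mult_left_mono one_minus_powr_ge S_nonneg) auto
    also have "1 - x = real (n + 1) / real (n + 2)"
      by (simp add: x_def field_simps)
    also have "\<dots> powr \<epsilon> = real (n + 1) powr \<epsilon> / real (n + 2) powr \<epsilon>"
      by (rule powr_divide)
    finally show ?thesis
      by (simp add: f_def field_simps)
  qed
  then have f_mono: "f n \<le> f m" if "n \<le> m" for n m
    using that by (rule lift_Suc_mono_le)
  have "\<xi> n \<le> K * (real (m + 1) / real (n + 1)) powr (1 - \<epsilon>) * \<xi> m" if nm: "n \<le> m" for n m
  proof -
    define a b where "a = real (n + 1)" and "b = real (m + 1)"
    have ab: "a > 0" "b > 0" by (auto simp: a_def b_def)
    have "\<xi> n \<le> S n / a"
      using le_arith_mean[OF \<xi>, of n] by (simp add: am a_def)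
    also have "S n = f n * a powr \<epsilon>"
      by (simp add: f_def a_def)
    also have "f n * a powr \<epsilon> / a \<le> f m * a powr \<epsilon> / a"
      using f_mono[OF nm] ab by (intro divide_right_mono mult_right_mono) auto
    also have "f m = arith_mean \<xi> m * b / b powr \<epsilon>"
      by (simp add: f_def am b_def)
    also have "arith_mean \<xi> m * b / b powr \<epsilon> * a powr \<epsilon> / a = arith_mean \<xi> m * (b / a) powr (1 - \<epsilon>)"
      using ab by (simp add: powr_divide powr_diff field_simps)
    also have "\<dots> \<le> (K * \<xi> m) * (b / a) powr (1 - \<epsilon>)"
      by (intro mult_right_mono K(2)) simp
    finally show ?thesis
      by (simp add: a_def b_def mult_ac)
  qed
  then have "almost_increasing (1 - \<epsilon>) \<xi>"
    unfolding almost_increasing_def using K(1) by (intro exI[of _ K]) auto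
  with \<epsilon> show ?thesis by (intro exI[of _ "1 - \<epsilon>"]) auto
qed

text \<open>Discrete form of the integral of a power; the constant is twice that of the integral
  because \<open>one_minus_powr_le\<close> loses a factor 2.\<close>

lemma sum_powr_le:
  assumes "0 < q" "q < 1"
  shows "(\<Sum>j\<le>n. real (j + 1) powr (- q)) \<le> 2 / (1 - q) * real (n + 1) powr (1 - q)"
proof (induction n)
  case 0
  then show ?case using assms by (simp add: field_simps)
next
  case (Suc n)
  define a where "a = 1 - q"
  have a: "0 < a" "a < 1" using assms by (auto simp: a_def)
  define b where "b = real (n + 2)"
  have b: "b \<ge> 2" by (simp add: b_def)
  have "(1 - 1 / b) powr a \<le> 1 - a * (1 / b) / 2"
    using a b by (intro one_minus_powr_le) auto
  then have "(1 - 1 / b) powr a * b powr a \<le> (1 - a * (1 / b) / 2) * b powr a"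
    by (intro mult_right_mono) auto
  also have "(1 - 1 / b) powr a * b powr a = ((1 - 1 / b) * b) powr a"
    by (rule powr_mult[symmetric])
  also have "(1 - 1 / b) * b = real (n + 1)"
    using b by (simp add: left_diff_distrib) (simp add: b_def)
  finally have "2 / a * real (n + 1) powr a \<le> 2 / a * ((1 - a * (1 / b) / 2) * b powr a)"
    using a by (intro mult_left_mono) auto
  also have "\<dots> = 2 / a * b powr a - b powr a / b"
    using a b by (simp add: field_simps)
  also have "b powr a / b = b powr (- q)"
    using b by (simp add: a_def powr_diff powr_minus field_simps)
  finally show ?case
    using Suc.IH by (simp add: a_def b_def add.commute)
qed

text \<open>Every earlier term is at most a multiple of \<open>(j + 1) powr (- q)\<close>, and for
  \<open>q < 1\<close> these powers sum to the order of \<open>n powr (1 - q)\<close>, which leaves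
  a sum of order \<open>n * \<xi> n\<close>.\<close>

lemma almost_increasing_imp_regular:
  assumes \<xi>: "\<xi> \<in> c0_star" and q: "0 < q" "q < 1" and inc: "almost_increasing q \<xi>"
  shows "regular \<xi>"
proof -
  obtain C where C: "C > 0"
    "\<And>n m. n \<le> m \<Longrightarrow> \<xi> n \<le> C * (real (m + 1) / real (n + 1)) powr q * \<xi> m"
    using inc by (auto simp: almost_increasing_def)
  have "arith_mean \<xi> n \<le> (C * (2 / (1 - q))) * \<xi> n" for n
  proof -
    define b where "b = real (n + 1)"
    have b: "b > 0" by (simp add: b_def)
    have "(\<Sum>j\<le>n. \<xi> j) \<le> (\<Sum>j\<le>n. C * b powr q * \<xi> n * real (j + 1) powr (- q))"
    proof (rule sum_mono)
      fix j assume "j \<in> {..n}"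
      then have "\<xi> j \<le> C * (b / real (j + 1)) powr q * \<xi> n"
        using C(2)[of j n] by (simp add: b_def)
      also have "(b / real (j + 1)) powr q = b powr q * real (j + 1) powr (- q)"
        using b by (simp add: powr_divide powr_minus_divide)
      finally show "\<xi> j \<le> C * b powr q * \<xi> n * real (j + 1) powr (- q)"
        by (simp add: mult_ac)
    qed
    also have "\<dots> = C * b powr q * \<xi> n * (\<Sum>j\<le>n. real (j + 1) powr (- q))"
      by (simp add: sum_distrib_left)
    also have "\<dots> \<le> C * b powr q * \<xi> n * (2 / (1 - q) * b powr (1 - q))"
      unfolding b_def using sum_powr_le[OF q] C(1) c0_starD(1)[OF \<xi>]
      by (intro mult_left_mono) (auto intro!: mult_nonneg_nonneg)
    also have "\<dots> = C * (2 / (1 - q)) * \<xi> n * b"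
      using b by (simp add: powr_diff)
    finally show ?thesis
      unfolding arith_mean_def b_def[symmetric] pos_divide_le_eq[OF b] .
  qed
  then show ?thesis
    unfolding regular_def by blast
qed

lemma almost_increasing_pos:
  assumes "\<xi> \<in> c0_star" "almost_increasing p \<xi>" "\<xi> 0 > 0"
  shows "\<xi> n > 0"
proof -
  obtain C where "C > 0" "\<xi> 0 \<le> C * (real (n + 1) / real (0 + 1)) powr p * \<xi> n"
    using assms(2) unfolding almost_increasing_def by blast
  with assms(3) have "\<xi> n \<noteq> 0" by auto
  with c0_starD(1)[OF assms(1), of n] show ?thesis by simp
qed

lemma almost_increasing_mono:
  assumes "almost_increasing p \<xi>" "p \<le> q" "\<xi> \<in> c0_star"
  shows "almost_increasing q \<xi>"
proof -
  obtain C where C: "C > 0"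
    "\<And>n m. n \<le> m \<Longrightarrow> \<xi> n \<le> C * (real (m + 1) / real (n + 1)) powr p * \<xi> m"
    using assms(1) by (auto simp: almost_increasing_def)
  have "\<xi> n \<le> C * (real (m + 1) / real (n + 1)) powr q * \<xi> m" if "n \<le> m" for n m
  proof -
    have "(real (m + 1) / real (n + 1)) powr p \<le> (real (m + 1) / real (n + 1)) powr q"
      using that assms(2) by (intro powr_mono) auto
    then have "C * (real (m + 1) / real (n + 1)) powr p * \<xi> m
        \<le> C * (real (m + 1) / real (n + 1)) powr q * \<xi> m"
      using C(1) c0_starD(1)[OF assms(3)] by (intro mult_right_mono mult_left_mono) auto
    with C(2)[OF that] show ?thesis by linarith
  qed
  with C(1) show ?thesis unfolding almost_increasing_def by blast
qed

lemma almost_increasing_sqrt: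
  assumes "almost_increasing p \<alpha>" "almost_increasing p \<beta>" "\<alpha> \<in> c0_star" "\<beta> \<in> c0_star"
  shows "almost_increasing p (\<lambda>n. sqrt (\<alpha> n * \<beta> n))"
proof -
  obtain C where C: "C > 0"
    "\<And>n m. n \<le> m \<Longrightarrow> \<alpha> n \<le> C * (real (m + 1) / real (n + 1)) powr p * \<alpha> m"
    using assms(1) by (auto simp: almost_increasing_def)
  obtain D where D: "D > 0"
    "\<And>n m. n \<le> m \<Longrightarrow> \<beta> n \<le> D * (real (m + 1) / real (n + 1)) powr p * \<beta> m"
    using assms(2) by (auto simp: almost_increasing_def)
  have "sqrt (\<alpha> n * \<beta> n) \<le> sqrt (C * D) * (real (m + 1) / real (n + 1)) powr p * sqrt (\<alpha> m * \<beta> m)"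
    if nm: "n \<le> m" for n m
  proof -
    define r where "r = (real (m + 1) / real (n + 1)) powr p"
    have r: "r \<ge> 0" by (simp add: r_def)
    have "\<alpha> n * \<beta> n \<le> (C * r * \<alpha> m) * (D * r * \<beta> m)"
      using C(2)[OF nm] D(2)[OF nm] c0_starD(1)[OF assms(3)] c0_starD(1)[OF assms(4)] C(1) r
      unfolding r_def[symmetric] by (intro mult_mono) auto
    also have "\<dots> = (C * D) * r\<^sup>2 * (\<alpha> m * \<beta> m)"
      by (simp add: power2_eq_square mult_ac)
    finally have "sqrt (\<alpha> n * \<beta> n) \<le> sqrt ((C * D) * r\<^sup>2 * (\<alpha> m * \<beta> m))"
      by (rule real_sqrt_le_mono)
    then show ?thesis
      unfolding r_def[symmetric] using r by (simp add: real_sqrt_mult mult.assoc)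
  qed
  moreover have "sqrt (C * D) > 0" using C D by simp
  ultimately show ?thesis unfolding almost_increasing_def by blast
qed

text \<open>If \<gamma> were dominated by \<alpha>, or \<beta> by \<gamma>, squaring would bound
  \<beta> by a multiple of \<alpha>, against \<open>unb\<close>. Regularity of \<alpha> and \<gamma>
  first makes these relations pointwise, so that no ampliation gets squared.\<close>

lemma regular_geometric_mean_between:
  assumes \<alpha>: "\<alpha> \<in> c0_star" "regular \<alpha>" "\<alpha> 0 > 0" and \<beta>: "\<beta> \<in> c0_star" "regular \<beta>"
    and le: "C > 0" "\<And>n. \<alpha> n \<le> C * \<beta> n"
    and unb: "\<nexists>M. M > 0 \<and> (\<forall>n. \<beta> n \<le> M * \<alpha> n)"
  obtains \<gamma> where "\<gamma> \<in> c0_star" "regular \<gamma>" "\<gamma> 0 > 0" "dominated \<alpha> \<gamma>" "dominated \<gamma> \<beta>"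
    "\<not> dominated \<gamma> \<alpha>" "\<not> dominated \<beta> \<gamma>"
proof -
  obtain p where p: "0 < p" "p < 1" "almost_increasing p \<alpha>"
    using regular_imp_almost_increasing[OF \<alpha>(1,2)] by blast
  obtain q where q: "0 < q" "q < 1" "almost_increasing q \<beta>"
    using regular_imp_almost_increasing[OF \<beta>(1,2)] by blast
  define \<gamma> where "\<gamma> n = sqrt (\<alpha> n * \<beta> n)" for n
  have pos: "\<alpha> n > 0" for n by (rule almost_increasing_pos[OF \<alpha>(1) p(3) \<alpha>(3)])
  have posb: "\<beta> n > 0" for n
    using pos[of n] le(2)[of n] le(1) c0_starD(1)[OF \<beta>(1), of n] by (cases "\<beta> n = 0") auto
  have "\<gamma> \<longlonglongrightarrow> sqrt (0 * 0)"
    unfolding \<gamma>_def[abs_def] by (intro tendsto_intros c0_starD(3) \<alpha> \<beta>)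
  moreover have "decseq \<gamma>"
    unfolding \<gamma>_def[abs_def] decseq_def
    using c0_starD(1,4)[OF \<alpha>(1)] c0_starD(1,4)[OF \<beta>(1)] by (auto intro!: mult_mono)
  moreover have "\<gamma> n > 0" for n
    using pos posb by (simp add: \<gamma>_def)
  ultimately have \<gamma>: "\<gamma> \<in> c0_star" "\<gamma> 0 > 0"
    by (auto simp: c0_star_def less_imp_le)
  have "almost_increasing (max p q) \<gamma>"
    unfolding \<gamma>_def[abs_def]
    by (intro almost_increasing_sqrt almost_increasing_mono[OF p(3)] almost_increasing_mono[OF q(3)] \<alpha> \<beta>) auto
  then have reg: "regular \<gamma>"
    using p q by (intro almost_increasing_imp_regular[OF \<gamma>(1), of "max p q"]) auto
  have sq: "(\<gamma> n)\<^sup>2 = \<alpha> n * \<beta> n" for n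
    using pos[of n] posb[of n] by (simp add: \<gamma>_def)
  have "\<alpha> n \<le> sqrt C * \<gamma> n" for n
  proof -
    have "(\<alpha> n)\<^sup>2 \<le> \<alpha> n * (C * \<beta> n)"
      unfolding power2_eq_square using le(2) pos by (intro mult_left_mono) (auto intro: less_imp_le)
    then have "(\<alpha> n)\<^sup>2 \<le> (sqrt C * \<gamma> n)\<^sup>2"
      using le(1) by (simp add: power_mult_distrib sq mult_ac)
    then show ?thesis
      using le(1) c0_starD(1)[OF \<gamma>(1), of n] by (intro power2_le_imp_le[of "\<alpha> n"]) auto
  qed
  then have 1: "dominated \<alpha> \<gamma>" by (rule dominatedI)
  have "\<gamma> n \<le> sqrt C * \<beta> n" for n
  proof -
    have "\<alpha> n * \<beta> n \<le> (C * \<beta> n) * \<beta> n"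
      using le(2) posb by (intro mult_right_mono) (auto intro: less_imp_le)
    moreover have "(sqrt C * \<beta> n)\<^sup>2 = C * \<beta> n * \<beta> n"
      using le(1) by (simp add: power_mult_distrib) (simp add: power2_eq_square)
    ultimately have "(\<gamma> n)\<^sup>2 \<le> (sqrt C * \<beta> n)\<^sup>2"
      by (simp only: sq)
    then show ?thesis
      using le(1) less_imp_le[OF posb[of n]] by (intro power2_le_imp_le[of "\<gamma> n"]) auto
  qed
  then have 2: "dominated \<gamma> \<beta>" by (rule dominatedI)
  have 3: "\<not> dominated \<gamma> \<alpha>"
  proof
    assume "dominated \<gamma> \<alpha>"
    then obtain M where M: "M > 0" "\<And>n. \<gamma> n \<le> M * \<alpha> n"
      using regular_dominated_iff(2)[OF \<alpha>(1,2) \<gamma>(1)] by blast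
    have "\<beta> n \<le> M\<^sup>2 * \<alpha> n" for n
    proof -
      have "(\<gamma> n)\<^sup>2 \<le> (M * \<alpha> n)\<^sup>2"
        using M(2) c0_starD(1)[OF \<gamma>(1)] by (intro power_mono) auto
      then have "\<alpha> n * \<beta> n \<le> \<alpha> n * (M\<^sup>2 * \<alpha> n)"
        unfolding sq power_mult_distrib by (simp add: power2_eq_square mult_ac)
      with pos[of n] show ?thesis by simp
    qed
    with M(1) unb show False by (metis zero_less_power)
  qed
  have 4: "\<not> dominated \<beta> \<gamma>"
  proof
    assume "dominated \<beta> \<gamma>"
    then obtain M where M: "M > 0" "\<And>n. \<beta> n \<le> M * \<gamma> n"
      using regular_dominated_iff(2)[OF \<gamma>(1) reg \<beta>(1)] by blast
    have "\<beta> n \<le> M\<^sup>2 * \<alpha> n" for n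
    proof -
      have "(\<beta> n)\<^sup>2 \<le> (M * \<gamma> n)\<^sup>2"
        using M(2) less_imp_le[OF posb] by (intro power_mono) auto
      then have "\<beta> n * \<beta> n \<le> (M\<^sup>2 * \<alpha> n) * \<beta> n"
        by (simp add: sq power_mult_distrib) (simp add: power2_eq_square mult_ac)
      with posb[of n] show ?thesis by simp
    qed
    with M(1) unb show False by (metis zero_less_power)
  qed
  show ?thesis
    by (rule that[OF \<gamma>(1) reg \<gamma>(2) 1 2 3 4])
qed

text \<open>\<open>\<zeta>\<close> is the largest minorant of \<open>\<rho>\<close> for which \<open>n\<^sup>q \<zeta>\<^sub>n\<close> increases; here \<open>q < 1\<close> exceeds the
  growth exponent \<open>p\<close> of \<open>\<xi>\<close>. If \<open>\<rho> / \<xi>\<close> is large at \<open>N\<close>, then \<open>\<zeta> / \<xi>\<close> is large at \<open>N / t\<close>, as the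
  infimum over \<open>m \<le> N\<close> sees \<open>\<rho>\<^sub>m \<ge> \<rho>\<^sub>N\<close> and the one over \<open>m > N\<close> gains \<open>t\<^sup>q\<^sup>-\<^sup>p\<close>.\<close>

lemma regular_minorant:
  assumes \<xi>: "\<xi> \<in> c0_star" "regular \<xi>" "\<xi> 0 > 0" and \<rho>: "\<rho> \<in> c0_star"
    and le: "\<And>n. \<xi> n \<le> \<rho> n"
    and unb: "\<nexists>M. M > 0 \<and> (\<forall>n. \<rho> n \<le> M * \<xi> n)"
  obtains \<zeta> C where "\<zeta> \<in> c0_star" "regular \<zeta>" "C > 0" "\<And>n. \<xi> n \<le> C * \<zeta> n" "\<And>n. \<zeta> n \<le> \<rho> n"
    "\<nexists>M. M > 0 \<and> (\<forall>n. \<zeta> n \<le> M * \<xi> n)"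
proof -
  obtain p where p: "0 < p" "p < 1" "almost_increasing p \<xi>"
    using regular_imp_almost_increasing[OF \<xi>(1,2)] by blast
  \<comment> \<open>Midway between \<open>p\<close> and 1: below 1 for the regularity of \<zeta>,
    above \<open>p\<close> for the gain \<open>q - p\<close>.\<close>
  define q where "q = (1 + p) / 2"
  have q: "0 < q" "q < 1" "p < q" using p by (auto simp: q_def)
  have pos: "\<xi> n > 0" for n by (rule almost_increasing_pos[OF \<xi>(1) p(3) \<xi>(3)])
  obtain C where C: "C > 0"
    "\<And>n m. n \<le> m \<Longrightarrow> \<xi> n \<le> C * (real (m + 1) / real (n + 1)) powr p * \<xi> m"
    using p(3) by (auto simp: almost_increasing_def)
  obtain D where D: "D > 0"
    "\<And>n m. n \<le> m \<Longrightarrow> \<xi> n \<le> D * (real (m + 1) / real (n + 1)) powr q * \<xi> m"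
    using almost_increasing_mono[OF p(3) _ \<xi>(1), of q] q(3) by (auto simp: almost_increasing_def)
  define h where "h n m = (real (m + 1) / real (n + 1)) powr q * \<rho> m" for n m
  define \<zeta> where "\<zeta> n = (INF m\<in>{n..}. h n m)" for n
  have h_nonneg: "h n m \<ge> 0" for n m
    using c0_starD(1)[OF \<rho>] by (simp add: h_def)
  have lower: "\<zeta> n \<le> h n m" if "n \<le> m" for n m
    unfolding \<zeta>_def using that h_nonneg by (intro cINF_lower bdd_belowI[of _ 0]) auto
  have greatest: "L \<le> \<zeta> n" if "\<And>m. n \<le> m \<Longrightarrow> L \<le> h n m" for L n
    unfolding \<zeta>_def using that by (intro cINF_greatest) auto
  have \<zeta>_le: "\<zeta> n \<le> \<rho> n" for n
    using lower[of n n] by (simp add: h_def)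
  have nonneg: "\<zeta> n \<ge> 0" for n
    using h_nonneg by (rule greatest)
  have "\<zeta> (Suc n) \<le> \<zeta> n" for n
  proof (rule greatest)
    fix m assume "n \<le> m"
    show "\<zeta> (Suc n) \<le> h n m"
    proof (cases "m = n")
      case True
      then show ?thesis
        using \<zeta>_le[of "Suc n"] c0_starD(4)[OF \<rho>, of n "Suc n"] by (simp add: h_def)
    next
      case False
      then have "\<zeta> (Suc n) \<le> h (Suc n) m"
        using \<open>n \<le> m\<close> by (intro lower) simp
      also have "\<dots> \<le> h n m"
        unfolding h_def using q c0_starD(1)[OF \<rho>]
        by (intro mult_right_mono powr_mono2 divide_left_mono) auto
      finally show ?thesis .
    qed
  qed
  then have "decseq \<zeta>" by (rule decseq_SucI)
  moreover have "\<zeta> \<longlonglongrightarrow> 0"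
    by (rule tendsto_sandwich[OF _ _ tendsto_const c0_starD(3)[OF \<rho>]]) (auto simp: nonneg \<zeta>_le)
  ultimately have \<zeta>: "\<zeta> \<in> c0_star"
    by (simp add: c0_star_def nonneg)
  have "\<zeta> n \<le> 1 * (real (k + 1) / real (n + 1)) powr q * \<zeta> k" if nk: "n \<le> k" for n k
  proof -
    define r where "r = (real (k + 1) / real (n + 1)) powr q"
    have r: "r > 0" by (simp add: r_def)
    \<comment> \<open>The weights are multiplicative, \<open>h n m = r * h k m\<close>, and the
      infimum for \<open>k\<close> runs over fewer indices than that for \<open>n\<close>.\<close>
    have "\<zeta> n / r \<le> \<zeta> k"
    proof (rule greatest)
      fix m assume m: "k \<le> m"
      have "\<zeta> n \<le> h n m" using nk m by (intro lower) simp
      also have "h n m = r * h k m"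
        unfolding h_def r_def by (simp add: powr_divide)
      finally show "\<zeta> n / r \<le> h k m"
        using r by (simp add: pos_divide_le_eq mult.commute)
    qed
    then show ?thesis
      unfolding r_def[symmetric] using r by (simp add: pos_divide_le_eq mult.commute)
  qed
  then have "almost_increasing q \<zeta>"
    unfolding almost_increasing_def by (intro exI[of _ 1]) auto
  then have reg: "regular \<zeta>"
    by (rule almost_increasing_imp_regular[OF \<zeta> q(1,2)])
  have below: "\<xi> n \<le> D * \<zeta> n" for n
  proof -
    have "\<xi> n / D \<le> \<zeta> n"
    proof (rule greatest)
      fix m assume m: "n \<le> m"
      have "\<xi> n \<le> D * ((real (m + 1) / real (n + 1)) powr q * \<xi> m)"
        using D(2)[OF m] by (simp add: mult.assoc)
      also have "\<dots> \<le> D * h n m"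
        unfolding h_def using D(1) le by (intro mult_left_mono) auto
      finally show "\<xi> n / D \<le> h n m"
        using D(1) by (simp add: pos_divide_le_eq mult.commute)
    qed
    then show ?thesis
      using D(1) by (simp add: pos_divide_le_eq mult.commute)
  qed
  have unb': "\<nexists>M. M > 0 \<and> (\<forall>n. \<zeta> n \<le> M * \<xi> n)"
  proof
    assume "\<exists>M. M > 0 \<and> (\<forall>n. \<zeta> n \<le> M * \<xi> n)"
    then obtain M where M: "M > 0" "\<And>n. \<zeta> n \<le> M * \<xi> n" by blast
    \<comment> \<open>Chosen so that \<open>(real t / 2) powr (q - p)\<close> outweighs
      \<open>2 * M * C\<close>; the halving allows for the rounding in
      \<open>N div t\<close>.\<close>
    obtain t :: nat where t: "2 * (2 * M * C) powr (1 / (q - p)) < real t"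
      using reals_Archimedean2 by blast
    have t0: "t > 0"
    proof (rule ccontr)
      assume "\<not> t > 0"
      then have "2 * (2 * M * C) powr (1 / (q - p)) < 0" using t by simp
      then show False by (simp add: not_less[symmetric])
    qed
    have t_large: "2 * M * C \<le> (real t / 2) powr (q - p)"
    proof -
      have "((2 * M * C) powr (1 / (q - p))) powr (q - p) \<le> (real t / 2) powr (q - p)"
        using t q by (intro powr_mono2) auto
      then show ?thesis
        using q M C by (simp add: powr_powr)
    qed
    define R where "R = 2 * M * C * real t powr p"
    have R: "R > 0" using M C t0 by (simp add: R_def)
    \<comment> \<open>A bound \<open>R\<close> on the ratio from \<open>t\<close> on would give a
      bound everywhere, the finitely many earlier terms being absorbed by
      \<open>\<rho> 0 / \<xi> t\<close>. Asking \<open>N \<ge> t\<close> keeps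
      \<open>(N + 1) / (n + 1)\<close> at least \<open>t / 2\<close>.\<close>
    obtain N where N: "N \<ge> t" "\<rho> N > R * \<xi> N"
    proof (rule ccontr)
      assume no: "\<not> thesis"
      then have R_bound: "\<rho> n \<le> R * \<xi> n" if "n \<ge> t" for n
        using that \<open>\<And>N. t \<le> N \<Longrightarrow> R * \<xi> N < \<rho> N \<Longrightarrow> thesis\<close> by (meson not_less)
      define B where "B = R + \<rho> 0 / \<xi> t"
      have "\<rho> n \<le> B * \<xi> n" for n
      proof (cases "n \<ge> t")
        case True
        have "R * \<xi> n \<le> B * \<xi> n"
          using pos[of n] pos[of t] c0_starD(1)[OF \<rho>, of 0] by (simp add: B_def)
        with R_bound[OF True] show ?thesis by linarith
      next
        case False
        have "\<rho> n \<le> \<rho> 0 / \<xi> t * \<xi> t"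
          using c0_starD(4)[OF \<rho>, of 0 n] pos[of t] by simp
        also have "\<dots> \<le> B * \<xi> n"
          using False R pos[of t] c0_starD(1)[OF \<rho>, of 0] c0_starD(4)[OF \<xi>(1), of n t]
          by (intro mult_mono) (auto simp: B_def)
        finally show ?thesis .
      qed
      moreover have "B > 0"
        using R pos[of t] c0_starD(1)[OF \<rho>, of 0] by (simp add: B_def add_pos_nonneg)
      ultimately show False using unb by blast
    qed
    define n where "n = N div t"
    have n: "n \<le> N" "N + 1 \<le> (n + 1) * t" "(n + 1) * t \<le> 2 * N"
    proof -
      show "n \<le> N" by (simp add: n_def)
      have "N < t + t * n"
        unfolding n_def using t0 by (rule dividend_less_times_div)
      then show "N + 1 \<le> (n + 1) * t" by (simp add: algebra_simps)
      have "t * n \<le> N" unfolding n_def by (rule times_div_less_eq_dividend)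
      with N(1) show "(n + 1) * t \<le> 2 * N" by (simp add: algebra_simps)
    qed
    have ratio: "real (N + 1) / real (n + 1) \<le> real t" "real t / 2 \<le> real (N + 1) / real (n + 1)"
    proof -
      have "real (N + 1) \<le> real ((n + 1) * t)" "real ((n + 1) * t) \<le> real (2 * N)"
        using n(2,3) by (simp_all only: of_nat_le_iff)
      then have *: "real (N + 1) \<le> real (n + 1) * real t" "real (n + 1) * real t \<le> 2 * real (N + 1)"
        by (simp_all only: of_nat_mult) simp_all
      then show "real (N + 1) / real (n + 1) \<le> real t"
        by (subst pos_divide_le_eq) (simp_all only: mult.commute of_nat_0_less_iff add_gr_0 zero_less_one disj_not1 simp_thms)
      from * show "real t / 2 \<le> real (N + 1) / real (n + 1)"
        by (subst pos_le_divide_eq) (simp_all add: mult.commute del: of_nat_add)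
    qed
    \<comment> \<open>Twice the assumed bound at a single index; as \<open>\<xi> n > 0\<close>, this
      contradicts the choice of \<open>M\<close>.\<close>
    have "2 * M * \<xi> n \<le> \<zeta> n"
    proof (rule greatest)
      fix m assume m: "n \<le> m"
      define s where "s = real (m + 1) / real (n + 1)"
      have s: "s \<ge> 1" using m by (simp add: s_def)
      show "2 * M * \<xi> n \<le> h n m"
      proof (cases "m \<le> N")
        case True
        have "\<xi> n \<le> C * (real (N + 1) / real (n + 1)) powr p * \<xi> N"
          by (rule C(2)[OF n(1)])
        also have "\<dots> \<le> C * real t powr p * \<xi> N"
          using ratio(1) p C(1) less_imp_le[OF pos]
          by (intro mult_right_mono mult_left_mono powr_mono2) auto
        finally have "2 * M * \<xi> n \<le> 2 * M * (C * real t powr p * \<xi> N)"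
          using M(1) by (intro mult_left_mono) auto
        also have "\<dots> = R * \<xi> N" by (simp add: R_def)
        also have "\<dots> \<le> \<rho> N" using N(2) by simp
        also have "\<rho> N \<le> \<rho> m" by (rule c0_starD(4)[OF \<rho> True])
        also have "1 * \<rho> m \<le> h n m"
          unfolding h_def s_def[symmetric] using s q c0_starD(1)[OF \<rho>]
          by (intro mult_right_mono ge_one_powr_ge_zero) auto
        finally show ?thesis by simp
      next
        case False
        have "2 * M * C \<le> (real t / 2) powr (q - p)" by (rule t_large)
        also have "\<dots> \<le> s powr (q - p)"
        proof (rule powr_mono2)
          have "real (N + 1) / real (n + 1) \<le> s"
            unfolding s_def using False by (intro divide_right_mono) auto
          with ratio(2) show "real t / 2 \<le> s" by linarith
        qed (use q in auto)
        finally have tl: "2 * M * C \<le> s powr (q - p)" .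
        have "2 * M * \<xi> n \<le> 2 * M * (C * s powr p * \<xi> m)"
          using C(2)[OF m] M(1) unfolding s_def by (intro mult_left_mono) auto
        also have "\<dots> = (2 * M * C) * (s powr p * \<xi> m)" by simp
        also have "\<dots> \<le> s powr (q - p) * (s powr p * \<xi> m)"
          using tl less_imp_le[OF pos] by (intro mult_right_mono) auto
        also have "\<dots> = s powr q * \<xi> m"
          by (simp add: mult.assoc[symmetric] powr_add[symmetric])
        also have "\<dots> \<le> h n m"
          unfolding h_def s_def[symmetric] using le by (intro mult_left_mono) auto
        finally show ?thesis .
      qed
    qed
    with M(2)[of n] have "2 * M * \<xi> n \<le> M * \<xi> n" by linarith
    with M(1) pos[of n] show False
      by (simp add: mult_le_0_iff not_le[symmetric])
  qed
  show ?thesis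
    by (rule that[OF \<zeta> reg D(1) below \<zeta>_le unb'])
qed

text \<open>\<open>\<zeta>\<close> is the smallest majorant of \<open>\<rho>\<close> for which \<open>n\<^sup>q \<zeta>\<^sub>n\<close> increases. If \<open>\<xi> = O(\<zeta>)\<close>, then the
  maximum defining \<open>\<zeta>\<^sub>n\<close> is attained at some \<open>m \<ge> n / t\<close> with \<open>t\<close> fixed, and \<open>\<xi> = O(D\<^sub>t \<rho>)\<close>.\<close>

lemma regular_majorant:
  assumes \<xi>: "\<xi> \<in> c0_star" "regular \<xi>" "\<xi> 0 > 0" and \<rho>: "\<rho> \<in> c0_star"
    and le: "\<And>n. \<rho> n \<le> \<xi> n"
    and ndom: "\<not> dominated \<xi> \<rho>"
  obtains \<zeta> C where "\<zeta> \<in> c0_star" "regular \<zeta>" "C > 0" "\<And>n. \<zeta> n \<le> C * \<xi> n" "\<And>n. \<rho> n \<le> \<zeta> n"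
    "\<nexists>M. M > 0 \<and> (\<forall>n. \<xi> n \<le> M * \<zeta> n)"
proof -
  obtain p where p: "0 < p" "p < 1" "almost_increasing p \<xi>"
    using regular_imp_almost_increasing[OF \<xi>(1,2)] by blast
  define q where "q = (1 + p) / 2"
  have q: "0 < q" "q < 1" "p < q" using p by (auto simp: q_def)
  have pos: "\<xi> n > 0" for n by (rule almost_increasing_pos[OF \<xi>(1) p(3) \<xi>(3)])
  obtain C where C: "C > 0"
    "\<And>n m. n \<le> m \<Longrightarrow> \<xi> n \<le> C * (real (m + 1) / real (n + 1)) powr p * \<xi> m"
    using p(3) by (auto simp: almost_increasing_def)
  obtain D where D: "D > 0"
    "\<And>n m. n \<le> m \<Longrightarrow> \<xi> n \<le> D * (real (m + 1) / real (n + 1)) powr q * \<xi> m"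
    using almost_increasing_mono[OF p(3) _ \<xi>(1), of q] q(3) by (auto simp: almost_increasing_def)
  define h where "h n m = (real (m + 1) / real (n + 1)) powr q * \<rho> m" for n m
  \<comment> \<open>For a majorant the monotonicity constraint acts forwards: only indices up to
    \<open>n\<close> push \<open>\<zeta> n\<close> up. Hence a finite maximum, attained, in place of
    the infimum over a tail.\<close>
  define \<zeta> where "\<zeta> n = Max (h n ` {..n})" for n
  have upper: "h n m \<le> \<zeta> n" if "m \<le> n" for n m
    unfolding \<zeta>_def using that by (intro Max_ge) auto
  have attained: "\<exists>m\<le>n. \<zeta> n = h n m" for n
  proof -
    have "\<zeta> n \<in> h n ` {..n}" unfolding \<zeta>_def by (intro Max_in) auto
    then show ?thesis by auto
  qed
  have \<rho>_le: "\<rho> n \<le> \<zeta> n" for n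
    using upper[of n n] by (simp add: h_def)
  have nonneg: "\<zeta> n \<ge> 0" for n
    using \<rho>_le[of n] c0_starD(1)[OF \<rho>, of n] by linarith
  have below: "\<zeta> n \<le> D * \<xi> n" for n
  proof -
    obtain m where m: "m \<le> n" "\<zeta> n = h n m" using attained by blast
    define s where "s = real (m + 1) / real (n + 1)"
    have "h n m \<le> s powr q * \<xi> m"
      unfolding h_def s_def[symmetric] using le by (intro mult_left_mono) auto
    also have "\<dots> \<le> s powr q * (D * (1 / s) powr q * \<xi> n)"
      using D(2)[OF m(1)] by (intro mult_left_mono) (simp_all add: s_def)
    also have "\<dots> = D * \<xi> n"
      by (simp add: powr_divide s_def)
    finally show ?thesis by (simp add: m(2))
  qed
  have "\<zeta> (Suc n) \<le> \<zeta> n" for n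
  proof -
    obtain m where m: "m \<le> Suc n" "\<zeta> (Suc n) = h (Suc n) m" using attained by blast
    show ?thesis
    proof (cases "m = Suc n")
      case True
      then show ?thesis
        using m(2) \<rho>_le[of n] c0_starD(4)[OF \<rho>, of n "Suc n"] by (simp add: h_def)
    next
      case False
      have "h (Suc n) m \<le> h n m"
        unfolding h_def using q c0_starD(1)[OF \<rho>]
        by (intro mult_right_mono powr_mono2 divide_left_mono) auto
      also have "\<dots> \<le> \<zeta> n" using False m(1) by (intro upper) simp
      finally show ?thesis by (simp add: m(2))
    qed
  qed
  then have "decseq \<zeta>" by (rule decseq_SucI)
  moreover have "\<zeta> \<longlonglongrightarrow> 0"
  proof (rule tendsto_sandwich[OF _ _ tendsto_const])
    show "(\<lambda>n. D * \<xi> n) \<longlonglongrightarrow> 0"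
      using tendsto_mult_left[OF c0_starD(3)[OF \<xi>(1)], of D] by simp
  qed (auto simp: nonneg below)
  ultimately have \<zeta>: "\<zeta> \<in> c0_star"
    by (simp add: c0_star_def nonneg)
  have "\<zeta> n \<le> 1 * (real (k + 1) / real (n + 1)) powr q * \<zeta> k" if nk: "n \<le> k" for n k
  proof -
    obtain m where m: "m \<le> n" "\<zeta> n = h n m" using attained by blast
    have "h n m = (real (k + 1) / real (n + 1)) powr q * h k m"
      unfolding h_def by (simp add: powr_divide)
    also have "\<dots> \<le> (real (k + 1) / real (n + 1)) powr q * \<zeta> k"
      using m(1) nk by (intro mult_left_mono upper) auto
    finally show ?thesis by (simp add: m(2))
  qed
  then have "almost_increasing q \<zeta>"
    unfolding almost_increasing_def by (intro exI[of _ 1]) auto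
  then have reg: "regular \<zeta>"
    by (rule almost_increasing_imp_regular[OF \<zeta> q(1,2)])
  have unb: "\<nexists>M. M > 0 \<and> (\<forall>n. \<xi> n \<le> M * \<zeta> n)"
  proof
    assume "\<exists>M. M > 0 \<and> (\<forall>n. \<xi> n \<le> M * \<zeta> n)"
    then obtain M where M: "M > 0" "\<And>n. \<xi> n \<le> M * \<zeta> n" by blast
    \<comment> \<open>Exceeds every ratio \<open>s\<close> of \<open>n + 1\<close> to
      \<open>m + 1\<close> for which the maximum defining \<open>\<zeta> n\<close> can be attained
      at \<open>m\<close>.\<close>
    obtain t :: nat where t: "(M * C) powr (1 / (q - p)) < real t"
      using reals_Archimedean2 by blast
    have t0: "t > 0"
    proof (rule ccontr)
      assume "\<not> t > 0"
      then have "(M * C) powr (1 / (q - p)) < 0" using t by simp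
      then show False by (simp add: not_less[symmetric])
    qed
    have "\<xi> n \<le> M * \<rho> (n div t)" for n
    proof -
      obtain m where m: "m \<le> n" "\<zeta> n = h n m" using attained by blast
      define s where "s = real (n + 1) / real (m + 1)"
      have s: "s \<ge> 1" using m(1) by (simp add: s_def)
      have h: "h n m = \<rho> m / s powr q"
        by (simp add: h_def s_def powr_divide)
      have "\<xi> n \<le> M * (\<rho> m / s powr q)"
        using M(2)[of n] by (simp add: m(2) h)
      also have "\<dots> \<le> M * (\<xi> m / s powr q)"
        using M(1) le by (intro mult_left_mono divide_right_mono) auto
      also have "\<dots> \<le> M * (C * s powr p * \<xi> n / s powr q)"
        using M(1) C(2)[OF m(1)] unfolding s_def[symmetric]
        by (intro mult_left_mono divide_right_mono) auto
      also have "\<dots> = (M * C / s powr (q - p)) * \<xi> n"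
        using s by (simp add: powr_diff)
      \<comment> \<open>Cancelling \<open>\<xi> n > 0\<close> leaves
        \<open>s powr (q - p) \<le> M * C\<close>, a bound on how far back the maximum can
        lie.\<close>
      finally have "1 * \<xi> n \<le> (M * C / s powr (q - p)) * \<xi> n" by simp
      then have "1 \<le> M * C / s powr (q - p)"
        using pos[of n] by (rule mult_right_le_imp_le)
      then have "s powr (q - p) \<le> M * C"
        using s by (simp add: le_divide_eq)
      then have "(s powr (q - p)) powr (1 / (q - p)) \<le> (M * C) powr (1 / (q - p))"
        using q by (intro powr_mono2) auto
      then have "s \<le> (M * C) powr (1 / (q - p))"
        using q s by (simp add: powr_powr)
      with t have "s < real t" by linarith
      then have "real (n + 1) < real t * real (m + 1)"
        by (simp add: s_def pos_divide_less_eq del: of_nat_add)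
      then have "n + 1 < t * (m + 1)"
        by (simp only: of_nat_mult[symmetric] of_nat_less_iff)
      \<comment> \<open>So \<open>n div t \<le> m\<close>, and monotonicity of \<rho> replaces
        \<open>\<rho> m\<close> by the ampliated value.\<close>
      then have "n div t < m + 1"
        by (intro div_less_iff_less_mult[THEN iffD2, OF t0]) (simp add: mult.commute)
      then have "\<rho> m \<le> \<rho> (n div t)"
        by (intro c0_starD(4)[OF \<rho>]) simp
      moreover have "\<rho> m / s powr q \<le> \<rho> m"
      proof -
        have "1 \<le> s powr q" using s q by (intro ge_one_powr_ge_zero) auto
        then have "\<rho> m * 1 \<le> \<rho> m * s powr q"
          using c0_starD(1)[OF \<rho>] by (intro mult_left_mono)
        then show ?thesis using s by (simp add: pos_divide_le_eq)
      qed
      ultimately have "h n m \<le> \<rho> (n div t)" by (simp add: h)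
      then have "M * \<zeta> n \<le> M * \<rho> (n div t)"
        using M(1) by (simp add: m(2))
      with M(2)[of n] show ?thesis by linarith
    qed
    with t0 have "dominated \<xi> \<rho>" unfolding dominated_def by blast
    with ndom show False ..
  qed
  show ?thesis
    by (rule that[OF \<zeta> reg D(1) below \<rho>_le unb])
qed

section \<open>The lattice of principal ideals\<close>

definition principal_set :: "(nat \<Rightarrow> real) \<Rightarrow> (nat \<Rightarrow> real) set" where
  "principal_set \<xi> = {\<eta> \<in> c0_star. dominated \<eta> \<xi>}"

lemma c0_star_add:
  assumes "\<xi> \<in> c0_star" "\<eta> \<in> c0_star"
  shows "(\<lambda>n. \<xi> n + \<eta> n) \<in> c0_star"
  using assms tendsto_add[of \<xi> 0 sequentially \<eta> 0]
  by (auto simp: c0_star_def decseq_def intro: add_mono)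

lemma principal_set_self: "\<xi> \<in> c0_star \<Longrightarrow> \<xi> \<in> principal_set \<xi>"
  using dominatedI[of \<xi> 1 \<xi>] by (simp add: principal_set_def)

lemma principal_set_subset_iff:
  assumes "\<xi> \<in> c0_star" "\<eta> \<in> c0_star"
  shows "principal_set \<xi> \<subseteq> principal_set \<eta> \<longleftrightarrow> dominated \<xi> \<eta>"
  using principal_set_self[OF assms(1)] dominated_trans[OF _ _ assms]
  unfolding principal_set_def by blast

lemma characteristic_set_principal_set:
  assumes "\<xi> \<in> c0_star"
  shows "characteristic_set (principal_set \<xi>)"
  unfolding characteristic_set_def
proof (intro conjI ballI allI impI)
  show "principal_set \<xi> \<noteq> {}"
    using principal_set_self[OF assms] by blast
  show "(\<lambda>n. \<zeta> n + \<eta> n) \<in> principal_set \<xi>"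
    if "\<zeta> \<in> principal_set \<xi>" "\<eta> \<in> principal_set \<xi>" for \<zeta> \<eta>
    using that c0_star_add dominated_add assms by (simp add: principal_set_def)
  show "\<eta> \<in> principal_set \<xi>"
    if "\<zeta> \<in> principal_set \<xi>" "\<eta> \<in> c0_star" "m > 0" "\<forall>n. \<eta> n \<le> C * \<zeta> (n div m)" for \<zeta> \<eta> C m
  proof -
    have "dominated \<eta> \<zeta>" using that unfolding dominated_def by blast
    then show ?thesis
      using that dominated_trans[OF _ _ _ assms] by (auto simp: principal_set_def)
  qed
qed (auto simp: principal_set_def)

text \<open>The mean is additive, and \<open>arith_mean_ampliation\<close> gives solidity and
  invariance under ampliations; this is the existence half of the description of
  \<open>pre_am_ideal\<close>.\<close>

lemma characteristic_set_pre_am: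
  assumes \<xi>: "\<xi> \<in> c0_star"
  shows "characteristic_set {\<eta> \<in> c0_star. arith_mean \<eta> \<in> principal_set \<xi>}"
  unfolding characteristic_set_def
proof (intro conjI ballI allI impI)
  have zero: "(\<lambda>_. 0) \<in> c0_star"
    by (simp add: c0_star_def decseq_def)
  have "dominated (arith_mean (\<lambda>_. 0)) \<xi>"
    by (rule dominatedI[of _ 0]) (simp add: arith_mean_def)
  then show "{\<eta> \<in> c0_star. arith_mean \<eta> \<in> principal_set \<xi>} \<noteq> {}"
    using zero arith_mean_c0_star[OF zero] unfolding principal_set_def by blast
  fix \<zeta> assume \<zeta>: "\<zeta> \<in> {\<eta> \<in> c0_star. arith_mean \<eta> \<in> principal_set \<xi>}"
  show "(\<lambda>n. \<zeta> n + \<eta> n) \<in> {\<eta> \<in> c0_star. arith_mean \<eta> \<in> principal_set \<xi>}"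
    if "\<eta> \<in> {\<eta> \<in> c0_star. arith_mean \<eta> \<in> principal_set \<xi>}" for \<eta>
  proof -
    have "arith_mean (\<lambda>n. \<zeta> n + \<eta> n) = (\<lambda>n. arith_mean \<zeta> n + arith_mean \<eta> n)"
      by (simp add: fun_eq_iff arith_mean_def sum.distrib add_divide_distrib)
    with \<zeta> that show ?thesis
      using characteristic_setD(3)[OF characteristic_set_principal_set[OF \<xi>]] c0_star_add
      by simp
  qed
  show "\<eta> \<in> {\<eta> \<in> c0_star. arith_mean \<eta> \<in> principal_set \<xi>}"
    if "\<eta> \<in> c0_star" "m > 0" "\<forall>n. \<eta> n \<le> C * \<zeta> (n div m)" for \<eta> C m
  proof -
    have \<zeta>0: "\<zeta> \<in> c0_star" using \<zeta> by simp
    have "\<eta> n \<le> \<bar>C\<bar> * \<zeta> (n div m)" for n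
      using that(3) mult_right_mono[OF abs_ge_self c0_starD(1)[OF \<zeta>0]] order_trans by blast
    then have "dominated (arith_mean \<eta>) (arith_mean \<zeta>)"
      by (intro dominatedI[of _ "\<bar>C\<bar> * real m"] arith_mean_ampliation[OF \<zeta>0 that(2)]) auto
    then have "dominated (arith_mean \<eta>) \<xi>"
      by (rule dominated_trans[OF _ _ _ \<xi>]) (use \<zeta> in \<open>auto simp: principal_set_def\<close>)
    then show ?thesis
      using that(1) arith_mean_c0_star by (simp add: principal_set_def)
  qed
qed auto

context
  assumes inf: "\<nexists>B :: 'a::chilbert_space set. finite B \<and> cspan B = UNIV"
begin

lemma ideal_of_principal_set_subset_iff:
  assumes "\<xi> \<in> c0_star" "\<eta> \<in> c0_star"
  shows "(ideal_of (principal_set \<xi>) :: ('a \<Rightarrow> 'a) set) \<subseteq> ideal_of (principal_set \<eta>) \<longleftrightarrow>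
    dominated \<xi> \<eta>"
  using ideal_of_subset_iff[OF inf, of "principal_set \<xi>" "principal_set \<eta>"]
    principal_set_subset_iff[OF assms]
  by (simp add: principal_set_def)

lemma Idl_singleton:
  assumes T: "compact_operator (T :: 'a \<Rightarrow> 'a)"
  shows "Idl\<^bsub>BH\<^esub> {T} = ideal_of (principal_set (s_numbers T))"
proof (rule Idl_eq_ideal_of[OF inf T])
  have s: "s_numbers T \<in> c0_star" by (rule s_numbers_c0_star[OF inf T])
  show "characteristic_set (principal_set (s_numbers T))"
    by (rule characteristic_set_principal_set[OF s])
  show "s_numbers T \<in> principal_set (s_numbers T)"
    by (rule principal_set_self[OF s])
qed (auto simp: principal_set_def dominated_def)

text \<open>The first s-number is the operator norm.\<close>

lemma s_numbers_0_eq_0_iff: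
  assumes T: "compact_operator (T :: 'a \<Rightarrow> 'a)"
  shows "s_numbers T 0 = 0 \<longleftrightarrow> T = (\<lambda>x. 0)"
proof -
  obtain e where e: "singular_system T e (s_numbers T)"
    by (rule singular_system_obtain[OF inf T])
  show ?thesis
    using singular_systemD(4)[OF e, of 0] singular_system_norm[OF e, of 0] by force
qed

lemma PL_iff:
  "(I :: ('a \<Rightarrow> 'a) set) \<in> PL \<longleftrightarrow>
    (\<exists>\<xi>\<in>c0_star. \<xi> 0 > 0 \<and> I = ideal_of (principal_set \<xi>))"
proof
  interpret BH: ring "BH :: ('a \<Rightarrow> 'a) ring" by (rule ring_BH)
  have zero: "\<zero>\<^bsub>BH\<^esub> = (\<lambda>x :: 'a. 0)" by (simp add: BH_def)
  assume I: "I \<in> PL"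
  then have oi: "operator_ideal I" and pi: "principalideal I BH" and ne: "I \<noteq> {\<zero>\<^bsub>BH\<^esub>}"
    by (auto simp: PL_def principal_operator_ideal_def)
  obtain T where T: "T \<in> carrier BH" "I = Idl\<^bsub>BH\<^esub> {T}"
    using principalideal.generate[OF pi] by blast
  then have "T \<in> I" using BH.genideal_self[of "{T}"] by simp
  then have c: "compact_operator T" using oi by (auto simp: operator_ideal_def)
  have s: "s_numbers T \<in> c0_star" by (rule s_numbers_c0_star[OF inf c])
  have "s_numbers T 0 \<noteq> 0"
  proof
    assume "s_numbers T 0 = 0"
    then have "T = \<zero>\<^bsub>BH\<^esub>" by (simp add: s_numbers_0_eq_0_iff[OF c] zero)
    then have "I = {\<zero>\<^bsub>BH\<^esub>}" using T(2) BH.genideal_zero by simp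
    with ne show False by contradiction
  qed
  then show "\<exists>\<xi>\<in>c0_star. \<xi> 0 > 0 \<and> I = ideal_of (principal_set \<xi>)"
    using s c0_starD(1)[OF s, of 0] T(2) Idl_singleton[OF c]
    by (intro bexI[of _ "s_numbers T"]) auto
next
  interpret BH: ring "BH :: ('a \<Rightarrow> 'a) ring" by (rule ring_BH)
  assume "\<exists>\<xi>\<in>c0_star. \<xi> 0 > 0 \<and> I = ideal_of (principal_set \<xi>)"
  then obtain \<xi> where \<xi>: "\<xi> \<in> c0_star" "\<xi> 0 > 0" and I: "I = ideal_of (principal_set \<xi>)" by blast
  obtain T :: "'a \<Rightarrow> 'a" where T: "compact_operator T" "s_numbers T = \<xi>"
    using s_numbers_surj[OF inf \<xi>(1)] by blast
  have oi: "operator_ideal I"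
    unfolding I by (rule operator_ideal_ideal_of[OF inf characteristic_set_principal_set[OF \<xi>(1)]])
  have gen: "I = Idl\<^bsub>BH\<^esub> {T}" using Idl_singleton[OF T(1)] by (simp add: I T(2))
  have carr: "T \<in> carrier BH" using compact_operatorD(1)[OF T(1)] by (simp add: BH_def)
  have "principalideal I BH"
    using oi gen carr by (intro principalidealI) (auto simp: operator_ideal_def)
  moreover have "I \<noteq> {\<zero>\<^bsub>BH\<^esub>}"
  proof
    assume "I = {\<zero>\<^bsub>BH\<^esub>}"
    then have "T = (\<lambda>x. 0)"
      using gen carr BH.genideal_self[of "{T}"] by (auto simp: BH_def)
    then show False using \<xi>(2) s_numbers_0_eq_0_iff[OF T(1)] T(2) by simp
  qed
  ultimately show "I \<in> PL"
    using oi by (simp add: PL_def principal_operator_ideal_def)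
qed

text \<open>Equality of the ideals is equality of their characteristic sets. Testing it on \<xi>
  itself gives regularity up to an ampliation, which \<open>regular_if_dominated_arith_mean\<close>
  removes; conversely \<open>regular_dominated_iff\<close> treats every member.\<close>

lemma am_stable_iff_regular:
  assumes \<xi>: "\<xi> \<in> c0_star"
  shows "am_stable (ideal_of (principal_set \<xi>) :: ('a \<Rightarrow> 'a) set) \<longleftrightarrow> regular \<xi>"
proof -
  let ?I = "ideal_of (principal_set \<xi>) :: ('a \<Rightarrow> 'a) set"
  let ?S = "{\<eta> \<in> c0_star. arith_mean \<eta> \<in> principal_set \<xi>}"
  have char: "char_set ?I = principal_set \<xi>"
    by (rule char_set_ideal_of[OF inf]) (auto simp: principal_set_def)
  have "pre_am_ideal ?I = ideal_of ?S"
    using pre_am_ideal_eq[OF inf, of ?I] characteristic_set_pre_am[OF \<xi>] by (simp only: char)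
  then have "am_stable ?I \<longleftrightarrow> ?I = ideal_of ?S"
    by (simp add: am_stable_def)
  also have "\<dots> \<longleftrightarrow> principal_set \<xi> = ?S"
  proof
    assume "?I = ideal_of ?S"
    then have "char_set ?I = char_set (ideal_of ?S :: ('a \<Rightarrow> 'a) set)" by simp
    also have "\<dots> = ?S" by (rule char_set_ideal_of[OF inf]) auto
    finally show "principal_set \<xi> = ?S" by (simp only: char)
  qed simp
  also have "\<dots> \<longleftrightarrow> regular \<xi>"
  proof
    assume "principal_set \<xi> = ?S"
    then have "dominated (arith_mean \<xi>) \<xi>"
      using principal_set_self[OF \<xi>] by (auto simp: principal_set_def)
    then show "regular \<xi>" by (rule regular_if_dominated_arith_mean[OF \<xi>])
  next
    assume "regular \<xi>"
    then show "principal_set \<xi> = ?S"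
      using regular_dominated_iff(1)[OF \<xi>] arith_mean_c0_star by (auto simp: principal_set_def)
  qed
  finally show ?thesis .
qed

lemma SPL_iff:
  "(I :: ('a \<Rightarrow> 'a) set) \<in> SPL \<longleftrightarrow>
    (\<exists>\<xi>\<in>c0_star. \<xi> 0 > 0 \<and> regular \<xi> \<and> I = ideal_of (principal_set \<xi>))"
  unfolding SPL_def mem_Collect_eq PL_iff using am_stable_iff_regular by blast

lemma ideal_of_principal_set_psubset_iff:
  assumes "\<xi> \<in> c0_star" "\<eta> \<in> c0_star"
  shows "(ideal_of (principal_set \<xi>) :: ('a \<Rightarrow> 'a) set) \<subset> ideal_of (principal_set \<eta>) \<longleftrightarrow>
    dominated \<xi> \<eta> \<and> \<not> dominated \<eta> \<xi>"
  unfolding less_le_not_le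
    ideal_of_principal_set_subset_iff[OF assms] ideal_of_principal_set_subset_iff[OF assms(2,1)] ..

lemma SPL_upper_dense: "upper_dense_in (SPL :: ('a \<Rightarrow> 'a) set set) PL"
  unfolding upper_dense_in_def
proof (intro ballI impI)
  fix I J :: "('a \<Rightarrow> 'a) set" assume "I \<in> SPL" "J \<in> PL" and IJ: "I \<subset> J"
  obtain \<xi> where \<xi>: "\<xi> \<in> c0_star" "\<xi> 0 > 0" "regular \<xi>" and I: "I = ideal_of (principal_set \<xi>)"
    using \<open>I \<in> SPL\<close> unfolding SPL_iff by blast
  obtain \<rho> where \<rho>: "\<rho> \<in> c0_star" and J: "J = ideal_of (principal_set \<rho>)"
    using \<open>J \<in> PL\<close> unfolding PL_iff by blast
  have dom: "dominated \<xi> \<rho>" "\<not> dominated \<rho> \<xi>"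
    using IJ unfolding I J ideal_of_principal_set_psubset_iff[OF \<xi>(1) \<rho>] by auto
  obtain C m where Cm: "C > 0" "m > 0" "\<And>n. \<xi> n \<le> C * \<rho> (n div m)"
    using dominatedE[OF dom(1) \<rho>] by blast
  \<comment> \<open>Absorbing the constant and the ampliation into \<rho> keeps the ideal and makes
    \<xi> lie below \<sigma> pointwise, as \<open>regular_minorant\<close> expects.\<close>
  define \<sigma> where "\<sigma> n = C * \<rho> (n div m)" for n
  have "filterlim (\<lambda>n. n div m) at_top sequentially"
    by (rule filterlim_at_top_div_const_nat) (use Cm in simp)
  then have "\<sigma> \<longlonglongrightarrow> C * 0"
    unfolding \<sigma>_def[abs_def]
    by (intro tendsto_mult_left filterlim_compose[OF c0_starD(3)[OF \<rho>]])
  moreover have "decseq \<sigma>"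
    unfolding decseq_def \<sigma>_def using Cm(1)
    by (intro allI impI mult_left_mono c0_starD(4)[OF \<rho>] div_le_mono) auto
  ultimately have \<sigma>: "\<sigma> \<in> c0_star"
    using Cm(1) c0_starD(1)[OF \<rho>] by (auto simp: c0_star_def \<sigma>_def)
  have \<sigma>\<rho>: "dominated \<sigma> \<rho>"
    unfolding dominated_def \<sigma>_def using Cm(2) by blast
  have "\<rho> n \<le> 1 / C * \<sigma> n" for n
    using Cm(1) c0_starD(4)[OF \<rho>, of "n div m" n] by (simp add: \<sigma>_def)
  then have \<rho>\<sigma>: "dominated \<rho> \<sigma>" by (rule dominatedI)
  have \<xi>\<sigma>: "\<xi> n \<le> \<sigma> n" for n
    using Cm(3) by (simp add: \<sigma>_def)
  have "\<nexists>M. M > 0 \<and> (\<forall>n. \<sigma> n \<le> M * \<xi> n)"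
    using dominatedI dominated_trans[OF \<rho>\<sigma> _ \<sigma> \<xi>(1)] dom(2) by blast
  then obtain \<zeta> D where \<zeta>: "\<zeta> \<in> c0_star" "regular \<zeta>" "D > 0" "\<And>n. \<xi> n \<le> D * \<zeta> n" "\<And>n. \<zeta> n \<le> \<sigma> n"
    "\<nexists>M. M > 0 \<and> (\<forall>n. \<zeta> n \<le> M * \<xi> n)"
    using regular_minorant[OF \<xi>(1,3,2) \<sigma> \<xi>\<sigma>] by blast
  \<comment> \<open>\<zeta> may generate \<open>J\<close> itself, so it is not yet the answer; its
    geometric mean with \<xi> is strictly below \<zeta> for domination, hence strictly below
    \<rho>.\<close>
  obtain \<gamma> where \<gamma>: "\<gamma> \<in> c0_star" "regular \<gamma>" "\<gamma> 0 > 0" "dominated \<xi> \<gamma>" "dominated \<gamma> \<zeta>"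
    "\<not> dominated \<gamma> \<xi>" "\<not> dominated \<zeta> \<gamma>"
    using regular_geometric_mean_between[OF \<xi>(1,3,2) \<zeta>(1-4,6)] .
  have "dominated \<zeta> \<sigma>" by (rule dominatedI[of _ 1]) (simp add: \<zeta>(5))
  then have \<zeta>\<rho>: "dominated \<zeta> \<rho>" by (rule dominated_trans[OF _ \<sigma>\<rho> \<sigma> \<rho>])
  have "dominated \<gamma> \<rho>" by (rule dominated_trans[OF \<gamma>(5) \<zeta>\<rho> \<zeta>(1) \<rho>])
  moreover have "\<not> dominated \<rho> \<gamma>"
    using dominated_trans[OF \<zeta>\<rho> _ \<rho> \<gamma>(1)] \<gamma>(7) by blast
  moreover have "ideal_of (principal_set \<gamma>) \<in> (SPL :: ('a \<Rightarrow> 'a) set set)"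
    unfolding SPL_iff using \<gamma>(1-3) by blast
  ultimately show "\<exists>L\<in>SPL. I \<subset> L \<and> L \<subset> J"
    unfolding I J using \<gamma>(4,6)
      ideal_of_principal_set_psubset_iff[OF \<xi>(1) \<gamma>(1)]
      ideal_of_principal_set_psubset_iff[OF \<gamma>(1) \<rho>] by blast
qed

lemma SPL_lower_dense: "lower_dense_in (SPL :: ('a \<Rightarrow> 'a) set set) PL"
  unfolding lower_dense_in_def
proof (intro ballI impI)
  fix I J :: "('a \<Rightarrow> 'a) set" assume "I \<in> SPL" "J \<in> PL" and JI: "J \<subset> I"
  obtain \<xi> where \<xi>: "\<xi> \<in> c0_star" "\<xi> 0 > 0" "regular \<xi>" and I: "I = ideal_of (principal_set \<xi>)"
    using \<open>I \<in> SPL\<close> unfolding SPL_iff by blast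
  obtain \<rho> where \<rho>: "\<rho> \<in> c0_star" "\<rho> 0 > 0" and J: "J = ideal_of (principal_set \<rho>)"
    using \<open>J \<in> PL\<close> unfolding PL_iff by blast
  have dom: "dominated \<rho> \<xi>" "\<not> dominated \<xi> \<rho>"
    using JI unfolding I J ideal_of_principal_set_psubset_iff[OF \<rho>(1) \<xi>(1)] by auto
  obtain C where C: "C > 0" "\<And>n. \<rho> n \<le> C * \<xi> n"
    using regular_dominated_iff(2)[OF \<xi>(1,3) \<rho>(1)] dom(1) by blast
  \<comment> \<open>Only a scaling is needed here: \<xi> is regular, so \<rho> lies below it
    pointwise up to the factor \<open>C\<close>.\<close>
  define \<sigma> where "\<sigma> n = \<rho> n / C" for n
  have "\<sigma> \<longlonglongrightarrow> 0 / C"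
    unfolding \<sigma>_def[abs_def] using C(1) by (intro tendsto_divide c0_starD(3)[OF \<rho>(1)] tendsto_const) auto
  then have \<sigma>: "\<sigma> \<in> c0_star"
    using C(1) c0_starD(1,4)[OF \<rho>(1)]
    by (auto simp: c0_star_def \<sigma>_def decseq_def intro!: divide_right_mono)
  have \<sigma>\<rho>: "dominated \<sigma> \<rho>"
    by (rule dominatedI[of _ "1 / C"]) (simp add: \<sigma>_def)
  have \<rho>\<sigma>: "dominated \<rho> \<sigma>"
    by (rule dominatedI[of _ C]) (use C(1) in \<open>simp add: \<sigma>_def\<close>)
  have \<sigma>\<xi>: "\<sigma> n \<le> \<xi> n" for n
    using C by (simp add: \<sigma>_def pos_divide_le_eq mult.commute)
  have "\<not> dominated \<xi> \<sigma>"
    using dominated_trans[OF _ \<sigma>\<rho> \<sigma> \<rho>(1)] dom(2) by blast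
  then obtain \<zeta> D where \<zeta>: "\<zeta> \<in> c0_star" "regular \<zeta>" "D > 0" "\<And>n. \<zeta> n \<le> D * \<xi> n" "\<And>n. \<sigma> n \<le> \<zeta> n"
    "\<nexists>M. M > 0 \<and> (\<forall>n. \<xi> n \<le> M * \<zeta> n)"
    using regular_majorant[OF \<xi>(1,3,2) \<sigma> \<sigma>\<xi>] by blast
  have "\<sigma> 0 > 0"
    using \<rho>(2) C(1) by (simp add: \<sigma>_def)
  with \<zeta>(5)[of 0] have \<zeta>0: "\<zeta> 0 > 0" by linarith
  \<comment> \<open>Now the smaller of the two regular sequences is the majorant \<zeta>. Its first
    term is positive because \<rho> generates a nonzero ideal, and almost monotonicity spreads
    positivity to all terms.\<close>
  obtain \<gamma> where \<gamma>: "\<gamma> \<in> c0_star" "regular \<gamma>" "\<gamma> 0 > 0" "dominated \<zeta> \<gamma>" "dominated \<gamma> \<xi>"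
    "\<not> dominated \<gamma> \<zeta>" "\<not> dominated \<xi> \<gamma>"
    using regular_geometric_mean_between[OF \<zeta>(1,2) \<zeta>0 \<xi>(1,3) \<zeta>(3,4,6)] .
  have "dominated \<sigma> \<zeta>" by (rule dominatedI[of _ 1]) (simp add: \<zeta>(5))
  then have \<rho>\<zeta>: "dominated \<rho> \<zeta>" by (rule dominated_trans[OF \<rho>\<sigma> _ \<sigma> \<zeta>(1)])
  have "dominated \<rho> \<gamma>" by (rule dominated_trans[OF \<rho>\<zeta> \<gamma>(4) \<zeta>(1) \<gamma>(1)])
  moreover have "\<not> dominated \<gamma> \<rho>"
    using dominated_trans[OF _ \<rho>\<zeta> \<rho>(1) \<zeta>(1)] \<gamma>(6) by blast
  moreover have "ideal_of (principal_set \<gamma>) \<in> (SPL :: ('a \<Rightarrow> 'a) set set)"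
    unfolding SPL_iff using \<gamma>(1-3) by blast
  ultimately show "\<exists>L\<in>SPL. J \<subset> L \<and> L \<subset> I"
    unfolding I J using \<gamma>(5,7)
      ideal_of_principal_set_psubset_iff[OF \<rho>(1) \<gamma>(1)]
      ideal_of_principal_set_psubset_iff[OF \<gamma>(1) \<xi>(1)] by blast
qed

end

theorem theorem3p10:
  assumes separable: "\<exists>D :: 'a::chilbert_space set. countable D \<and> closure D = UNIV"
    and infinite_dimensional: "\<nexists>B :: 'a set. finite B \<and> cspan B = UNIV"
  shows "upper_dense_in (SPL :: ('a \<Rightarrow> 'a) set set) PL \<and>
         lower_dense_in (SPL :: ('a \<Rightarrow> 'a) set set) PL"
  using SPL_upper_dense[OF infinite_dimensional] SPL_lower_dense[OF infinite_dimensional] ..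

end
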